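(* Let $\alpha\in(1,2)$, $\gamma\in\mathbb R$, $a_0=0$ and $a_1\in L^2(\Omega)$, and let $u$ be the solution of the fractional wave equation with initial values $a_0=0$ and $a_1$. Let $\{t_k\}_{k=1}^N$ be the set of positive roots of $t\mapsto E_{\alpha,2}(-t)$. Then $$\|a_1\|_{D((-\Delta)^{-\gamma})}\le C_T\,\|u(\cdot,T)\|_{D((-\Delta)^{1-\gamma})}$$ holds for every $T>0$ satisfying $T^\alpha\notin\bigcup_{k=1}^\infty\{\frac{t_1}{\lambda_k},\dots,\frac{t_N}{\lambda_k}\}$, where the constant $C_T>0$ depends only on $\alpha,\gamma,d,\Omega,T$. Moreover, if $\alpha\in(1,\frac43]$, then there exists a positive constant $C=C(\alpha,\gamma,d,\Omega)$ such that $$\|a_1\|_{D((-\Delta)^{-\gamma})}\le C\,T^{\alpha-1}\,\|u(\cdot,T)\|_{D((-\Delta)^{1-\gamma})}.$$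
   Context: $\Omega\subset\mathbb R^d$, $d\in\{1,2,3\}$, is a bounded domain with sufficiently smooth boundary. The fractional wave equation is $$\partial_t^\alpha u-\Delta u=0 \text{ in }\Omega\times(0,T),\quad u(x,0)=a_0(x),\ \ \tfrac{\partial}{\partial t}u(x,0)=a_1(x)\text{ in }\Omega,\quad u=0\text{ on }\partial\Omega\times(0,T),$$ where $\partial_t^\alpha\psi(t)=\frac1{\Gamma(2-\alpha)}\int_0^t(t-\tau)^{1-\alpha}\psi''(\tau)\,d\tau$ is the Caputo derivative of order $\alpha\in(1,2)$. The Mittag-Leffler function is $E_{\alpha,\beta}(z)=\sum_{k=0}^\infty\frac{z^k}{\Gamma(\alpha k+\beta)}$; for $\alpha\in(1,2)$, $E_{\alpha,2}(-t)$ has at most finitely many positive roots (possibly none, in which case the condition on $T$ is void). $\{\lambda_k,\varphi_k\}_{k\ge1}$ is the Dirichlet eigensystem of $-\Delta$ on $\Omega$, with $0<\lambda_1\le\lambda_2\le\cdots\to\infty$ and $\{\varphi_k\}$ an orthonormal basis of $L^2(\Omega)$. For $a_0=0$ and $a_1\in L^2(\Omega)$ the (unique weak) solution is $u(\cdot,t)=\sum_{n\ge1}tE_{\alpha,2}(-\lambda_nt^\alpha)(a_1,\varphi_n)\varphi_n$, where $(\cdot,\cdot)$ is the $L^2(\Omega)$ inner product. For $\gamma\in\mathbb R$, $\|\psi\|_{D((-\Delta)^\gamma)}=\left(\sum_{n\ge1}|\lambda_n^\gamma(\psi,\varphi_n)|^2\right)^{1/2}$ (a value in $[0,\infty]$)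.
   Formalization: In the second estimate the constant C is uniform only over T ≥ T_0 for each fixed T_0 > 0 and may depend on T_0; a C independent of all T > 0 is impossible, since a_1 = φ_1 would require 1 ≤ C λ_1 T^α E_{α,2}(-λ_1 T^α), whose right side tends to 0 as T → 0. *)

theory Defs
  imports "HOL-Analysis.Analysis"
begin

definition mittag_leffler :: "real \<Rightarrow> real \<Rightarrow> real \<Rightarrow> real" where
  "mittag_leffler \<alpha> \<beta> z = (\<Sum>k. z ^ k / Gamma (\<alpha> * real k + \<beta>))"

text \<open>The Caputo derivative of order \<open>1 < \<alpha> < 2\<close>. The Lebesgue integral of a non-integrable
  function is 0 by convention, so integrability is a separate predicate.\<close>

definition caputo_integrand :: "real \<Rightarrow> (real \<Rightarrow> real) \<Rightarrow> real \<Rightarrow> real \<Rightarrow> real" where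
  "caputo_integrand \<alpha> \<psi> t \<tau> = (t - \<tau>) powr (1 - \<alpha>) * deriv (deriv \<psi>) \<tau>"

definition caputo_differentiable :: "real \<Rightarrow> (real \<Rightarrow> real) \<Rightarrow> real \<Rightarrow> bool" where
  "caputo_differentiable \<alpha> \<psi> t \<longleftrightarrow>
     (\<forall>\<tau>\<in>{0<..<t}. \<psi> differentiable at \<tau> \<and> deriv \<psi> differentiable at \<tau>) \<and>
     set_integrable lborel {0<..<t} (caputo_integrand \<alpha> \<psi> t)"

definition caputo_deriv :: "real \<Rightarrow> (real \<Rightarrow> real) \<Rightarrow> real \<Rightarrow> real" where
  "caputo_deriv \<alpha> \<psi> t =
     1 / Gamma (2 - \<alpha>) * (LINT \<tau>:{0<..<t}|lborel. caputo_integrand \<alpha> \<psi> t \<tau>)"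

definition partial :: "'d::finite \<Rightarrow> (real^'d \<Rightarrow> real) \<Rightarrow> real^'d \<Rightarrow> real" where
  "partial i f x = frechet_derivative f (at x) (axis i 1)"

text \<open>\<open>Ck k S f\<close>: \<open>f\<close> is \<open>k\<close> times continuously differentiable on \<open>S\<close>; only used for open \<open>S\<close>.\<close>

primrec Ck :: "nat \<Rightarrow> (real^'d::finite) set \<Rightarrow> (real^'d \<Rightarrow> real) \<Rightarrow> bool" where
  "Ck 0 S f \<longleftrightarrow> continuous_on S f"
| "Ck (Suc k) S f \<longleftrightarrow> f differentiable_on S \<and> (\<forall>i. Ck k S (partial i f))"

text \<open>The boundary is locally a regular level set of a \<open>C^k\<close> function, with the domain lying
  on exactly one side of it.\<close>

definition Ck_boundary :: "nat \<Rightarrow> (real^'d::finite) set \<Rightarrow> bool" where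
  "Ck_boundary k \<Omega> \<longleftrightarrow>
     (\<forall>x\<in>frontier \<Omega>. \<exists>U \<rho>. open U \<and> x \<in> U \<and> Ck k U \<rho> \<and>
        (\<forall>y\<in>U. \<exists>i. partial i \<rho> y \<noteq> 0) \<and> \<Omega> \<inter> U = {y\<in>U. \<rho> y < 0})"

text \<open>Elements of \<open>L2 \<Omega>\<close> are functions, not classes: they are equal in the space
  when they agree almost everywhere on \<open>\<Omega>\<close>.\<close>

definition L2 :: "(real^'d::finite) set \<Rightarrow> (real^'d \<Rightarrow> real) set" where
  "L2 \<Omega> = {f. f \<in> borel_measurable (lebesgue_on \<Omega>) \<and> integrable (lebesgue_on \<Omega>) (\<lambda>x. (f x)\<^sup>2)}"

definition L2_inner :: "(real^'d::finite) set \<Rightarrow> (real^'d \<Rightarrow> real) \<Rightarrow> (real^'d \<Rightarrow> real) \<Rightarrow> real" where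
  "L2_inner \<Omega> f g = (LINT x|lebesgue_on \<Omega>. f x * g x)"

definition L2_norm :: "(real^'d::finite) set \<Rightarrow> (real^'d \<Rightarrow> real) \<Rightarrow> real" where
  "L2_norm \<Omega> f = sqrt (L2_inner \<Omega> f f)"

definition test_function :: "(real^'d::finite) set \<Rightarrow> (real^'d \<Rightarrow> real) \<Rightarrow> bool" where
  "test_function \<Omega> \<phi> \<longleftrightarrow>
     (\<forall>k. Ck k UNIV \<phi>) \<and> (\<exists>K. compact K \<and> K \<subseteq> \<Omega> \<and> (\<forall>x. x \<notin> K \<longrightarrow> \<phi> x = 0))"

definition has_weak_gradient ::
  "(real^'d::finite) set \<Rightarrow> (real^'d \<Rightarrow> real) \<Rightarrow> (real^'d \<Rightarrow> real^'d) \<Rightarrow> bool" where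
  "has_weak_gradient \<Omega> f g \<longleftrightarrow>
     (\<forall>i. (\<lambda>x. g x $ i) \<in> L2 \<Omega> \<and>
       (\<forall>\<phi>. test_function \<Omega> \<phi> \<longrightarrow>
          L2_inner \<Omega> f (partial i \<phi>) = - L2_inner \<Omega> (\<lambda>x. g x $ i) \<phi>))"

definition weak_gradient ::
  "(real^'d::finite) set \<Rightarrow> (real^'d \<Rightarrow> real) \<Rightarrow> real^'d \<Rightarrow> real^'d" where
  "weak_gradient \<Omega> f = (SOME g. has_weak_gradient \<Omega> f g)"

definition H1 :: "(real^'d::finite) set \<Rightarrow> (real^'d \<Rightarrow> real) set" where
  "H1 \<Omega> = {f \<in> L2 \<Omega>. \<exists>g. has_weak_gradient \<Omega> f g}"

text \<open>The closure of the test functions in \<open>H1 \<Omega>\<close>; membership encodes the homogeneous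
  Dirichlet boundary condition.\<close>

definition H10 :: "(real^'d::finite) set \<Rightarrow> (real^'d \<Rightarrow> real) set" where
  "H10 \<Omega> = {f \<in> H1 \<Omega>. \<exists>\<phi>. (\<forall>j::nat. test_function \<Omega> (\<phi> j)) \<and>
     (\<lambda>j. L2_norm \<Omega> (\<lambda>x. \<phi> j x - f x)) \<longlonglongrightarrow> 0 \<and>
     (\<forall>i. (\<lambda>j. L2_norm \<Omega> (\<lambda>x. partial i (\<phi> j) x - weak_gradient \<Omega> f x $ i)) \<longlonglongrightarrow> 0)}"

definition dirichlet_form ::
  "(real^'d::finite) set \<Rightarrow> (real^'d \<Rightarrow> real) \<Rightarrow> (real^'d \<Rightarrow> real) \<Rightarrow> real" where
  "dirichlet_form \<Omega> f g = (LINT x|lebesgue_on \<Omega>. weak_gradient \<Omega> f x \<bullet> weak_gradient \<Omega> g x)"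

definition L2_orthonormal_basis ::
  "(real^'d::finite) set \<Rightarrow> (nat \<Rightarrow> real^'d \<Rightarrow> real) \<Rightarrow> bool" where
  "L2_orthonormal_basis \<Omega> \<phi> \<longleftrightarrow>
     (\<forall>k. \<phi> k \<in> L2 \<Omega>) \<and>
     (\<forall>j k. L2_inner \<Omega> (\<phi> j) (\<phi> k) = (if j = k then 1 else 0)) \<and>
     (\<forall>f\<in>L2 \<Omega>. (\<lambda>N. L2_norm \<Omega> (\<lambda>x. f x - (\<Sum>k<N. L2_inner \<Omega> f (\<phi> k) * \<phi> k x))) \<longlonglongrightarrow> 0)"

text \<open>Indices start at 0, so \<open>lam k\<close> and \<open>\<phi> k\<close> are the usual \<open>\<lambda>\<^sub>k\<^sub>+\<^sub>1\<close> and
  \<open>\<phi>\<^sub>k\<^sub>+\<^sub>1\<close>. The eigenvalue equation is the variational form of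
  \<open>-\<Delta>\<phi> = \<lambda>\<phi>\<close> in \<open>\<Omega>\<close>, \<open>\<phi> = 0\<close> on the boundary.\<close>

definition dirichlet_eigensystem ::
  "(real^'d::finite) set \<Rightarrow> (nat \<Rightarrow> real) \<Rightarrow> (nat \<Rightarrow> real^'d \<Rightarrow> real) \<Rightarrow> bool" where
  "dirichlet_eigensystem \<Omega> lam \<phi> \<longleftrightarrow>
     0 < lam 0 \<and> incseq lam \<and> filterlim lam at_top sequentially \<and>
     (\<forall>k. \<phi> k \<in> H10 \<Omega> \<and>
        (\<forall>v\<in>H10 \<Omega>. dirichlet_form \<Omega> (\<phi> k) v = lam k * L2_inner \<Omega> (\<phi> k) v)) \<and>
     L2_orthonormal_basis \<Omega> \<phi>"

text \<open>\<open>u\<close> solves \<open>\<partial>\<^sub>t\<^sup>\<alpha> u - \<Delta>u = 0\<close> in \<open>\<Omega> \<times> (0,T)\<close> with \<open>u = 0\<close> on the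
  lateral boundary, \<open>u(0) = a0\<close> and \<open>u'(0) = a1\<close>, after testing in space against every
  \<open>v\<close> in \<open>H10 \<Omega>\<close>. The pairing \<open>\<psi>\<close> is only prescribed on \<open>[0,T]\<close>, hence the derivative at 0
  is one-sided.\<close>

definition weak_solution ::
  "(real^'d::finite) set \<Rightarrow> real \<Rightarrow> real \<Rightarrow> (real^'d \<Rightarrow> real) \<Rightarrow> (real^'d \<Rightarrow> real) \<Rightarrow>
     (real \<Rightarrow> real^'d \<Rightarrow> real) \<Rightarrow> bool" where
  "weak_solution \<Omega> \<alpha> T a0 a1 u \<longleftrightarrow>
     (\<forall>t\<in>{0..T}. u t \<in> L2 \<Omega>) \<and>
     (\<forall>t\<in>{0<..<T}. u t \<in> H10 \<Omega>) \<and>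
     (AE x in lebesgue_on \<Omega>. u 0 x = a0 x) \<and>
     (\<forall>v\<in>H10 \<Omega>. let \<psi> = (\<lambda>t. L2_inner \<Omega> (u t) v) in
        continuous_on {0..T} \<psi> \<and>
        (\<psi> has_real_derivative L2_inner \<Omega> a1 v) (at 0 within {0..T}) \<and>
        (\<forall>t\<in>{0<..<T}. caputo_differentiable \<alpha> \<psi> t \<and>
           caputo_deriv \<alpha> \<psi> t + dirichlet_form \<Omega> (u t) v = 0))"

text \<open>The norm of \<open>D((-\<Delta>)\<^sup>\<gamma>)\<close>; it takes the value \<open>\<infinity>\<close> where the series diverges.\<close>

definition D_norm ::
  "(real^'d::finite) set \<Rightarrow> (nat \<Rightarrow> real) \<Rightarrow> (nat \<Rightarrow> real^'d \<Rightarrow> real) \<Rightarrow> real \<Rightarrow>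
     (real^'d \<Rightarrow> real) \<Rightarrow> ennreal" where
  "D_norm \<Omega> lam \<phi> \<gamma> \<psi> =
     (let S = (\<Sum>n. ennreal (\<bar>lam n powr \<gamma> * L2_inner \<Omega> \<psi> (\<phi> n)\<bar>\<^sup>2))
      in if S = \<infinity> then \<infinity> else ennreal (sqrt (enn2real S)))"

definition mlf_roots :: "real \<Rightarrow> real set" where
  "mlf_roots \<alpha> = {t. 0 < t \<and> mittag_leffler \<alpha> 2 (- t) = 0}"

end

theory Submission
  imports Defs "HOL-Complex_Analysis.Complex_Analysis"
begin

text \<open>Pairing the solution with an eigenfunction \<open>\<phi>\<^sub>n\<close> gives a scalar function \<open>\<psi>\<close> with
  \<open>\<partial>\<^sub>t\<^sup>\<alpha> \<psi> + \<lambda>\<^sub>n \<psi> = 0\<close>, \<open>\<psi>(0) = 0\<close> and \<open>\<psi>'(0) = (a\<^sub>1, \<phi>\<^sub>n)\<close>. Taylor's formula and the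
  composition rule \<open>I\<^sup>\<alpha> I\<^bsup>2-\<alpha>\<^esup> = I\<^sup>2\<close> turn this into the Volterra equation
  \<open>\<psi>(t) = a t - \<lambda>\<^sub>n I\<^sup>\<alpha>\<psi>(t)\<close>, whose Picard iteration is the Mittag-Leffler series. Hence
  \<open>(u(T), \<phi>\<^sub>n) = (a\<^sub>1, \<phi>\<^sub>n) T E\<^bsub>\<alpha>,2\<^esub>(-\<lambda>\<^sub>n T\<^sup>\<alpha>)\<close> (lemma \<open>weak_solution_coefficient\<close>), and both
  estimates follow coefficientwise once \<open>z \<bar>E\<^bsub>\<alpha>,2\<^esub>(-z)\<bar>\<close> is bounded below by a positive
  constant at all \<open>z = \<lambda>\<^sub>n T\<^sup>\<alpha>\<close> (lemma \<open>D_norm_bound\<close>). Two eigensystems of the same domain have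
  the same set of eigenvalues, so the constant depends on the domain only.

  For large \<open>z\<close> the bound comes from the representation of \<open>t E\<^bsub>\<alpha>,2\<^esub>(-t\<^sup>\<alpha>)\<close> as the Laplace
  integral of a nonnegative density plus an exponentially damped oscillation (lemma
  \<open>ml_mode_decomp\<close>). Both sides have the same Laplace transform \<open>p\<^bsup>\<alpha>-2\<^esup> / (p\<^sup>\<alpha> + 1)\<close>: for the right
  hand side this is the residue theorem on a long rectangle in the variable \<open>w = ln s\<close>. The density
  behaves like \<open>r\<^bsup>\<alpha>-2\<^esup>\<close> at \<open>r = 0\<close>, which gives the lower bound \<open>c t\<^bsup>1-\<alpha>\<^esup>\<close>. When \<open>T\<^sup>\<alpha>\<close>
  avoids the exceptional set, only finitely many further values of \<open>z\<close> remain, all with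
  \<open>E\<^bsub>\<alpha>,2\<^esub>(-z) \<noteq> 0\<close>.

  For \<open>\<alpha> \<le> 4/3\<close> the point is that \<open>E\<^bsub>\<alpha>,2\<^esub>(-z)\<close> has no positive zero (lemma
  \<open>mittag_leffler_pos\<close>). The function \<open>(1 - cos x)\<^sup>2 \<ge> 0\<close> has the Laplace transform
  \<open>6 / (p (p\<^sup>2 + 1) (p\<^sup>2 + 4))\<close>, which is therefore completely monotone. Substituting
  \<open>p = s\<^bsup>\<alpha>/2\<^esup>\<close> and multiplying by \<open>s\<^bsup>-(2-3\<alpha>/2)\<^esup>/2\<close>, whose exponent is nonpositive exactly
  when \<open>\<alpha> \<le> 4/3\<close>, preserves complete monotonicity and yields the transform of
  \<open>t (E\<^bsub>\<alpha>,2\<^esub>(-t\<^sup>\<alpha>) - E\<^bsub>\<alpha>,2\<^esub>(-4t\<^sup>\<alpha>))\<close>. So this function is nonnegative (lemma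
  \<open>nonneg_of_laplace_cm_upto\<close>), that is \<open>E\<^bsub>\<alpha>,2\<^esub>(-z) \<ge> E\<^bsub>\<alpha>,2\<^esub>(-4z) \<ge> E\<^bsub>\<alpha>,2\<^esub>(-16z) \<ge> \<dots>\<close>,
  and the terms far out in this chain are positive by the bound for large arguments. For
  \<open>T \<ge> T\<^sub>0\<close> all \<open>z\<close> are at least \<open>\<lambda>\<^sub>1 T\<^sub>0\<^sup>\<alpha>\<close>, so compactness gives one constant for all of
  them (lemma \<open>mittag_leffler_lower\<close>).\<close>

section \<open>Laplace transforms and complete monotonicity\<close>

lemma has_bochner_integral_powr_exp:
  fixes s y :: real
  assumes "s > 0" "y > -1"
  shows "has_bochner_integral lborel (\<lambda>x. indicator {0..} x * (exp (- s * x) * x powr y))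
           (Gamma (y + 1) / s powr (y + 1))"
proof -
  have "has_bochner_integral lborel (\<lambda>t. indicator {0..} t * t powr (y + 1 - 1) / exp t)
          (Gamma (y + 1))"
  proof (rule has_bochner_integral_nn_integral)
    show "(\<integral>\<^sup>+ t. ennreal (indicator {0..} t * t powr (y + 1 - 1) / exp t) \<partial>lborel)
        = ennreal (Gamma (y + 1))"
      using Gamma_conv_nn_integral_real[of "y + 1"] assms by simp
  qed (use assms in \<open>auto intro!: AE_I2 Gamma_real_nonneg\<close>)
  hence "has_bochner_integral lborel
      (\<lambda>x. indicator {0..} (0 + s * x) * (0 + s * x) powr (y + 1 - 1) / exp (0 + s * x))
      (Gamma (y + 1) /\<^sub>R \<bar>s\<bar>)"
    by (subst (asm) lborel_has_bochner_integral_real_affine_iff[of s _ _ 0]) (use assms in auto)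
  hence "has_bochner_integral lborel
      (\<lambda>x. (indicator {0..} (0 + s * x) * (0 + s * x) powr (y + 1 - 1) / exp (0 + s * x)) / s powr y)
      (Gamma (y + 1) /\<^sub>R \<bar>s\<bar> / s powr y)"
    by (rule has_bochner_integral_divide_zero)
  also have "Gamma (y + 1) /\<^sub>R \<bar>s\<bar> / s powr y = Gamma (y + 1) / s powr (y + 1)"
    using assms by (simp add: powr_add field_simps)
  also have "(\<lambda>x. (indicator {0..} (0 + s * x) * (0 + s * x) powr (y + 1 - 1) / exp (0 + s * x)) / s powr y)
    = (\<lambda>x. indicator {0..} x * (exp (- s * x) * x powr y))"
  proof
    fix x :: real
    show "(indicator {0..} (0 + s * x) * (0 + s * x) powr (y + 1 - 1) / exp (0 + s * x)) / s powr y
      = indicator {0..} x * (exp (- s * x) * x powr y)"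
      using assms by (auto simp: indicator_def zero_le_mult_iff powr_mult exp_minus field_simps)
  qed
  finally show ?thesis .
qed

lemma integrable_power_exp:
  fixes s :: real
  assumes "s > 0"
  shows "integrable lborel (\<lambda>x. indicator {0..} x * (exp (- s * x) * x ^ n))"
proof -
  have "integrable lborel (\<lambda>x. indicator {0..} x * (exp (- s * x) * x powr real n))"
    using has_bochner_integral_powr_exp[OF assms, of "real n"] by (simp add: has_bochner_integral_iff)
  moreover have "AE x in lborel. indicator {0..} x * (exp (- s * x) * x powr real n)
     = indicator {0..} x * (exp (- s * x) * x ^ n)"
    using AE_lborel_singleton[of "0::real"]
    by eventually_elim (auto simp: indicator_def powr_realpow)
  ultimately show ?thesis
    by (subst integrable_cong_AE[symmetric]) auto
qed

lemma has_bochner_integral_exp_complex: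
  fixes q :: complex
  assumes q: "Re q > 0"
  shows "has_bochner_integral lborel (\<lambda>x. indicator {0..} x *\<^sub>R exp (- (of_real x * q))) (1 / q)"
proof -
  have q0: "q \<noteq> 0" using q by auto
  have int: "integrable lborel (\<lambda>x. indicator {0..} x *\<^sub>R exp (- (of_real x * q)))"
  proof (rule Bochner_Integration.integrable_bound)
    show "integrable lborel (\<lambda>x. indicator {0..} x * (exp (- Re q * x) * x ^ 0))"
      using integrable_power_exp[OF q, of 0] by simp
  qed (auto simp: indicator_def mult.commute)
  have sint: "set_integrable lborel (einterval 0 \<infinity>) (\<lambda>x. exp (- (of_real x * q)))"
  proof -
    have "set_integrable lborel {0..} (\<lambda>x. exp (- (of_real x * q)))"
      unfolding set_integrable_def using int by simp
    thus ?thesis by (rule set_integrable_subset) (auto simp: einterval_def)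
  qed
  have lim: "((\<lambda>x. - exp (- (of_real x * q)) / q) \<longlongrightarrow> 0) at_top"
  proof (rule tendsto_norm_zero_cancel)
    have "((\<lambda>x::real. exp (- (Re q * x))) \<longlongrightarrow> 0) at_top"
      by (rule filterlim_compose[OF exp_at_bot])
        (simp add: filterlim_uminus_at_bot filterlim_tendsto_pos_mult_at_top[OF tendsto_const q filterlim_ident])
    hence "((\<lambda>x::real. exp (- (Re q * x)) / norm q) \<longlongrightarrow> 0 / norm q) at_top"
      using q0 by (intro tendsto_intros) auto
    thus "((\<lambda>x. norm (- exp (- (of_real x * q)) / q)) \<longlongrightarrow> 0) at_top"
      by (simp add: norm_divide mult.commute)
  qed
  have lim0: "((\<lambda>x::real. - exp (- (of_real x * q)) / q) \<longlongrightarrow> - 1 / q) (at_right 0)"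
  proof -
    have "((\<lambda>x::real. - exp (- (of_real x * q)) / q) \<longlongrightarrow> - exp (- (of_real 0 * q)) / q) (at_right 0)"
      using q0 by (intro tendsto_intros)
    thus ?thesis by simp
  qed
  have "(LBINT x=0..\<infinity>. exp (- (of_real x * q))) = 0 - (- 1 / q)"
  proof (rule interval_integral_FTC_integrable[where F = "\<lambda>x. - exp (- (of_real x * q)) / q"])
    show "((\<lambda>x. - exp (- (of_real x * q)) / q) has_vector_derivative exp (- (of_real x * q))) (at x)" for x
    proof -
      have "((\<lambda>z. - exp (- (z * q)) / q) has_field_derivative exp (- (of_real x * q))) (at (of_real x))"
        using q0 by (auto intro!: derivative_eq_intros)
      from has_vector_derivative_real_field[OF this] show ?thesis .
    qed
    show "isCont (\<lambda>x. exp (- (of_real x * q))) x" for x by (intro continuous_intros)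
    show "(((\<lambda>x. - exp (- (of_real x * q)) / q) \<circ> real_of_ereal) \<longlongrightarrow> 0) (at_left \<infinity>)"
      using lim by (simp add: ereal_tendsto_simps1)
    show "(((\<lambda>x. - exp (- (of_real x * q)) / q) \<circ> real_of_ereal) \<longlongrightarrow> - 1 / q) (at_right 0)"
      using lim0 by (simp add: zero_ereal_def ereal_tendsto_simps1)
  qed (use sint in auto)
  hence "(LINT x|lborel. indicator {0<..} x *\<^sub>R exp (- (of_real x * q))) = 1 / q"
    by (simp add: interval_lebesgue_integral_def set_lebesgue_integral_def einterval_def zero_ereal_def greaterThan_def)
  also have "(LINT x|lborel. indicator {0<..} x *\<^sub>R exp (- (of_real x * q)))
      = (LINT x|lborel. indicator {0..} x *\<^sub>R exp (- (of_real x * q)))"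
  proof (rule integral_cong_AE)
    show "AE x in lborel. indicator {0<..} x *\<^sub>R exp (- (of_real x * q)) = indicator {0..} x *\<^sub>R exp (- (of_real x * q))"
      using AE_lborel_singleton[of "0::real"] by eventually_elim (auto simp: indicator_def)
  qed auto
  finally show ?thesis using int by (simp add: has_bochner_integral_iff)
qed

lemma has_bochner_integral_exp_cos:
  fixes p b :: real
  assumes p: "p > 0"
  shows "has_bochner_integral lborel (\<lambda>x. indicator {0..} x * (exp (- p * x) * cos (b * x))) (p / (p\<^sup>2 + b\<^sup>2))"
proof -
  have "has_bochner_integral lborel (\<lambda>x. indicator {0..} x *\<^sub>R exp (- (of_real x * Complex p b))) (1 / Complex p b)"
    using p by (intro has_bochner_integral_exp_complex) simp
  from has_bochner_integral_Re[OF this] show ?thesis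
    by (simp add: Re_exp Re_divide mult.commute)
qed

text \<open>Measurable functions of exponential type on the half-line. Measurability is asked on all of \<open>\<real>\<close>,
  the bound only for \<open>x \<ge> 0\<close>.\<close>

definition exp_bounded :: "real \<Rightarrow> (real \<Rightarrow> real) \<Rightarrow> bool" where
  "exp_bounded b f \<longleftrightarrow> f \<in> borel_measurable borel \<and> (\<exists>M\<ge>0. \<forall>x\<ge>0. \<bar>f x\<bar> \<le> M * exp (b * x))"

text \<open>The Laplace transform \<open>\<integral>\<^sub>0\<^sup>\<infinity> e\<^bsup>-sx\<^esup> f(x) dx\<close>; it is only meaningful where the integrand
  is integrable.\<close>

definition laplace :: "(real \<Rightarrow> real) \<Rightarrow> real \<Rightarrow> real" where
  "laplace f s = (LINT x|lborel. indicator {0..} x * (exp (- s * x) * f x))"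

lemma exp_boundedE:
  assumes "exp_bounded b f"
  obtains M where "M \<ge> 0" "\<And>x. x \<ge> 0 \<Longrightarrow> \<bar>f x\<bar> \<le> M * exp (b * x)" "f \<in> borel_measurable borel"
  using assms by (auto simp: exp_bounded_def)

lemma exp_bounded_diff:
  assumes "exp_bounded b f" "exp_bounded b g"
  shows "exp_bounded b (\<lambda>x. f x - g x)"
proof -
  from assms(1) obtain M where M: "M \<ge> 0" "\<And>x. x \<ge> 0 \<Longrightarrow> \<bar>f x\<bar> \<le> M * exp (b * x)" "f \<in> borel_measurable borel"
    by (elim exp_boundedE) blast 
  from assms(2) obtain N where N: "N \<ge> 0" "\<And>x. x \<ge> 0 \<Longrightarrow> \<bar>g x\<bar> \<le> N * exp (b * x)" "g \<in> borel_measurable borel"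
    by (elim exp_boundedE) blast
  have "\<bar>f x - g x\<bar> \<le> (M + N) * exp (b * x)" if "x \<ge> 0" for x
    using M(2)[OF that] N(2)[OF that] by (auto simp: distrib_right)
  with M N show ?thesis unfolding exp_bounded_def by (intro conjI exI[of _ "M + N"]) auto
qed

lemma exp_bounded_add:
  assumes "exp_bounded b f" "exp_bounded b g"
  shows "exp_bounded b (\<lambda>x. f x + g x)"
proof -
  have "exp_bounded b (\<lambda>x. 0)" by (auto simp: exp_bounded_def intro!: exI[of _ 0])
  from exp_bounded_diff[OF assms(1) exp_bounded_diff[OF this assms(2)]] show ?thesis by simp
qed

lemma exp_bounded_mono:
  assumes "exp_bounded b f" "b \<le> c"
  shows "exp_bounded c f"
proof -
  from assms(1) obtain M where M: "M \<ge> 0" "\<And>x. x \<ge> 0 \<Longrightarrow> \<bar>f x\<bar> \<le> M * exp (b * x)" "f \<in> borel_measurable borel"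
    by (elim exp_boundedE) blast 
  have "\<bar>f x\<bar> \<le> M * exp (c * x)" if "x \<ge> 0" for x
    using M(2)[OF that] that assms(2) M(1)
    by (intro order.trans[OF M(2)[OF that]] mult_left_mono) (auto intro: mult_right_mono)
  with M show ?thesis unfolding exp_bounded_def by blast
qed

lemma laplace_integrable_power:
  assumes "exp_bounded b f" "s > b"
  shows "integrable lborel (\<lambda>x. indicator {0..} x * (exp (- s * x) * (x ^ n * f x)))"
proof -
  from assms(1) obtain M where M: "M \<ge> 0" "\<And>x. x \<ge> 0 \<Longrightarrow> \<bar>f x\<bar> \<le> M * exp (b * x)" 
    and [measurable]: "f \<in> borel_measurable borel"
    by (elim exp_boundedE) blast 
  show ?thesis
  proof (rule Bochner_Integration.integrable_bound)
    show "integrable lborel (\<lambda>x. M * (indicator {0..} x * (exp (- (s - b) * x) * x ^ n)))"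
      using assms by (intro integrable_mult_right integrable_power_exp) auto
    show "AE x in lborel. norm (indicator {0..} x * (exp (- s * x) * (x ^ n * f x)))
        \<le> norm (M * (indicator {0..} x * (exp (- (s - b) * x) * x ^ n)))"
    proof (intro AE_I2)
      fix x :: real
      show "norm (indicator {0..} x * (exp (- s * x) * (x ^ n * f x)))
        \<le> norm (M * (indicator {0..} x * (exp (- (s - b) * x) * x ^ n)))"
      proof (cases "x \<ge> 0")
        case True
        have "exp (- s * x) * x ^ n * \<bar>f x\<bar> \<le> exp (- s * x) * x ^ n * (M * exp (b * x))"
          using M True by (intro mult_left_mono) auto
        also have "\<dots> = M * (exp (- (s - b) * x) * x ^ n)"
          by (simp add: exp_add[symmetric] algebra_simps exp_diff exp_minus field_simps)
        finally show ?thesis using True M by (simp add: abs_mult mult_ac)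
      qed auto
    qed
  qed measurable
qed

lemma exp_taylor_bound:
  fixes z :: real
  shows "\<bar>exp z - 1 - z\<bar> \<le> z\<^sup>2 * exp \<bar>z\<bar>"
proof -
  obtain t where t: "\<bar>t\<bar> \<le> \<bar>z\<bar>" "exp z = (\<Sum>m<2. z ^ m / fact m) + exp t / fact 2 * z ^ 2"
    using Maclaurin_exp_le[of z 2] by blast
  have "exp z - 1 - z = exp t / 2 * z\<^sup>2"
    using t(2) by (simp add: numeral_2_eq_2)
  hence "\<bar>exp z - 1 - z\<bar> = exp t / 2 * z\<^sup>2" by (simp only: abs_mult) simp
  also have "\<dots> \<le> exp \<bar>z\<bar> * z\<^sup>2"
  proof (intro mult_right_mono)
    have "exp t \<le> exp \<bar>z\<bar>" using t(1) by simp
    thus "exp t / 2 \<le> exp \<bar>z\<bar>" using exp_gt_zero[of t] by linarith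
  qed auto
  finally show ?thesis by (simp add: mult.commute)
qed

text \<open>Differentiation under the integral sign. The difference quotient is compared with the derivative by
  the second order bound on the exponential, uniformly for \<open>\<bar>h\<bar> \<le> d\<close>.\<close>

lemma laplace_has_derivative:
  assumes f: "exp_bounded b f" and s: "s > b"
  shows "(laplace (\<lambda>x. x ^ n * f x) has_real_derivative
            - laplace (\<lambda>x. x ^ Suc n * f x) s) (at s)"
proof -
  define d where "d = (s - b) / 2"
  have d: "d > 0" "s - d > b" using s by (auto simp: d_def field_simps)
  let ?L = "\<lambda>n. laplace (\<lambda>x. x ^ n * f x)"
  let ?I = "\<lambda>n s x. indicator {0..} x * (exp (- s * x) * (x ^ n * f x))"
  define C where "C = (LINT x|lborel. \<bar>?I (Suc (Suc n)) (s - d) x\<bar>)"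
  have int: "integrable lborel (?I n s)" if "s > b" for n s
    using laplace_integrable_power[OF f that] .
  have bound: "\<bar>?L n (s + h) - ?L n s + h * ?L (Suc n) s\<bar> \<le> h\<^sup>2 * C" if h: "\<bar>h\<bar> \<le> d" for h
  proof -
    have sh: "s + h > b" using h d by (auto simp: abs_le_iff)
    have eq: "?L n (s + h) - ?L n s + h * ?L (Suc n) s
       = (LINT x|lborel. ?I n (s + h) x - ?I n s x + h * ?I (Suc n) s x)"
      unfolding laplace_def
      by (simp only: Bochner_Integration.integral_add[OF Bochner_Integration.integrable_diff[OF int[OF sh] int[OF s]]
            integrable_mult_right[OF int[OF s]]]
          Bochner_Integration.integral_diff[OF int[OF sh] int[OF s]] integral_mult_right_zero)
    have "\<bar>?L n (s + h) - ?L n s + h * ?L (Suc n) s\<bar>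
        \<le> (LINT x|lborel. h\<^sup>2 * \<bar>?I (Suc (Suc n)) (s - d) x\<bar>)"
      unfolding eq real_norm_def[symmetric]
    proof (rule Bochner_Integration.integral_norm_bound_integral)
      show "integrable lborel (\<lambda>x. ?I n (s + h) x - ?I n s x + h * ?I (Suc n) s x)"
        using int[OF s] int[OF sh]
        by (intro Bochner_Integration.integrable_add Bochner_Integration.integrable_diff integrable_mult_right)
      show "integrable lborel (\<lambda>x. h\<^sup>2 * norm (?I (Suc (Suc n)) (s - d) x))"
        using int[OF d(2)] by (intro integrable_mult_right integrable_norm)
      fix x :: real
      show "norm (?I n (s + h) x - ?I n s x + h * ?I (Suc n) s x) \<le> h\<^sup>2 * norm (?I (Suc (Suc n)) (s - d) x)"
      proof (cases "x \<ge> 0")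
        case True
        have hx: "\<bar>- h * x\<bar> \<le> d * x" using h True by (auto simp: abs_mult intro: mult_right_mono)
        have "?I n (s + h) x - ?I n s x + h * ?I (Suc n) s x
           = (exp (- s * x) * (x ^ n * f x)) * (exp (- h * x) - 1 - (- h * x))"
          using True by (simp add: algebra_simps exp_add exp_diff exp_minus field_simps)
        hence "norm (?I n (s + h) x - ?I n s x + h * ?I (Suc n) s x)
           = (exp (- s * x) * (x ^ n * \<bar>f x\<bar>)) * \<bar>exp (- h * x) - 1 - (- h * x)\<bar>"
          using True by (simp add: abs_mult)
        also have "\<dots> \<le> (exp (- s * x) * (x ^ n * \<bar>f x\<bar>)) * ((- h * x)\<^sup>2 * exp (d * x))"
          using True hx
          by (intro mult_left_mono order.trans[OF exp_taylor_bound]) auto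
        also have "\<dots> = h\<^sup>2 * norm (?I (Suc (Suc n)) (s - d) x)"
          using True by (simp add: abs_mult power2_eq_square algebra_simps exp_add exp_diff exp_minus field_simps)
        finally show ?thesis .
      qed auto
    qed
    also have "\<dots> = h\<^sup>2 * C" by (simp add: C_def)
    finally show ?thesis .
  qed
  show ?thesis
    unfolding DERIV_def
  proof -
    show "(\<lambda>h. (?L n (s + h) - ?L n s) / h) \<midarrow>0\<rightarrow> - ?L (Suc n) s"
    proof (rule LIM_zero_cancel, rule Lim_null_comparison[where g = "\<lambda>h. \<bar>h\<bar> * C"])
      show "((\<lambda>h. \<bar>h\<bar> * C) \<longlongrightarrow> 0) (at 0)" by (auto intro!: tendsto_eq_intros)
      have "eventually (\<lambda>h. \<bar>h\<bar> \<le> d \<and> h \<noteq> 0) (at (0::real))"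
        using d(1) by (auto simp: eventually_at dist_real_def intro!: exI[of _ d])
      thus "eventually (\<lambda>h. norm ((?L n (s + h) - ?L n s) / h - - ?L (Suc n) s) \<le> \<bar>h\<bar> * C) (at 0)"
      proof eventually_elim
        case (elim h)
        have "norm ((?L n (s + h) - ?L n s) / h - - ?L (Suc n) s)
            = \<bar>?L n (s + h) - ?L n s + h * ?L (Suc n) s\<bar> / \<bar>h\<bar>"
          using elim by (simp add: field_simps flip: abs_divide)
        also have "\<dots> \<le> (h\<^sup>2 * C) / \<bar>h\<bar>"
          using bound[of h] elim by (intro divide_right_mono) auto
        also have "\<dots> = \<bar>h\<bar> * C" using elim by (simp add: power2_eq_square abs_if field_simps)
        finally show ?case .
      qed
    qed
  qed
qed

text \<open>\<open>cm_upto n c F\<close>: on \<open>(c, \<infinity>)\<close> the function \<open>F\<close> is \<open>n\<close> times differentiable and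
  \<open>(-1)\<^sup>k F\<^bsup>(k)\<^esup> \<ge> 0\<close> for \<open>k \<le> n\<close>. Complete monotonicity is \<open>cm_upto n c F\<close> for all \<open>n\<close>.
  The function \<open>D\<close> is \<open>-F'\<close>.\<close>

primrec cm_upto :: "nat \<Rightarrow> real \<Rightarrow> (real \<Rightarrow> real) \<Rightarrow> bool" where
  "cm_upto 0 c F \<longleftrightarrow> (\<forall>s>c. F s \<ge> 0)"
| "cm_upto (Suc n) c F \<longleftrightarrow> (\<forall>s>c. F s \<ge> 0) \<and>
     (\<exists>D. (\<forall>s>c. (F has_real_derivative - D s) (at s)) \<and> cm_upto n c D)"

lemma cm_upto_SucD: "cm_upto (Suc n) c F \<Longrightarrow> cm_upto n c F"
  by (induction n arbitrary: F) auto

lemma cm_upto_weaken: "cm_upto n c F \<Longrightarrow> c \<le> c' \<Longrightarrow> cm_upto n c' F"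
proof (induction n arbitrary: F)
  case (Suc n)
  then obtain D where "\<forall>s>c. (F has_real_derivative - D s) (at s)" "cm_upto n c D" "\<forall>s>c. F s \<ge> 0" by auto
  with Suc show ?case by (auto intro!: exI[of _ D])
qed auto

lemma cm_upto_cong:
  assumes "cm_upto n c F" "\<And>s. s > c \<Longrightarrow> F s = G s"
  shows "cm_upto n c G"
proof (cases n)
  case 0
  with assms show ?thesis by auto
next
  case (Suc m)
  with assms(1) obtain D where D: "\<forall>s>c. (F has_real_derivative - D s) (at s)" "cm_upto m c D" "\<forall>s>c. F s \<ge> 0"
    by auto
  have "(G has_real_derivative - D s) (at s)" if "s > c" for s
  proof (rule DERIV_cong_ev[THEN iffD1, OF refl _ refl])
    show "(F has_real_derivative - D s) (at s)" using D(1) that by blast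
    have "eventually (\<lambda>x. x > c) (nhds s)" using that by (auto intro: eventually_nhds_in_open[of "{c<..}", simplified])
    thus "eventually (\<lambda>x. F x = G x) (nhds s)" by eventually_elim (use assms(2) in auto)
  qed
  with D assms(2) Suc show ?thesis by auto
qed

lemma cm_upto_add: "cm_upto n c F \<Longrightarrow> cm_upto n c G \<Longrightarrow> cm_upto n c (\<lambda>s. F s + G s)"
proof (induction n arbitrary: F G)
  case (Suc n)
  then obtain D E where "\<forall>s>c. (F has_real_derivative - D s) (at s)" "cm_upto n c D"
    "\<forall>s>c. (G has_real_derivative - E s) (at s)" "cm_upto n c E" "\<forall>s>c. F s \<ge> 0" "\<forall>s>c. G s \<ge> 0"
    by auto
  with Suc.IH[of D E] show ?case
    by (auto intro!: exI[of _ "\<lambda>s. D s + E s"] derivative_eq_intros)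
qed auto

lemma cm_upto_mult: "cm_upto n c F \<Longrightarrow> cm_upto n c G \<Longrightarrow> cm_upto n c (\<lambda>s. F s * G s)"
proof (induction n arbitrary: F G)
  case (Suc n)
  then obtain D E where *: "\<forall>s>c. (F has_real_derivative - D s) (at s)" "cm_upto n c D"
    "\<forall>s>c. (G has_real_derivative - E s) (at s)" "cm_upto n c E" "\<forall>s>c. F s \<ge> 0" "\<forall>s>c. G s \<ge> 0"
    by auto
  have "cm_upto n c (\<lambda>s. D s * G s + F s * E s)"
    using *(2,4) Suc.prems[THEN cm_upto_SucD] by (intro cm_upto_add Suc.IH)
  with * show ?case
    by (auto intro!: exI[of _ "\<lambda>s. D s * G s + F s * E s"] derivative_eq_intros simp: mult_ac)
qed auto

text \<open>A completely monotone function of a positive function with completely monotone derivative is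
  completely monotone: \<open>-(F \<circ> G)' = (-F' \<circ> G) G'\<close>.\<close>

lemma cm_upto_compose:
  assumes "\<And>s. s > c \<Longrightarrow> G s > 0" "\<And>s. s > c \<Longrightarrow> (G has_real_derivative E s) (at s)" 
    and "\<And>n. cm_upto n c E" and "cm_upto n 0 F"
  shows "cm_upto n c (\<lambda>s. F (G s))"
  using assms(4)
proof (induction n arbitrary: F)
  case 0
  with assms(1) show ?case by auto
next
  case (Suc n)
  then obtain D where D: "\<forall>s>0. (F has_real_derivative - D s) (at s)" "cm_upto n 0 D" "\<forall>s>0. F s \<ge> 0"
    by auto
  have "cm_upto n c (\<lambda>s. D (G s) * E s)"
    by (intro cm_upto_mult Suc.IH D assms(3))
  moreover have "((\<lambda>s. F (G s)) has_real_derivative - (D (G s) * E s)) (at s)" if "s > c" for s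
    using DERIV_chain2[of F "- D (G s)" G s "E s"] D(1) assms(1,2)[OF that] by auto
  ultimately show ?case
    unfolding cm_upto.simps using D(3) assms(1)
    by (intro conjI exI[of _ "\<lambda>s. D (G s) * E s"]) auto
qed

lemma cm_upto_powr:
  assumes "k \<ge> 0" "b \<ge> 0"
  shows "cm_upto n 0 (\<lambda>s. k * s powr (- b))"
  using assms
proof (induction n arbitrary: k b)
  case (Suc n)
  have "cm_upto n 0 (\<lambda>s. (k * b) * s powr (- (b + 1)))"
    using Suc.prems by (intro Suc.IH) auto
  moreover have "((\<lambda>s. k * s powr (- b)) has_real_derivative - ((k * b) * s powr (- (b + 1)))) (at s)"
    if "s > 0" for s
    using that by (auto intro!: derivative_eq_intros simp: mult_ac)
  ultimately show ?case
    unfolding cm_upto.simps using Suc.prems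
    by (intro conjI exI[of _ "\<lambda>s. (k * b) * s powr (- (b + 1))"]) auto
qed auto

lemma cm_upto_laplace:
  assumes "exp_bounded c w" "\<And>x. x \<ge> 0 \<Longrightarrow> w x \<ge> 0"
  shows "cm_upto n c (laplace (\<lambda>x. x ^ m * w x))"
proof (induction n arbitrary: m)
  case 0
  show ?case using assms(2)
    by (auto simp: laplace_def indicator_def intro!: Bochner_Integration.integral_nonneg)
next
  case (Suc n)
  have "laplace (\<lambda>x. x ^ m * w x) s \<ge> 0" for s
    using assms(2) by (auto simp: laplace_def indicator_def intro!: Bochner_Integration.integral_nonneg)
  moreover have "(laplace (\<lambda>x. x ^ m * w x) has_real_derivative - laplace (\<lambda>x. x ^ Suc m * w x) s) (at s)"
    if "s > c" for s using laplace_has_derivative[OF assms(1) that] .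
  ultimately show ?case using Suc.IH[of "Suc m"] by auto
qed

text \<open>The derivatives of a Laplace transform are, up to sign, the transforms of \<open>x\<^sup>n f(x)\<close>; derivatives
  are unique, so the sign conditions pass to these moments.\<close>

lemma laplace_moment_nonneg:
  assumes "exp_bounded c f" "s > c" "cm_upto n c (laplace (\<lambda>x. x ^ m * f x))"
  shows "laplace (\<lambda>x. x ^ (m + n) * f x) s \<ge> 0"
  using assms(3)
proof (induction n arbitrary: m)
  case 0
  with assms(2) show ?case by auto
next
  case (Suc n)
  then obtain D where D: "\<forall>s>c. (laplace (\<lambda>x. x ^ m * f x) has_real_derivative - D s) (at s)" "cm_upto n c D"
    by auto
  have "D s = laplace (\<lambda>x. x ^ Suc m * f x) s" if "s > c" for s
    using DERIV_unique[OF D(1)[rule_format, OF that] laplace_has_derivative[OF assms(1) that]] by simp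
  with D(2) have "cm_upto n c (laplace (\<lambda>x. x ^ Suc m * f x))"
    by (rule cm_upto_cong) 
  from Suc.IH[OF this] show ?case by simp
qed

section \<open>Recovering a function from the moments of its Laplace transform\<close>

text \<open>The function \<open>y e\<^bsup>1-y\<^esup>\<close> has its strict maximum \<open>1\<close> at \<open>y = 1\<close>, so its powers
  concentrate there.\<close>

lemma peak_mono:
  fixes a b :: real
  assumes "0 \<le> a" "a \<le> b" "b \<le> 1"
  shows "a * exp (1 - a) \<le> b * exp (1 - b)"
proof (rule DERIV_nonneg_imp_nondecreasing[OF assms(2)])
  fix x assume "a \<le> x" "x \<le> b"
  thus "\<exists>y. ((\<lambda>x. x * exp (1 - x)) has_real_derivative y) (at x) \<and> y \<ge> 0"
    using assms by (intro exI[of _ "(1 - x) * exp (1 - x)"]) (auto intro!: derivative_eq_intros simp: algebra_simps)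
qed

lemma peak_antimono:
  fixes a b :: real
  assumes "1 \<le> a" "a \<le> b"
  shows "b * exp (1 - b) \<le> a * exp (1 - a)"
proof (rule DERIV_nonpos_imp_nonincreasing[OF assms(2)])
  fix x assume "a \<le> x" "x \<le> b"
  thus "\<exists>y. ((\<lambda>x. x * exp (1 - x)) has_real_derivative y) (at x) \<and> y \<le> 0"
    using assms by (intro exI[of _ "(1 - x) * exp (1 - x)"])
      (auto intro!: derivative_eq_intros mult_nonpos_nonneg simp: algebra_simps)
qed

lemma peak_less_1:
  fixes y :: real
  assumes "y \<noteq> 1"
  shows "y * exp (1 - y) < 1"
proof -
  have "y < exp (y - 1)"
  proof (cases "y > 0")
    case True
    with assms have "ln y < y - 1"
      using ln_eq_minus_one[of y] ln_le_minus_one[of y] by linarith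
    with True show ?thesis by (metis exp_less_mono exp_ln)
  qed (use exp_gt_zero[of "y - 1"] in linarith)
  thus ?thesis by (simp add: exp_diff field_simps)
qed

text \<open>The principle behind the Post inversion formula. With \<open>s = n / t\<close> the weight \<open>x\<^sup>n e\<^bsup>-sx\<^esup>\<close> is
  a multiple of \<open>v(x)\<^sup>n\<close>, where \<open>v(x) = (x/t) e\<^bsup>1-x/t\<^esup>\<close> peaks at \<open>x = t\<close>. If \<open>f(t)\<close> were
  negative, the part of the moment near \<open>t\<close>, of order at least \<open>\<rho>'\<^sup>n\<close>, would outweigh the rest,
  of order at most \<open>\<rho>\<^sup>n\<close> with \<open>\<rho> < \<rho>'\<close>.\<close>

lemma nonneg_of_laplace_moments:
  assumes f: "exp_bounded b f" and cont: "isCont f t" and t: "t > 0"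
    and mom: "\<And>n s. s > c \<Longrightarrow> laplace (\<lambda>x. x ^ n * f x) s \<ge> 0"
  shows "f t \<ge> 0"
proof (rule ccontr)
  assume "\<not> f t \<ge> 0"
  hence neg: "f t < 0" by simp
  from f obtain M where M: "M \<ge> 0" "\<And>x. x \<ge> 0 \<Longrightarrow> \<bar>f x\<bar> \<le> M * exp (b * x)"
    and [measurable]: "f \<in> borel_measurable borel"
    by (elim exp_boundedE) blast
  define \<delta> where "\<delta> = - f t / 2"
  have \<delta>: "\<delta> > 0" using neg by (simp add: \<delta>_def)
  have "eventually (\<lambda>x. f x < - \<delta>) (nhds t)"
    using order_tendstoD(2)[OF cont[unfolded isCont_def], of "-\<delta>"] neg
    by (auto simp: \<delta>_def eventually_at_filter elim!: eventually_mono)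
  then obtain \<eta>0 where \<eta>0: "\<eta>0 > 0" "\<And>x. \<bar>x - t\<bar> < \<eta>0 \<Longrightarrow> f x < - \<delta>"
    by (auto simp: eventually_nhds_metric dist_real_def)
  define \<eta> where "\<eta> = min (\<eta>0 / 2) (t / 2)"
  have \<eta>: "\<eta> > 0" "\<eta> < t" "\<And>x. \<bar>x - t\<bar> \<le> \<eta> \<Longrightarrow> f x < - \<delta>"
    using \<eta>0 t by (auto simp: \<eta>_def min_def split: if_splits)
  define v where "v = (\<lambda>x::real. (x / t) * exp (1 - x / t))"
  have v_nonneg: "v x \<ge> 0" if "x \<ge> 0" for x using that t by (simp add: v_def)
  define \<rho> where "\<rho> = max (v (t - \<eta>)) (v (t + \<eta>))"
  have "v (t - \<eta>) < 1" "v (t + \<eta>) < 1"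
    unfolding v_def using t \<eta> by (auto intro!: peak_less_1 simp del: times_divide_eq_left)
  moreover have "v (t + \<eta>) > 0" using t \<eta> by (simp add: v_def)
  ultimately have \<rho>: "0 < \<rho>" "\<rho> < 1" by (auto simp: \<rho>_def)
  have out: "v x \<le> \<rho>" if "x \<ge> 0" "\<bar>x - t\<bar> > \<eta>" for x
  proof (cases "x \<le> t")
    case True
    with that have "x / t \<le> (t - \<eta>) / t" using t by (intro divide_right_mono) auto
    moreover have "(t - \<eta>) / t \<le> 1" "0 \<le> x / t" using t \<eta> that by (auto simp: field_simps)
    ultimately have "v x \<le> v (t - \<eta>)" unfolding v_def by (intro peak_mono)
    thus ?thesis by (simp add: \<rho>_def)
  next
    case False
    with that have "(t + \<eta>) / t \<le> x / t" using t by (intro divide_right_mono) auto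
    moreover have "1 \<le> (t + \<eta>) / t" using t \<eta> by (simp add: field_simps)
    ultimately have "v x \<le> v (t + \<eta>)" unfolding v_def by (intro peak_antimono)
    thus ?thesis by (simp add: \<rho>_def)
  qed
  define \<rho>' where "\<rho>' = (1 + \<rho>) / 2"
  have \<rho>': "\<rho> < \<rho>'" "\<rho>' < 1" "\<rho>' > 0" using \<rho> by (auto simp: \<rho>'_def)
  have "isCont v t" unfolding v_def using t by (intro continuous_intros) auto
  moreover have "v t = 1" using t by (simp add: v_def)
  ultimately have "eventually (\<lambda>x. v x > \<rho>') (nhds t)"
    using order_tendstoD(1)[of v "v t" "at t" "\<rho>'"] \<rho>'
    by (auto simp: isCont_def eventually_at_filter elim!: eventually_mono)
  then obtain \<epsilon>0 where \<epsilon>0: "\<epsilon>0 > 0" "\<And>x. \<bar>x - t\<bar> < \<epsilon>0 \<Longrightarrow> v x > \<rho>'"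
    by (auto simp: eventually_nhds_metric dist_real_def)
  define \<epsilon> where "\<epsilon> = min (\<epsilon>0 / 2) \<eta>"
  have \<epsilon>: "\<epsilon> > 0" "\<epsilon> \<le> \<eta>" "\<And>x. \<bar>x - t\<bar> \<le> \<epsilon> \<Longrightarrow> v x > \<rho>'"
    using \<epsilon>0 \<eta> by (auto simp: \<epsilon>_def min_def split: if_splits)
  \<comment> \<open>From \<open>n = m\<close> on, \<open>s = n / t\<close> exceeds both the exponential type \<open>b\<close> and the abscissa \<open>c\<close>.\<close>
  obtain m :: nat where m: "real m > t * (1 + max b c)" using reals_Archimedean2 by blast
  have m': "real m / t > b" "real n / t > c" "real n / t > b" if "n \<ge> m" for n
  proof -
    have "t * b \<le> t * max b c" "t * c \<le> t * max b c" using t by (auto intro: mult_left_mono)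
    moreover have "t + t * max b c < real m" "real m \<le> real n" using m that by (auto simp: distrib_left)
    ultimately have "t * b < real m" "t * c < real n" "t * b < real n" using t by linarith+
    thus "real m / t > b" "real n / t > c" "real n / t > b" using t by (auto simp: field_simps)
  qed
  have vpow: "v x ^ n = (exp 1 / t) ^ n * (exp (- (real n / t) * x) * x ^ n)" for x n
    by (simp add: v_def power_mult_distrib power_divide exp_diff exp_of_nat_mult[symmetric] exp_minus field_simps)
  have int: "integrable lborel (\<lambda>x. indicator {0..} x * (v x ^ n * f x))" if "n \<ge> m" for n
  proof -
    have "integrable lborel (\<lambda>x. (exp 1 / t) ^ n *
            (indicator {0..} x * (exp (- (real n / t) * x) * (x ^ n * f x))))"
      by (intro integrable_mult_right laplace_integrable_power[OF f m'(3)[OF that]])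
    thus ?thesis by (simp only: vpow mult_ac)
  qed
  have int_nonneg: "(LINT x|lborel. indicator {0..} x * (v x ^ n * f x)) \<ge> 0" if "n \<ge> m" for n
  proof -
    have "(LINT x|lborel. indicator {0..} x * (v x ^ n * f x))
        = (LINT x|lborel. (exp 1 / t) ^ n * (indicator {0..} x * (exp (- (real n / t) * x) * (x ^ n * f x))))"
      by (simp only: vpow mult_ac)
    also have "\<dots> = (exp 1 / t) ^ n * laplace (\<lambda>x. x ^ n * f x) (real n / t)"
      by (simp add: laplace_def)
    also have "\<dots> \<ge> 0" using t mom[OF m'(2)[OF that]] by simp
    finally show ?thesis .
  qed
  define B where "B = (LINT x|lborel. \<bar>indicator {0..} x * (v x ^ m * f x)\<bar>)"
  \<comment> \<open>Within \<open>\<eta>\<close> of \<open>t\<close> the function is below \<open>-\<delta>\<close>, within \<open>\<epsilon>\<close> also \<open>v > \<rho>'\<close>; farther away \<open>v \<le> \<rho>\<close>.\<close>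
  have key: "2 * \<epsilon> * (\<delta> * \<rho>' ^ n) \<le> \<rho> ^ (n - m) * B" if n: "n \<ge> m" for n
  proof -
    let ?g = "\<lambda>x. \<rho> ^ (n - m) * \<bar>indicator {0..} x * (v x ^ m * f x)\<bar>
                   - (\<delta> * \<rho>' ^ n) * indicator {t - \<epsilon>..t + \<epsilon>} x"
    have ind: "integrable lborel (\<lambda>x. (\<delta> * \<rho>' ^ n) * indicator {t - \<epsilon>..t + \<epsilon>} x :: real)"
      by (intro integrable_mult_right integrable_real_indicator) (auto simp: emeasure_lborel_Icc_eq)
    have gi: "integrable lborel (\<lambda>x. \<rho> ^ (n - m) * \<bar>indicator {0..} x * (v x ^ m * f x)\<bar>)"
      using int[of m] by (intro integrable_mult_right integrable_abs) simp
    have "0 \<le> (LINT x|lborel. indicator {0..} x * (v x ^ n * f x))" by (rule int_nonneg[OF n])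
    also have "\<dots> \<le> (LINT x|lborel. ?g x)"
    proof (rule integral_mono)
      show "integrable lborel (\<lambda>x. indicator {0..} x * (v x ^ n * f x))" by (rule int[OF n])
      show "integrable lborel ?g" by (intro Bochner_Integration.integrable_diff gi ind)
      fix x :: real
      show "indicator {0..} x * (v x ^ n * f x) \<le> ?g x"
      proof (cases "x \<ge> 0")
        case x: True
        show ?thesis
        proof (cases "\<bar>x - t\<bar> \<le> \<eta>")
          case True
          have fx: "f x < - \<delta>" using \<eta>(3)[OF True] .
          have "v x ^ n * f x \<le> - (\<delta> * \<rho>' ^ n) * indicator {t - \<epsilon>..t + \<epsilon>} x"
          proof (cases "\<bar>x - t\<bar> \<le> \<epsilon>")
            case True
            have "\<rho>' ^ n \<le> v x ^ n" using \<epsilon>(3)[OF True] \<rho>' by (intro power_mono) auto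
            hence "\<rho>' ^ n * \<delta> \<le> v x ^ n * (- f x)" using fx \<delta> \<rho>' v_nonneg[OF x] by (intro mult_mono) auto
            thus ?thesis using True by (auto simp: indicator_def abs_le_iff mult_ac)
          next
            case False
            hence "indicator {t - \<epsilon>..t + \<epsilon>} x = (0::real)" by (auto simp: indicator_def abs_le_iff)
            moreover have "v x ^ n * f x \<le> 0" using fx \<delta> v_nonneg[OF x] by (intro mult_nonneg_nonpos) auto
            ultimately show ?thesis by simp
          qed
          moreover have "0 \<le> \<rho> ^ (n - m) * \<bar>indicator {0..} x * (v x ^ m * f x)\<bar>" using \<rho> by simp
          ultimately show ?thesis using x by simp
        next
          case False
          hence "v x \<le> \<rho>" using out x by auto
          have "v x ^ n * f x \<le> v x ^ n * \<bar>f x\<bar>" using v_nonneg[OF x] by (intro mult_left_mono) auto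
          also have "\<dots> = v x ^ (n - m) * v x ^ m * \<bar>f x\<bar>" using n by (simp flip: power_add)
          also have "\<dots> \<le> \<rho> ^ (n - m) * v x ^ m * \<bar>f x\<bar>"
            using \<open>v x \<le> \<rho>\<close> v_nonneg[OF x] by (intro mult_right_mono power_mono) auto
          finally have "v x ^ n * f x \<le> \<rho> ^ (n - m) * \<bar>indicator {0..} x * (v x ^ m * f x)\<bar>"
            using x v_nonneg[OF x] by (simp add: abs_mult mult_ac)
          moreover have "indicator {t - \<epsilon>..t + \<epsilon>} x = (0::real)"
            using False \<epsilon> by (auto simp: indicator_def abs_le_iff)
          ultimately show ?thesis using x by simp
        qed
      next
        case False
        hence "indicator {t - \<epsilon>..t + \<epsilon>} x = (0::real)" using \<epsilon> \<eta> by (auto simp: indicator_def)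
        with False show ?thesis by simp
      qed
    qed
    also have "\<dots> = \<rho> ^ (n - m) * B - (\<delta> * \<rho>' ^ n) * (2 * \<epsilon>)"
      unfolding Bochner_Integration.integral_diff[OF gi ind] B_def using \<epsilon> by simp
    finally show ?thesis by (simp add: mult_ac)
  qed
  have "B \<ge> 0" by (simp add: B_def)
  have key': "2 * \<epsilon> * \<delta> * \<rho> ^ m \<le> (\<rho> / \<rho>') ^ n * B" if n: "n \<ge> m" for n
  proof -
    have "\<rho> ^ m * (2 * \<epsilon> * (\<delta> * \<rho>' ^ n)) \<le> \<rho> ^ m * (\<rho> ^ (n - m) * B)"
      using key[OF n] \<rho> by (intro mult_left_mono) auto
    also have "\<dots> = \<rho> ^ n * B" using n by (simp flip: power_add mult.assoc)
    finally show ?thesis using \<rho>' by (simp add: power_divide field_simps)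
  qed
  have "(\<lambda>n. (\<rho> / \<rho>') ^ n * B) \<longlonglongrightarrow> 0 * B"
    using \<rho> \<rho>' by (intro tendsto_intros LIMSEQ_power_zero) auto
  hence "2 * \<epsilon> * \<delta> * \<rho> ^ m \<le> 0 * B"
    by (rule LIMSEQ_le_const) (use key' in blast)
  moreover have "2 * \<epsilon> * \<delta> * \<rho> ^ m > 0" using \<epsilon> \<delta> \<rho> by simp
  ultimately show False by simp
qed

lemma nonneg_of_laplace_cm_upto:
  assumes f: "exp_bounded b f" and cont: "isCont f t" and t: "t > 0"
    and cm: "\<And>n. cm_upto n b (laplace f)"
  shows "f t \<ge> 0"
proof (rule nonneg_of_laplace_moments[OF f cont t])
  fix n s assume "s > b"
  thus "laplace (\<lambda>x. x ^ n * f x) s \<ge> 0"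
    using laplace_moment_nonneg[OF f, of s n 0] cm[of n] by simp
qed

lemma laplace_diff:
  assumes "exp_bounded b f" "exp_bounded b g" "s > b"
  shows "laplace (\<lambda>x. f x - g x) s = laplace f s - laplace g s"
  using laplace_integrable_power[OF assms(1,3), of 0] laplace_integrable_power[OF assms(2,3), of 0]
  by (simp add: laplace_def right_diff_distrib)

text \<open>Uniqueness of the Laplace transform at points of continuity: the zero function is completely
  monotone, so the difference has both signs.\<close>

lemma laplace_inject:
  assumes f: "exp_bounded b f" and g: "exp_bounded b g" 
    and "isCont f t" "isCont g t" and t: "t > 0"
    and eq: "\<And>s. s > b \<Longrightarrow> laplace f s = laplace g s"
  shows "f t = g t"
proof -
  have zero: "cm_upto n b (\<lambda>_. 0)" for n by (induction n) (auto intro!: exI[of _ "\<lambda>_. 0"])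
  have 1: "laplace (\<lambda>x. f x - g x) s = 0" "laplace (\<lambda>x. g x - f x) s = 0" if "s > b" for s
    using laplace_diff[OF f g that] laplace_diff[OF g f that] eq[OF that] by auto
  have "f t - g t \<ge> 0"
    using assms 1 by (intro nonneg_of_laplace_cm_upto[OF exp_bounded_diff[OF f g] _ t] cm_upto_cong[OF zero]) auto
  moreover have "g t - f t \<ge> 0"
    using assms 1 by (intro nonneg_of_laplace_cm_upto[OF exp_bounded_diff[OF g f] _ t] cm_upto_cong[OF zero]) auto
  ultimately show ?thesis by simp
qed

section \<open>The Mittag-Leffler series and its Laplace transform\<close>

text \<open>Restrict the Gamma integral of \<open>u\<^sup>y e\<^bsup>-u\<^esup>\<close> to \<open>[x, x + 1]\<close>.\<close>

lemma powr_le_exp_Gamma: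
  fixes x y :: real
  assumes "x \<ge> 0" "y \<ge> 0"
  shows "x powr y \<le> exp (x + 1) * Gamma (y + 1)"
proof -
  have int: "has_bochner_integral lborel (\<lambda>u. indicator {0..} u * (exp (- 1 * u) * u powr y)) (Gamma (y + 1))"
    using has_bochner_integral_powr_exp[of 1 y] assms by simp
  have "(LINT u|lborel. (exp (- (x + 1)) * x powr y) * indicator {x..x + 1} u)
      \<le> (LINT u|lborel. indicator {0..} u * (exp (- 1 * u) * u powr y))"
  proof (rule integral_mono)
    fix u :: real
    show "(exp (- (x + 1)) * x powr y) * indicator {x..x + 1} u \<le> indicator {0..} u * (exp (- 1 * u) * u powr y)"
      using assms by (auto simp: indicator_def intro!: mult_mono powr_mono2)
  qed (use int in \<open>auto simp: has_bochner_integral_iff\<close>)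
  hence "exp (- (x + 1)) * x powr y \<le> Gamma (y + 1)"
    using int by (simp add: has_bochner_integral_iff)
  hence "exp (x + 1) * (exp (- (x + 1)) * x powr y) \<le> exp (x + 1) * Gamma (y + 1)"
    by (intro mult_left_mono) auto
  thus ?thesis by (simp only: mult.assoc[symmetric] exp_add[symmetric]) simp
qed

text \<open>The previous bound at \<open>b x\<close> in place of \<open>x\<close> dominates the Mittag-Leffler series by a geometric
  series, which converges as soon as \<open>b\<^sup>\<alpha> > \<kappa>\<close>.\<close>

lemma ml_term_bound:
  fixes \<alpha> \<kappa> b x :: real
  assumes "\<alpha> > 0" "\<kappa> \<ge> 0" "b > 0" "x \<ge> 0"
  shows "\<bar>(- \<kappa>) ^ k * (x powr (\<alpha> * real k + 1) / Gamma (\<alpha> * real k + 2))\<bar>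
           \<le> (\<kappa> / b powr \<alpha>) ^ k * (exp (b * x + 1) / b)"
proof -
  let ?y = "\<alpha> * real k + 1"
  have "\<alpha> * real k \<ge> 0" using assms by simp
  hence G: "Gamma (?y + 1) > 0" by (intro Gamma_real_pos) linarith
  have "b powr ?y * x powr ?y \<le> exp (b * x + 1) * Gamma (?y + 1)"
    using powr_le_exp_Gamma[of "b * x" ?y] assms by (simp add: powr_mult)
  moreover have "b powr ?y = (b powr \<alpha>) ^ k * b"
    using assms by (simp add: powr_add powr_powr[symmetric] powr_realpow)
  ultimately have "(b powr \<alpha>) ^ k * b * x powr ?y \<le> exp (b * x + 1) * Gamma (?y + 1)" by simp
  hence "x powr ?y / Gamma (?y + 1) \<le> exp (b * x + 1) / ((b powr \<alpha>) ^ k * b)"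
    using G assms by (simp add: field_simps)
  hence "\<kappa> ^ k * (x powr ?y / Gamma (?y + 1)) \<le> \<kappa> ^ k * (exp (b * x + 1) / ((b powr \<alpha>) ^ k * b))"
    using assms by (intro mult_left_mono) auto
  moreover have "\<bar>(- \<kappa>) ^ k * (x powr ?y / Gamma (?y + 1))\<bar> = \<kappa> ^ k * (x powr ?y / Gamma (?y + 1))"
    using G assms by (simp add: abs_mult power_abs)
  ultimately show ?thesis by (simp add: power_divide add.commute add.left_commute)
qed

lemma ml_base_exists:
  fixes \<alpha> \<kappa> :: real
  assumes "\<alpha> > 0" "\<kappa> \<ge> 0"
  obtains b where "b > 0" "\<kappa> < b powr \<alpha>"
proof
  show "(\<kappa> + 1) powr (1 / \<alpha>) > 0" "\<kappa> < ((\<kappa> + 1) powr (1 / \<alpha>)) powr \<alpha>"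
    using assms by (auto simp: powr_powr)
qed

lemma mittag_leffler_summable:
  fixes \<alpha> z :: real
  assumes "\<alpha> > 0"
  shows "summable (\<lambda>k. norm (z ^ k / Gamma (\<alpha> * real k + 2)))"
proof -
  obtain b where b: "b > 0" "\<bar>z\<bar> < b powr \<alpha>" using ml_base_exists[of \<alpha> "\<bar>z\<bar>"] assms by auto
  show ?thesis
  proof (rule summable_comparison_test)
    show "\<exists>N. \<forall>k\<ge>N. norm (norm (z ^ k / Gamma (\<alpha> * real k + 2))) \<le> (\<bar>z\<bar> / b powr \<alpha>) ^ k * (exp (b * 1 + 1) / b)"
      using ml_term_bound[of \<alpha> "\<bar>z\<bar>" b 1] assms b by (auto simp: abs_mult power_abs)
    show "summable (\<lambda>k. (\<bar>z\<bar> / b powr \<alpha>) ^ k * (exp (b * 1 + 1) / b))"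
      using b by (intro summable_mult2 summable_geometric) auto
  qed
qed

lemma isCont_mittag_leffler:
  fixes \<alpha> z :: real
  assumes "\<alpha> > 0"
  shows "isCont (mittag_leffler \<alpha> 2) z"
proof -
  have "isCont (\<lambda>z. \<Sum>k. (1 / Gamma (\<alpha> * real k + 2)) * z ^ k) z"
    by (rule isCont_powser_converges_everywhere)
      (use summable_norm_cancel[OF mittag_leffler_summable[OF assms]] in simp)
  thus ?thesis by (simp add: mittag_leffler_def[abs_def])
qed

text \<open>The solution \<open>x E\<^bsub>\<alpha>,2\<^esub>(-\<kappa> x\<^sup>\<alpha>)\<close> of \<open>\<partial>\<^sup>\<alpha> f + \<kappa> f = 0\<close>, \<open>f(0) = 0\<close>,
  \<open>f'(0) = 1\<close>.\<close>

definition ml_mode :: "real \<Rightarrow> real \<Rightarrow> real \<Rightarrow> real" where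
  "ml_mode \<alpha> \<kappa> x = x * mittag_leffler \<alpha> 2 (- \<kappa> * x powr \<alpha>)"

lemma ml_mode_sums:
  assumes "\<alpha> > 0" "x \<ge> 0"
  shows "(\<lambda>k. (- \<kappa>) ^ k * (x powr (\<alpha> * real k + 1) / Gamma (\<alpha> * real k + 2))) sums ml_mode \<alpha> \<kappa> x"
proof -
  have "(\<lambda>k. (- \<kappa> * x powr \<alpha>) ^ k / Gamma (\<alpha> * real k + 2)) sums mittag_leffler \<alpha> 2 (- \<kappa> * x powr \<alpha>)"
    unfolding mittag_leffler_def
    by (rule summable_sums[OF summable_norm_cancel[OF mittag_leffler_summable[OF assms(1)]]])
  hence "(\<lambda>k. x * ((- \<kappa> * x powr \<alpha>) ^ k / Gamma (\<alpha> * real k + 2))) sums ml_mode \<alpha> \<kappa> x"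
    unfolding ml_mode_def by (rule sums_mult)
  also have "(\<lambda>k. x * ((- \<kappa> * x powr \<alpha>) ^ k / Gamma (\<alpha> * real k + 2)))
     = (\<lambda>k. (- \<kappa>) ^ k * (x powr (\<alpha> * real k + 1) / Gamma (\<alpha> * real k + 2)))"
  proof
    fix k
    have "x * (x powr \<alpha>) ^ k = x powr (\<alpha> * real k + 1)"
    proof (cases "x = 0")
      case False
      with assms have "x > 0" by simp
      thus ?thesis by (simp add: powr_add powr_powr[symmetric] powr_realpow)
    qed auto
    thus "x * ((- \<kappa> * x powr \<alpha>) ^ k / Gamma (\<alpha> * real k + 2))
      = (- \<kappa>) ^ k * (x powr (\<alpha> * real k + 1) / Gamma (\<alpha> * real k + 2))"
      unfolding power_mult_distrib by (metis mult.left_commute times_divide_eq_right)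
  qed
  finally show ?thesis .
qed

lemma isCont_ml_mode:
  assumes "\<alpha> > 0" "x > 0"
  shows "isCont (ml_mode \<alpha> \<kappa>) x"
  unfolding ml_mode_def
  by (intro continuous_intros isCont_o2[OF _ isCont_mittag_leffler[OF assms(1)]]) (use assms in auto)

lemma exp_bounded_ml_mode:
  assumes "\<alpha> > 0" "\<kappa> \<ge> 0" "b > 0" "\<kappa> < b powr \<alpha>"
  shows "exp_bounded b (ml_mode \<alpha> \<kappa>)"
proof -
  have [measurable]: "mittag_leffler \<alpha> 2 \<in> borel_measurable borel"
    using isCont_mittag_leffler[OF assms(1)]
    by (intro borel_measurable_continuous_onI) (simp add: continuous_at_imp_continuous_on)
  have "ml_mode \<alpha> \<kappa> \<in> borel_measurable borel"
    unfolding ml_mode_def[abs_def] by measurable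
  moreover have "\<bar>ml_mode \<alpha> \<kappa> x\<bar> \<le> exp 1 / b / (1 - \<kappa> / b powr \<alpha>) * exp (b * x)" if x: "x \<ge> 0" for x
  proof -
    let ?t = "\<lambda>k. (- \<kappa>) ^ k * (x powr (\<alpha> * real k + 1) / Gamma (\<alpha> * real k + 2))"
    let ?B = "\<lambda>k. (\<kappa> / b powr \<alpha>) ^ k * (exp (b * x + 1) / b)"
    have B: "?B sums (1 / (1 - \<kappa> / b powr \<alpha>) * (exp (b * x + 1) / b))"
      using assms by (intro sums_mult2 geometric_sums) auto
    have "norm (suminf ?t) \<le> suminf ?B"
      by (rule norm_suminf_le) (use B ml_term_bound[of \<alpha> \<kappa> b x] assms x in \<open>auto simp: sums_iff\<close>)
    thus ?thesis using ml_mode_sums[OF assms(1) x, of \<kappa>] B by (simp add: sums_iff exp_add mult_ac)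
  qed
  ultimately show ?thesis unfolding exp_bounded_def using assms
    by (intro conjI exI[of _ "exp 1 / b / (1 - \<kappa> / b powr \<alpha>)"]) auto
qed

lemma laplace_ml_mode:
  assumes \<alpha>: "\<alpha> > 0" and \<kappa>: "\<kappa> \<ge> 0" and b: "b > 0" "\<kappa> < b powr \<alpha>" and s: "s > b"
  shows "laplace (ml_mode \<alpha> \<kappa>) s = s powr (\<alpha> - 2) / (s powr \<alpha> + \<kappa>)"
proof -
  have s0: "s > 0" using b s by simp
  have s\<alpha>: "\<kappa> < s powr \<alpha>" using powr_less_mono2[of \<alpha> b s] assms by simp
  have ratio: "\<kappa> / s powr \<alpha> < 1" "\<kappa> / s powr \<alpha> \<ge> 0" using s\<alpha> \<kappa> s0 by (simp_all add: divide_less_eq)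
  let ?t = "\<lambda>k x. (- \<kappa>) ^ k * (x powr (\<alpha> * real k + 1) / Gamma (\<alpha> * real k + 2))"
  let ?F = "\<lambda>k x. indicator {0..} x * (exp (- s * x) * ?t k x)"
  have G: "Gamma (\<alpha> * real k + 2) > 0" for k
    using \<alpha> by (intro Gamma_real_pos) (simp add: add_nonneg_pos)
  have F: "has_bochner_integral lborel (\<lambda>x. c * (indicator {0..} x * (exp (- s * x) * x powr (\<alpha> * real k + 1))))
     (c * (Gamma (\<alpha> * real k + 2) / s powr (\<alpha> * real k + 2)))" for c k
    using has_bochner_integral_powr_exp[OF s0, of "\<alpha> * real k + 1"] \<alpha>
    by (intro has_bochner_integral_mult_right) (simp_all add: add.assoc add_nonneg_pos order_less_le_trans[of "-1" 0])
  have F1: "?F k = (\<lambda>x. ((- \<kappa>) ^ k / Gamma (\<alpha> * real k + 2)) *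
       (indicator {0..} x * (exp (- s * x) * x powr (\<alpha> * real k + 1))))" for k
    by (auto simp: mult_ac)
  have F2: "(\<lambda>x. norm (?F k x)) = (\<lambda>x. (\<kappa> ^ k / Gamma (\<alpha> * real k + 2)) *
       (indicator {0..} x * (exp (- s * x) * x powr (\<alpha> * real k + 1))))" for k
    using G[of k] \<kappa> by (auto simp: abs_mult power_abs fun_eq_iff indicator_def)
  have spow: "s powr (\<alpha> * real k + 2) = (s powr \<alpha>) ^ k * s powr 2" for k
    using s0 by (simp add: powr_add powr_powr[symmetric] powr_realpow[of "s powr \<alpha>"])
  have int: "integrable lborel (?F k)" for k
    unfolding F1 using F by (blast dest: integrable.intros)
  have I1: "integral\<^sup>L lborel (?F k) = (- \<kappa> / s powr \<alpha>) ^ k * (1 / s powr 2)" for k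
  proof -
    have "integral\<^sup>L lborel (?F k) = (- \<kappa>) ^ k / Gamma (\<alpha> * real k + 2) * (Gamma (\<alpha> * real k + 2) / s powr (\<alpha> * real k + 2))"
      unfolding F1 by (rule has_bochner_integral_integral_eq[OF F])
    thus ?thesis using G[of k] by (simp only: spow power_divide) simp
  qed
  have I2: "(LINT x|lborel. norm (?F k x)) = (\<kappa> / s powr \<alpha>) ^ k * (1 / s powr 2)" for k
    unfolding F2 using F G[of k] by (simp add: has_bochner_integral_iff spow power_divide)
  have sumx: "(\<lambda>k. ?F k x) sums (indicator {0..} x * (exp (- s * x) * ml_mode \<alpha> \<kappa> x))" for x
    using sums_mult[OF ml_mode_sums[OF \<alpha>, of x \<kappa>], of "exp (- s * x)"] by (cases "x \<ge> 0") auto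
  have "(\<lambda>k. integral\<^sup>L lborel (?F k)) sums (LINT x|lborel. (\<Sum>k. ?F k x))"
  proof (rule sums_integral)
    show "integrable lborel (?F k)" for k by (rule int)
    show "AE x in lborel. summable (\<lambda>k. norm (?F k x))"
    proof (intro AE_I2)
      fix x :: real
      show "summable (\<lambda>k. norm (?F k x))"
      proof (cases "x \<ge> 0")
        case True
        have S: "summable (\<lambda>k. exp (- s * x) * ((\<kappa> / b powr \<alpha>) ^ k * (exp (b * x + 1) / b)))"
          using assms by (intro summable_mult summable_mult2 summable_geometric) auto
        have "norm (norm (?F k x)) \<le> exp (- s * x) * ((\<kappa> / b powr \<alpha>) ^ k * (exp (b * x + 1) / b))" for k
        proof -
          have "norm (norm (?F k x)) = exp (- s * x) * \<bar>?t k x\<bar>"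
            using True by (simp add: abs_mult)
          also have "\<dots> \<le> exp (- s * x) * ((\<kappa> / b powr \<alpha>) ^ k * (exp (b * x + 1) / b))"
            using True assms by (intro mult_left_mono ml_term_bound) auto
          finally show ?thesis .
        qed
        thus ?thesis by (intro summable_comparison_test'[OF S, of 0])
      qed auto
    qed
    show "summable (\<lambda>k. LINT x|lborel. norm (?F k x))"
      unfolding I2 using ratio by (intro summable_mult2 summable_geometric) auto
  qed
  moreover have "(LINT x|lborel. (\<Sum>k. ?F k x)) = laplace (ml_mode \<alpha> \<kappa>) s"
    unfolding laplace_def using sums_unique[OF sumx] by simp
  ultimately have "(\<lambda>k. (- \<kappa> / s powr \<alpha>) ^ k * (1 / s powr 2)) sums laplace (ml_mode \<alpha> \<kappa>) s"
    by (simp only: I1)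
  moreover have "(\<lambda>k. (- \<kappa> / s powr \<alpha>) ^ k * (1 / s powr 2)) sums (1 / (1 - (- \<kappa> / s powr \<alpha>)) * (1 / s powr 2))"
    using ratio by (intro sums_mult2 geometric_sums) auto
  ultimately have "laplace (ml_mode \<alpha> \<kappa>) s = 1 / (1 - (- \<kappa> / s powr \<alpha>)) * (1 / s powr 2)"
    by (rule sums_unique2)
  also have "\<dots> = s powr (\<alpha> - 2) / (s powr \<alpha> + \<kappa>)"
    using s0 \<kappa> by (simp add: powr_diff field_simps)
  finally show ?thesis .
qed

section \<open>A contour integral in the logarithmic variable\<close>

lemma contour_integral_horizontal:
  fixes f :: "complex \<Rightarrow> complex"
  assumes "a < b"
  shows "contour_integral (linepath (Complex a y) (Complex b y)) f
           = integral {a..b} (\<lambda>x. f (Complex x y))"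
proof -
  have eq: "linepath (Complex a y) (Complex b y) t = linepath (of_real a) (of_real b) t + Complex 0 y" for t
    by (simp add: linepath_def complex_eq_iff algebra_simps)
  have "(f has_contour_integral I) (linepath (Complex a y) (Complex b y)) \<longleftrightarrow>
        ((\<lambda>w. f (w + Complex 0 y)) has_contour_integral I) (linepath (of_real a) (of_real b))" for I
    unfolding has_contour_integral_linepath eq by (simp add: complex_eq_iff Complex_eq)
  hence "contour_integral (linepath (Complex a y) (Complex b y)) f
      = contour_integral (linepath (of_real a) (of_real b)) (\<lambda>w. f (w + Complex 0 y))"
    by (simp add: contour_integral_def contour_integrable_on_def)
  also have "\<dots> = integral {a..b} (\<lambda>x. f (of_real x + Complex 0 y))"
    using assms by (subst contour_integral_linepath_Reals_eq) auto
  also have "(\<lambda>x. f (of_real x + Complex 0 y)) = (\<lambda>x. f (Complex x y))"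
    by (simp add: Complex_eq)
  finally show ?thesis .
qed

lemma sin_pi_neg:
  fixes \<alpha> :: real
  assumes "1 < \<alpha>" "\<alpha> < 2"
  shows "sin (pi * \<alpha>) < 0"
proof -
  have "sin (pi * \<alpha>) = - sin (pi * \<alpha> - pi)" by (simp add: sin_diff)
  moreover have "sin (pi * \<alpha> - pi) > 0"
    using assms by (intro sin_gt_zero) (auto simp: algebra_simps)
  ultimately show ?thesis by linarith
qed

text \<open>The density in \<open>\<integral> e\<^bsup>-tr\<^esup> K(r) dr\<close> coming from the jump of \<open>s\<^bsup>\<alpha>-2\<^esup> / (s\<^sup>\<alpha> + 1)\<close>
  across the negative half-axis, in the variable \<open>x = ln r\<close>: \<open>ml_kernel \<alpha> x = r K(r)\<close>. The
  denominator is \<open>\<bar>1 + r\<^sup>\<alpha> e\<^bsup>i\<pi>\<alpha>\<^esup>\<bar>\<^sup>2\<close>.\<close>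

definition ml_kernel :: "real \<Rightarrow> real \<Rightarrow> real" where
  "ml_kernel \<alpha> x = - (1 / pi) * exp ((\<alpha> - 1) * x) * sin (pi * \<alpha>)
      / ((1 + exp (\<alpha> * x) * cos (pi * \<alpha>))\<^sup>2 + (exp (\<alpha> * x) * sin (pi * \<alpha>))\<^sup>2)"

text \<open>The integrand \<open>s\<^bsup>\<alpha>-2\<^esup> / ((1 + s\<^sup>\<alpha>) (p - s)) ds\<close> with \<open>s = e\<^sup>w\<close>. The cut plane becomes the strip
  \<open>\<bar>Im w\<bar> < \<pi>\<close> and its two edges the lines \<open>Im w = \<plusminus>\<pi>\<close>. In the slightly larger convex strip
  \<open>S\<close> the integrand \<open>\<Phi>\<close> is meromorphic with simple poles at \<open>wp\<close> (where \<open>s = p\<close>), \<open>w0\<close> and its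
  conjugate (where \<open>s\<^sup>\<alpha> = -1\<close>); \<open>num\<close> and \<open>den\<close> are its numerator and denominator.\<close>

locale ml_contour =
  fixes \<alpha> p :: real
  assumes \<alpha>: "1 < \<alpha>" "\<alpha> < 2" and p: "p > 0"
begin

definition num :: "complex \<Rightarrow> complex" where "num w = exp (of_real (\<alpha> - 1) * w)"
definition den :: "complex \<Rightarrow> complex" where "den w = (1 + exp (of_real \<alpha> * w)) * (of_real p - exp w)"
definition \<Phi> :: "complex \<Rightarrow> complex" where "\<Phi> w = num w / den w"
definition w0 :: complex where "w0 = Complex 0 (pi / \<alpha>)"
definition wp :: complex where "wp = of_real (ln p)"
definition S :: "complex set" where "S = {w. \<bar>Im w\<bar> < 3 * pi / 2}"

lemma \<Phi>_def': "\<Phi> = (\<lambda>w. num w / den w)"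
  by (simp add: \<Phi>_def fun_eq_iff)

lemma exp_w0: "exp (of_real \<alpha> * w0) = -1" "exp (of_real \<alpha> * cnj w0) = -1"
proof -
  have "of_real \<alpha> * w0 = \<i> * pi" 
    using \<alpha> by (simp add: w0_def complex_eq_iff)
  thus 1: "exp (of_real \<alpha> * w0) = -1" by simp
  have "exp (of_real \<alpha> * cnj w0) = cnj (exp (of_real \<alpha> * w0))" by (simp add: exp_cnj)
  thus "exp (of_real \<alpha> * cnj w0) = -1" by (simp add: 1)
qed

lemma exp_wp: "exp wp = of_real p"
  using p by (simp add: wp_def exp_of_real)

lemma den_zero:
  assumes "w \<in> S"
  shows "den w = 0 \<longleftrightarrow> w \<in> {wp, w0, cnj w0}"
proof
  assume "den w = 0"
  then consider "exp (of_real \<alpha> * w) = -1" | "exp w = of_real p"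
    by (auto simp: den_def add_eq_0_iff)
  thus "w \<in> {wp, w0, cnj w0}"
  proof cases
    case 2
    have "w = wp"
      by (rule exp_complex_eqI) (use assms 2 exp_wp in \<open>auto simp: S_def wp_def\<close>)
    thus ?thesis by simp
  next
    case 1
    \<comment> \<open>The next zeros of \<open>1 + e\<^bsup>\<alpha>w\<^esup>\<close> have \<open>\<bar>Im w\<bar> = 3\<pi>/\<alpha> > 3\<pi>/2\<close>, outside the strip.\<close>
    have bd: "\<bar>\<alpha> * Im w\<bar> < 3 * pi"
    proof -
      have "\<bar>\<alpha> * Im w\<bar> = \<alpha> * \<bar>Im w\<bar>" using \<alpha> by (simp add: abs_mult)
      also have "\<dots> \<le> 2 * \<bar>Im w\<bar>" using \<alpha> by (intro mult_right_mono) auto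
      also have "\<dots> < 3 * pi" using assms by (simp add: S_def)
      finally show ?thesis .
    qed
    show ?thesis
    proof (cases "Im w \<ge> 0")
      case True
      hence nn: "\<alpha> * Im w \<ge> 0" using \<alpha> by simp
      have "of_real \<alpha> * w = of_real \<alpha> * w0"
        by (rule exp_complex_eqI) (use nn bd \<alpha> 1 exp_w0 in \<open>auto simp: w0_def abs_less_iff\<close>)
      thus ?thesis using \<alpha> by simp
    next
      case False
      hence neg: "\<alpha> * Im w < 0" using \<alpha> by (simp add: mult_pos_neg)
      have "of_real \<alpha> * w = of_real \<alpha> * cnj w0"
        by (rule exp_complex_eqI) (use neg bd \<alpha> 1 exp_w0 in \<open>auto simp: w0_def abs_less_iff\<close>)
      thus ?thesis using \<alpha> by simp
    qed
  qed
next
  assume "w \<in> {wp, w0, cnj w0}"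
  thus "den w = 0" using exp_w0 exp_wp by (auto simp: den_def)
qed

lemma open_S: "open S"
  unfolding S_def by (intro open_Collect_less continuous_intros)

lemma convex_S: "convex S"
proof -
  have "S = {w. Im w < 3 * pi / 2} \<inter> {w. Im w > - (3 * pi / 2)}"
    by (auto simp: S_def abs_less_iff)
  thus ?thesis
    using convex_Int[OF convex_halfspace_Im_lt[of "3 * pi / 2"] convex_halfspace_Im_gt[of "- (3 * pi / 2)"]]
    by metis
qed

lemma num_holo: "num holomorphic_on A" and den_holo: "den holomorphic_on A"
  unfolding num_def den_def by (auto intro!: holomorphic_intros)

lemma \<Phi>_holo: "\<Phi> holomorphic_on (S - {wp, w0, cnj w0})"
  unfolding \<Phi>_def'
  by (intro holomorphic_on_divide num_holo den_holo) (use den_zero in auto)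

lemma in_S: "wp \<in> S" "w0 \<in> S" "cnj w0 \<in> S"
proof -
  have "pi / \<alpha> < pi" using \<alpha> by (simp add: divide_less_eq)
  moreover have "pi / \<alpha> > 0" using \<alpha> by simp
  ultimately show "wp \<in> S" "w0 \<in> S" "cnj w0 \<in> S"
    by (auto simp: S_def wp_def w0_def)
qed

lemma distinct: "wp \<noteq> w0" "wp \<noteq> cnj w0" "w0 \<noteq> cnj w0"
  using \<alpha> by (auto simp: wp_def w0_def complex_eq_iff)

lemma den_deriv: "(den has_field_derivative
    (of_real \<alpha> * exp (of_real \<alpha> * w) * (of_real p - exp w) - (1 + exp (of_real \<alpha> * w)) * exp w)) (at w)"
  unfolding den_def by (auto intro!: derivative_eq_intros)

lemma residue_wp: "residue \<Phi> wp = - of_real (p powr (\<alpha> - 2) / (p powr \<alpha> + 1))"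
proof -
  have e: "exp (of_real \<alpha> * wp) = of_real (p powr \<alpha>)" "exp (of_real (\<alpha> - 1) * wp) = of_real (p powr (\<alpha> - 1))"
    using p by (simp_all add: wp_def powr_def flip: exp_of_real)
  have pos: "1 + p powr \<alpha> > 0" using powr_ge_zero[of p \<alpha>] by linarith
  hence nz: "1 + complex_of_real (p powr \<alpha>) \<noteq> 0" by (metis of_real_1 of_real_add of_real_eq_0_iff less_irrefl)
  have "residue (\<lambda>w. num w / den w) wp = num wp / (- ((1 + of_real (p powr \<alpha>)) * of_real p))"
  proof (rule residue_simple_pole_deriv[OF num_holo den_holo open_S convex_connected[OF convex_S] in_S(1)])
    show "(den has_field_derivative - ((1 + of_real (p powr \<alpha>)) * of_real p)) (at wp)"
      using den_deriv[of wp] by (simp add: e exp_wp)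
    show "- ((1 + of_real (p powr \<alpha>)) * of_real p) \<noteq> (0::complex)" using nz p by simp
  qed (use den_zero[OF in_S(1)] in \<open>auto simp: num_def\<close>)
  also have "\<dots> = - of_real (p powr (\<alpha> - 1) / ((1 + p powr \<alpha>) * p))"
    unfolding num_def e(2) by simp
  also have "p powr (\<alpha> - 1) / ((1 + p powr \<alpha>) * p) = p powr (\<alpha> - 2) / (p powr \<alpha> + 1)"
    using p pos by (simp add: powr_diff field_simps power2_eq_square)
  finally show ?thesis by (simp add: \<Phi>_def')
qed

lemma residue_w0_aux:
  assumes "w \<in> {w0, cnj w0}"
  shows "residue \<Phi> w = 1 / (of_real \<alpha> * exp w * (of_real p - exp w))"
proof -
  have e: "exp (of_real \<alpha> * w) = -1" using assms exp_w0 by auto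
  have w: "w \<in> S" "den w = 0" using in_S assms den_zero[of w] by auto
  have "exp w \<noteq> of_real p"
  proof
    assume "exp w = of_real p"
    with exp_wp have eq: "exp w = exp wp" by simp
    have "\<bar>Im w - Im wp\<bar> < 2 * pi" using w(1) pi_gt_zero by (simp add: S_def wp_def)
    hence "w = wp" using eq by (rule exp_complex_eqI)
    with assms distinct show False by (metis insertE singletonD)
  qed
  have "num w = exp (of_real \<alpha> * w - w)" by (simp add: num_def left_diff_distrib)
  also have "\<dots> = exp (of_real \<alpha> * w) / exp w" by (rule exp_diff)
  finally have num: "num w = - (1 / exp w)" unfolding e by simp
  have "residue (\<lambda>w. num w / den w) w = num w / (- of_real \<alpha> * (of_real p - exp w))"
    by (rule residue_simple_pole_deriv[OF num_holo den_holo open_S convex_connected[OF convex_S] w(1)])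
      (use den_deriv[of w] w \<open>exp w \<noteq> of_real p\<close> \<alpha> in \<open>auto simp: e num_def\<close>)
  also have "\<dots> = 1 / (of_real \<alpha> * exp w * (of_real p - exp w))"
    using \<alpha> \<open>exp w \<noteq> of_real p\<close> by (simp add: num divide_simps)
  finally show ?thesis by (simp add: \<Phi>_def')
qed

text \<open>The pole \<open>w0\<close> in the original variable.\<close>

definition s0 :: complex where "s0 = exp w0"

lemma sum_residues:
  "(\<Sum>w\<in>{wp, w0, cnj w0}. residue \<Phi> w)
     = of_real (2 * Re (1 / (of_real \<alpha> * s0 * (of_real p - s0))) - p powr (\<alpha> - 2) / (p powr \<alpha> + 1))"
proof -
  have "residue \<Phi> (cnj w0) = cnj (residue \<Phi> w0)"
    by (simp add: residue_w0_aux exp_cnj)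
  hence "residue \<Phi> w0 + residue \<Phi> (cnj w0) = of_real (2 * Re (1 / (of_real \<alpha> * s0 * (of_real p - s0))))"
    by (simp only: complex_add_cnj residue_w0_aux[of w0] s0_def insertI1 of_real_mult)
  moreover have "(\<Sum>w\<in>{wp, w0, cnj w0}. residue \<Phi> w) = residue \<Phi> wp + (residue \<Phi> w0 + residue \<Phi> (cnj w0))"
    using distinct by simp
  ultimately show ?thesis by (simp add: residue_wp)
qed

lemma \<Phi>_cnj: "\<Phi> (cnj w) = cnj (\<Phi> w)"
  by (simp add: \<Phi>_def num_def den_def exp_cnj)

lemma Im_\<Phi>_top: "Im (\<Phi> (Complex x pi)) = pi * (ml_kernel \<alpha> x / (p + exp x))"
proof -
  have 1: "exp (Complex x pi) = - of_real (exp x)" 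
    by (simp add: exp_eq_polar cis.ctr complex_eq_iff)
  have 2: "exp (of_real \<alpha> * Complex x pi) = of_real (exp (\<alpha> * x)) * cis (pi * \<alpha>)"
    by (simp add: exp_eq_polar mult.commute)
  have 3: "num (Complex x pi) = - of_real (exp ((\<alpha> - 1) * x)) * cis (pi * \<alpha>)"
    by (simp add: num_def exp_eq_polar complex_eq_iff algebra_simps cos_diff sin_diff)
  define u where "u = exp (\<alpha> * x)"
  have "\<Phi> (Complex x pi) = (- of_real (exp ((\<alpha> - 1) * x)) / of_real (p + exp x)) * (cis (pi * \<alpha>) / (1 + of_real u * cis (pi * \<alpha>)))"
    unfolding \<Phi>_def den_def 1 2 3 u_def by (simp add: mult_ac)
  also have "\<dots> = of_real (- exp ((\<alpha> - 1) * x) / (p + exp x)) * (cis (pi * \<alpha>) / (1 + of_real u * cis (pi * \<alpha>)))"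
    by simp
  also have "Im \<dots> = - exp ((\<alpha> - 1) * x) / (p + exp x) * Im (cis (pi * \<alpha>) / (1 + of_real u * cis (pi * \<alpha>)))"
    by (simp only: Im_complex_of_real Re_complex_of_real times_complex.sel mult_zero_left add_0_right)
  also have "Im (cis (pi * \<alpha>) / (1 + of_real u * cis (pi * \<alpha>))) = 
      sin (pi * \<alpha>) / ((1 + u * cos (pi * \<alpha>))\<^sup>2 + (u * sin (pi * \<alpha>))\<^sup>2)"
    by (simp add: Im_divide algebra_simps)
  finally show ?thesis by (simp add: ml_kernel_def u_def)
qed

lemma norm_\<Phi>_right:
  assumes "Re w = X" "exp (\<alpha> * X) > 1" "exp X > p"
  shows "norm (\<Phi> w) \<le> exp ((\<alpha> - 1) * X) / ((exp (\<alpha> * X) - 1) * (exp X - p))"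
proof -
  have "norm (exp (of_real \<alpha> * w)) - norm (1::complex) \<le> norm (1 + exp (of_real \<alpha> * w))"
    using norm_diff_ineq[of "exp (of_real \<alpha> * w)" 1] by (simp add: add.commute)
  moreover have "norm (exp w) - norm (complex_of_real p) \<le> norm (of_real p - exp w)"
    using norm_triangle_ineq2[of "exp w" "of_real p"] by (simp add: norm_minus_commute)
  ultimately have "(exp (\<alpha> * X) - 1) * (exp X - p) \<le> norm (den w)"
    unfolding den_def norm_mult using assms p by (intro mult_mono) auto
  moreover have "norm (num w) = exp ((\<alpha> - 1) * X)" using assms by (simp add: num_def)
  ultimately show ?thesis
    unfolding \<Phi>_def norm_divide using assms by (simp add: frac_le)
qed

lemma norm_\<Phi>_left:
  assumes "Re w = X" "exp (\<alpha> * X) < 1" "exp X < p"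
  shows "norm (\<Phi> w) \<le> exp ((\<alpha> - 1) * X) / ((1 - exp (\<alpha> * X)) * (p - exp X))"
proof -
  have "norm (1::complex) - norm (exp (of_real \<alpha> * w)) \<le> norm (1 + exp (of_real \<alpha> * w))"
    using norm_diff_ineq[of 1 "exp (of_real \<alpha> * w)"] by simp
  moreover have "norm (complex_of_real p) - norm (exp w) \<le> norm (of_real p - exp w)"
    using norm_triangle_ineq2[of "of_real p" "exp w"] by simp
  ultimately have "(1 - exp (\<alpha> * X)) * (p - exp X) \<le> norm (den w)"
    unfolding den_def norm_mult using assms p by (intro mult_mono) auto
  moreover have "norm (num w) = exp ((\<alpha> - 1) * X)" using assms by (simp add: num_def)
  ultimately show ?thesis
    unfolding \<Phi>_def norm_divide using assms by (simp add: frac_le)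
qed

lemma kernel_nonneg: "ml_kernel \<alpha> x \<ge> 0"
proof -
  have "sin (pi * \<alpha>) \<le> 0" using sin_pi_neg[OF \<alpha>] by simp
  thus ?thesis unfolding ml_kernel_def
    by (intro divide_nonneg_nonneg mult_nonpos_nonpos) (auto simp: mult_nonneg_nonpos2)
qed

lemma isCont_\<Phi>: "w \<in> S - {wp, w0, cnj w0} \<Longrightarrow> isCont \<Phi> w"
  using holomorphic_on_imp_continuous_on[OF \<Phi>_holo] open_S
  by (simp add: continuous_on_eq_continuous_at open_Diff)

text \<open>The residue theorem on the rectangle with corners \<open>\<plusminus>X \<plusminus> i\<pi>\<close>. The horizontal sides are complex
  conjugate and contribute \<open>-2i\<close> times the integral of \<open>Im \<Phi>\<close> over the upper one; the vertical
  sides, each of length \<open>2\<pi>\<close>, form the error.\<close>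

lemma J_bound:
  assumes X: "X > \<bar>ln p\<bar>" 
    and A: "\<And>w. Re w = X \<Longrightarrow> norm (\<Phi> w) \<le> A" and B: "\<And>w. Re w = -X \<Longrightarrow> norm (\<Phi> w) \<le> B"
  shows "\<bar>integral {-X..X} (\<lambda>x. ml_kernel \<alpha> x / (p + exp x))
            - (p powr (\<alpha> - 2) / (p powr \<alpha> + 1) - 2 * Re (1 / (of_real \<alpha> * s0 * (of_real p - s0))))\<bar>
         \<le> A + B"
proof -
  have X0: "X > 0" using X by simp
  let ?h = "p powr (\<alpha> - 2) / (p powr \<alpha> + 1) - 2 * Re (1 / (of_real \<alpha> * s0 * (of_real p - s0)))"
  let ?J = "integral {-X..X} (\<lambda>x. ml_kernel \<alpha> x / (p + exp x))"
  define pts where "pts = {wp, w0, cnj w0}"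
  define c1 c2 c3 c4 where "c1 = Complex (-X) (-pi)" "c2 = Complex X (-pi)" "c3 = Complex X pi" "c4 = Complex (-X) pi"
  note c_defs = this
  have pia: "0 < pi / \<alpha>" "pi / \<alpha> < pi" using \<alpha> by (simp_all add: divide_less_eq)
  have box: "pts \<subseteq> box c1 c3"
    using X pia unfolding pts_def in_box_complex_iff c_defs by (auto simp: in_box_complex_iff wp_def w0_def)
  have cb: "cbox c1 c3 \<subseteq> S" 
  proof
    fix w assume "w \<in> cbox c1 c3"
    hence "\<bar>Im w\<bar> \<le> pi" by (auto simp: in_cbox_complex_iff c_defs)
    hence "\<bar>Im w\<bar> < 3 * pi / 2" using pi_gt_zero by linarith
    thus "w \<in> S" by (simp add: S_def)
  qed
  have pimg: "path_image (rectpath c1 c3) = cbox c1 c3 - box c1 c3"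
    using X0 by (intro path_image_rectpath_cbox_minus_box) (auto simp: c_defs)
  have "contour_integral (rectpath c1 c3) \<Phi> = 2 * pi * \<i> * (\<Sum>w\<in>pts. winding_number (rectpath c1 c3) w * residue \<Phi> w)"
  proof (rule Residue_theorem[OF open_S convex_connected[OF convex_S]])
    show "\<Phi> holomorphic_on S - pts" using \<Phi>_holo by (simp add: pts_def)
    show "path_image (rectpath c1 c3) \<subseteq> S - pts" using pimg cb box by auto
    show "\<forall>z. z \<notin> S \<longrightarrow> winding_number (rectpath c1 c3) z = 0"
      using cb X0 by (auto intro!: winding_number_rectpath_outside simp: c_defs)
  qed (auto simp: pts_def)
  also have "(\<Sum>w\<in>pts. winding_number (rectpath c1 c3) w * residue \<Phi> w) = (\<Sum>w\<in>pts. residue \<Phi> w)"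
    using box by (intro sum.cong) (auto simp: winding_number_rectpath)
  also have "\<dots> = of_real (- ?h)" unfolding pts_def sum_residues by simp
  finally have res: "contour_integral (rectpath c1 c3) \<Phi> = 2 * pi * \<i> * of_real (- ?h)" .
  have seg: "closed_segment c1 c2 \<subseteq> S - pts" "closed_segment c2 c3 \<subseteq> S - pts"
    "closed_segment c3 c4 \<subseteq> S - pts" "closed_segment c4 c1 \<subseteq> S - pts"
  proof -
    have "path_image (rectpath c1 c3) = closed_segment c1 c2 \<union> closed_segment c2 c3 \<union> closed_segment c3 c4 \<union> closed_segment c4 c1"
      by (simp add: rectpath_def Let_def c_defs path_image_join Un_assoc)
    moreover have "path_image (rectpath c1 c3) \<subseteq> S - pts" using pimg cb box by auto
    ultimately show "closed_segment c1 c2 \<subseteq> S - pts" "closed_segment c2 c3 \<subseteq> S - pts"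
      "closed_segment c3 c4 \<subseteq> S - pts" "closed_segment c4 c1 \<subseteq> S - pts" by auto
  qed
  have ci: "\<Phi> contour_integrable_on linepath a b" if "closed_segment a b \<subseteq> S - pts" for a b
    using that isCont_\<Phi> unfolding pts_def
    by (intro contour_integrable_continuous_linepath continuous_at_imp_continuous_on) blast
  have split: "contour_integral (rectpath c1 c3) \<Phi> = contour_integral (linepath c1 c2) \<Phi> +
      (contour_integral (linepath c2 c3) \<Phi> + (contour_integral (linepath c3 c4) \<Phi> + contour_integral (linepath c4 c1) \<Phi>))"
  proof -
    have "rectpath c1 c3 = linepath c1 c2 +++ linepath c2 c3 +++ linepath c3 c4 +++ linepath c4 c1"
      by (simp add: rectpath_def Let_def c_defs)
    thus ?thesis using ci[OF seg(1)] ci[OF seg(2)] ci[OF seg(3)] ci[OF seg(4)]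
      by (simp add: valid_path_join contour_integrable_joinI)
  qed
  define I where "I = integral {-X..X} (\<lambda>x. \<Phi> (Complex x pi))"
  have top_int: "(\<lambda>x. \<Phi> (Complex x pi)) integrable_on {-X..X}"
  proof (intro integrable_continuous_real continuous_at_imp_continuous_on ballI)
    fix x assume "x \<in> {-X..X}"
    have "Complex x pi \<in> S - pts" using pia by (auto simp: S_def pts_def wp_def w0_def complex_eq_iff)
    hence "isCont \<Phi> (Complex x pi)" by (intro isCont_\<Phi>) (simp only: pts_def)
    moreover have "isCont (\<lambda>x. Complex x pi) x" unfolding Complex_eq by (intro continuous_intros)
    ultimately show "isCont (\<lambda>x. \<Phi> (Complex x pi)) x" by (rule isCont_o2[rotated])
  qed
  have bot: "contour_integral (linepath c1 c2) \<Phi> = cnj I"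
  proof -
    have "contour_integral (linepath c1 c2) \<Phi> = integral {-X..X} (\<lambda>x. \<Phi> (Complex x (-pi)))"
      unfolding c_defs using X0 by (intro contour_integral_horizontal) simp
    also have "(\<lambda>x. \<Phi> (Complex x (-pi))) = (\<lambda>x. cnj (\<Phi> (Complex x pi)))"
      by (simp only: \<Phi>_cnj[symmetric] complex_cnj)
    also have "integral {-X..X} \<dots> = cnj I" unfolding I_def by (simp add: integral_cnj)
    finally show ?thesis .
  qed
  have top: "contour_integral (linepath c3 c4) \<Phi> = - I"
  proof -
    have "contour_integral (linepath c3 c4) \<Phi> = - contour_integral (linepath c4 c3) \<Phi>"
      using seg(3) isCont_\<Phi> unfolding pts_def
      by (intro contour_integral_reverse_linepath continuous_at_imp_continuous_on) blast
    also have "contour_integral (linepath c4 c3) \<Phi> = I"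
      unfolding c_defs I_def using X0 by (intro contour_integral_horizontal) simp
    finally show ?thesis .
  qed
  have ImI: "Im I = pi * ?J"
  proof -
    have "Im I = integral {-X..X} (\<lambda>x. Im (\<Phi> (Complex x pi)))"
      unfolding I_def using integral_linear[OF top_int bounded_linear_Im] by (simp add: o_def)
    thus ?thesis by (simp only: Im_\<Phi>_top integral_mult_right)
  qed
  have II: "cnj I + (- I) = - (2 * pi * \<i> * of_real ?J)"
    by (simp add: complex_eq_iff ImI)
  have shift: "R + L = 2 * pi * \<i> * of_real (j - h)"
    if "cnj I + (- I) = - (2 * pi * \<i> * of_real j)" "cnj I + (R + (- I + L)) = 2 * pi * \<i> * of_real (- h)"
    for R L :: complex and j h :: real
  proof -
    have "R + L = (cnj I + (R + (- I + L))) - (cnj I + (- I))" by simp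
    also have "\<dots> = 2 * pi * \<i> * of_real (j - h)" unfolding that by (simp add: algebra_simps)
    finally show ?thesis .
  qed
  have eq: "contour_integral (linepath c2 c3) \<Phi> + contour_integral (linepath c4 c1) \<Phi>
      = 2 * pi * \<i> * of_real (?J - ?h)"
    by (rule shift[OF II res[unfolded split bot top]])
  have A0: "A \<ge> 0" "B \<ge> 0"
    using A[of "Complex X 0"] B[of "Complex (-X) 0"] norm_ge_zero[of "\<Phi> (Complex X 0)"] norm_ge_zero[of "\<Phi> (Complex (-X) 0)"]
    by (auto intro: order.trans[OF norm_ge_zero])
  have "norm (contour_integral (linepath c2 c3) \<Phi>) \<le> A * norm (c3 - c2)"
    by (intro contour_integral_bound_linepath ci[OF seg(2)] A0 A) (auto simp: c_defs closed_segment_same_Re)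
  moreover have "norm (contour_integral (linepath c4 c1) \<Phi>) \<le> B * norm (c1 - c4)"
    by (intro contour_integral_bound_linepath ci[OF seg(4)] A0 B) (auto simp: c_defs closed_segment_same_Re)
  moreover have "norm (c3 - c2) = 2 * pi" "norm (c1 - c4) = 2 * pi"
    by (simp_all add: c_defs cmod_def complex_diff real_sqrt_mult)
  ultimately have "norm (contour_integral (linepath c2 c3) \<Phi> + contour_integral (linepath c4 c1) \<Phi>) \<le> A * (2 * pi) + B * (2 * pi)"
    by (metis add_mono norm_triangle_le)
  hence "2 * pi * \<bar>?J - ?h\<bar> \<le> 2 * pi * (A + B)"
    unfolding eq norm_mult norm_of_real by (simp add: algebra_simps)
  thus ?thesis by simp
qed

lemma J_tendsto:
  "(\<lambda>n. integral {-real n..real n} (\<lambda>x. ml_kernel \<alpha> x / (p + exp x)))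
     \<longlonglongrightarrow> p powr (\<alpha> - 2) / (p powr \<alpha> + 1) - 2 * Re (1 / (of_real \<alpha> * s0 * (of_real p - s0)))"
proof (rule LIM_zero_cancel, rule Lim_null_comparison)
  let ?A = "\<lambda>X. exp ((\<alpha> - 1) * X) / ((exp (\<alpha> * X) - 1) * (exp X - p))"
  let ?B = "\<lambda>X. exp ((\<alpha> - 1) * - X) / ((1 - exp (\<alpha> * - X)) * (p - exp (- X)))"
  have "eventually (\<lambda>X. X > \<bar>ln p\<bar>) at_top" by (rule eventually_gt_at_top)
  hence "eventually (\<lambda>X. \<bar>integral {-X..X} (\<lambda>x. ml_kernel \<alpha> x / (p + exp x))
            - (p powr (\<alpha> - 2) / (p powr \<alpha> + 1) - 2 * Re (1 / (of_real \<alpha> * s0 * (of_real p - s0))))\<bar>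
         \<le> ?A X + ?B X) at_top"
  proof eventually_elim
    case (elim X)
    hence "X > ln p" "- X < ln p" "X > 0" by auto
    hence "exp X > p" "exp (-X) < p" "\<alpha> * X > 0" using p \<alpha> by (metis exp_ln exp_less_mono, metis exp_ln exp_less_mono, simp)
    thus ?case using elim by (intro J_bound norm_\<Phi>_left norm_\<Phi>_right) auto
  qed
  thus "eventually (\<lambda>n. norm (integral {-real n..real n} (\<lambda>x. ml_kernel \<alpha> x / (p + exp x))
            - (p powr (\<alpha> - 2) / (p powr \<alpha> + 1) - 2 * Re (1 / (of_real \<alpha> * s0 * (of_real p - s0)))))
         \<le> ?A (real n) + ?B (real n)) sequentially"
    unfolding real_norm_def by (rule eventually_compose_filterlim[OF _ filterlim_real_sequentially])
  have E: "((\<lambda>X::real. exp (- (c * X))) \<longlongrightarrow> 0) at_top" if "c > 0" for c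
    by (rule filterlim_compose[OF exp_at_bot])
      (simp add: filterlim_uminus_at_bot filterlim_tendsto_pos_mult_at_top[OF tendsto_const that filterlim_ident])
  have "((\<lambda>X. exp (- (2 * X)) / ((1 - exp (- (\<alpha> * X))) * (1 - p * exp (- (1 * X))))) \<longlongrightarrow> 0 / ((1 - 0) * (1 - p * 0))) at_top"
    using \<alpha> by (intro tendsto_intros E) auto
  also have "(\<lambda>X. exp (- (2 * X)) / ((1 - exp (- (\<alpha> * X))) * (1 - p * exp (- (1 * X))))) = ?A"
  proof
    fix X
    have "exp ((\<alpha> - 1) * X) = exp (- (2 * X)) * (exp (\<alpha> * X) * exp X)"
      by (simp add: algebra_simps flip: exp_add)
    moreover have "(exp (\<alpha> * X) - 1) * (exp X - p) = ((1 - exp (- (\<alpha> * X))) * (1 - p * exp (- (1 * X)))) * (exp (\<alpha> * X) * exp X)"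
      by (simp add: exp_minus field_simps)
    ultimately show "exp (- (2 * X)) / ((1 - exp (- (\<alpha> * X))) * (1 - p * exp (- (1 * X)))) = ?A X"
      by simp
  qed
  finally have "(?A \<longlongrightarrow> 0) at_top" by simp
  moreover have "(?B \<longlongrightarrow> exp 0 * 0 / ((1 - 0) * (p - 0))) at_top"
  proof -
    have "((\<lambda>X. exp 0 * exp (- ((\<alpha> - 1) * X)) / ((1 - exp (- (\<alpha> * X))) * (p - exp (- (1 * X))))) \<longlongrightarrow> exp 0 * 0 / ((1 - 0) * (p - 0))) at_top"
      using \<alpha> p by (intro tendsto_intros E) auto
    thus ?thesis by simp
  qed
  hence "(?B \<longlongrightarrow> 0) at_top" by simp
  ultimately have "((\<lambda>X. ?A X + ?B X) \<longlongrightarrow> 0 + 0) at_top" by (rule tendsto_add)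
  thus "(\<lambda>n. ?A (real n) + ?B (real n)) \<longlonglongrightarrow> 0"
    using filterlim_compose[OF _ filterlim_real_sequentially] by force
qed

end

section \<open>Integral representation and lower bound at infinity\<close>

text \<open>The pole \<open>e\<^bsup>i\<pi>/\<alpha>\<^esup>\<close> of \<open>1 / (s\<^sup>\<alpha> + 1)\<close> in the upper half-plane; its real part is negative for
  \<open>1 < \<alpha> < 2\<close>.\<close>

definition ml_root :: "real \<Rightarrow> complex" where "ml_root \<alpha> = cis (pi / \<alpha>)"

text \<open>Bounds for \<open>\<bar>1 + u e\<^bsup>i\<pi>\<alpha>\<^esup>\<bar>\<^sup>2\<close> with \<open>u = e\<^bsup>\<alpha>x\<^esup>\<close>: the first two make the density
  decay at both ends, the third bounds it below for \<open>x \<le> 0\<close>.\<close>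

lemma ml_kernel_den:
  fixes \<alpha> x :: real
  defines "u \<equiv> exp (\<alpha> * x)" and "c \<equiv> cos (pi * \<alpha>)" and "s \<equiv> sin (pi * \<alpha>)"
  defines "D \<equiv> (1 + u * c)\<^sup>2 + (u * s)\<^sup>2"
  shows "D \<ge> s\<^sup>2" "D \<ge> u\<^sup>2 * s\<^sup>2" "D \<le> (1 + u)\<^sup>2"
proof -
  have cs: "c\<^sup>2 + s\<^sup>2 = 1" unfolding c_def s_def by simp
  have D: "D = 1 + 2 * u * c + u\<^sup>2"
  proof -
    have "D = 1 + 2 * u * c + u\<^sup>2 * (c\<^sup>2 + s\<^sup>2)" unfolding D_def by algebra
    thus ?thesis using cs by simp
  qed
  have "D = (u + c)\<^sup>2 + s\<^sup>2" unfolding D using cs by algebra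
  thus "D \<ge> s\<^sup>2" by simp
  show "D \<ge> u\<^sup>2 * s\<^sup>2" unfolding D_def by (simp add: power_mult_distrib)
  have "u * c \<le> u * 1" unfolding u_def c_def by (intro mult_left_mono) auto
  thus "D \<le> (1 + u)\<^sup>2" unfolding D by (simp add: power2_eq_square algebra_simps)
qed

lemma ml_kernel_measurable [measurable]: "ml_kernel \<alpha> \<in> borel_measurable borel"
  unfolding ml_kernel_def[abs_def] by measurable

lemma ml_kernel_integrable:
  assumes \<alpha>: "1 < \<alpha>" "\<alpha> < 2"
  shows "integrable lborel (ml_kernel \<alpha>)"
proof -
  define s where "s = sin (pi * \<alpha>)"
  have s: "s < 0" unfolding s_def by (rule sin_pi_neg[OF \<alpha>])
  define C where "C = 1 / (pi * (- s))"
  have C: "C > 0" using s by (simp add: C_def mult_pos_neg)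
  define b where "b = (\<lambda>x::real. C * (indicator {0..} x * exp (- 1 * x)) + C * (indicator {0..} (-x) * exp (- (\<alpha> - 1) * (- x))))"
  have e: "integrable lborel (\<lambda>x. indicator {0..} x * exp (- c * x))" if "c > 0" for c :: real
    using integrable_power_exp[OF that, of 0] by simp
  have "integrable lborel (\<lambda>x. indicator {0..} (0 + (-1) * x) * exp (- (\<alpha> - 1) * (0 + (-1) * x)))"
    by (rule lborel_integrable_real_affine[OF e]) (use \<alpha> in auto)
  hence bint: "integrable lborel b"
    unfolding b_def using e[of 1] by (intro Bochner_Integration.integrable_add integrable_mult_right) auto
  show ?thesis
  proof (rule Bochner_Integration.integrable_bound[OF bint])
    show "AE x in lborel. norm (ml_kernel \<alpha> x) \<le> norm (b x)"
    proof (intro AE_I2)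
      fix x :: real
      define u where "u = exp (\<alpha> * x)"
      define D where "D = (1 + u * cos (pi * \<alpha>))\<^sup>2 + (u * s)\<^sup>2"
      have D: "D \<ge> s\<^sup>2" "D \<ge> u\<^sup>2 * s\<^sup>2"
        using ml_kernel_den(1,2)[of \<alpha> x] by (simp_all add: D_def u_def s_def)
      have s2: "s\<^sup>2 > 0" using s by simp
      hence Dpos: "D > 0" using D(1) by linarith
      have u: "u > 0" by (simp add: u_def)
      have eq: "norm (ml_kernel \<alpha> x) = (1 / pi) * exp ((\<alpha> - 1) * x) * (- s) / D"
        using s Dpos unfolding ml_kernel_def D_def u_def s_def by (simp add: abs_mult)
      have bnn: "b x \<ge> 0" using C by (simp add: b_def)
      have "(1 / pi) * exp ((\<alpha> - 1) * x) * (- s) / D \<le> b x"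
      proof (cases "x \<ge> 0")
        case True
        have "(1 / pi) * exp ((\<alpha> - 1) * x) * (- s) / D \<le> (1 / pi) * exp ((\<alpha> - 1) * x) * (- s) / (u\<^sup>2 * s\<^sup>2)"
          using s D u by (intro divide_left_mono mult_nonneg_nonneg mult_pos_pos Dpos) auto
        also have "\<dots> = C * (exp ((\<alpha> - 1) * x) / u\<^sup>2)"
          using s u by (simp add: C_def power2_eq_square field_simps)
        also have "exp ((\<alpha> - 1) * x) / u\<^sup>2 = exp (- (\<alpha> + 1) * x)"
          by (simp add: u_def power2_eq_square exp_diff[symmetric] exp_add[symmetric] algebra_simps)
        also have "C * exp (- (\<alpha> + 1) * x) \<le> C * exp (- 1 * x)"
        proof -
          have "1 * x \<le> (\<alpha> + 1) * x" using True \<alpha> by (intro mult_right_mono) auto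
          hence "- (\<alpha> + 1) * x \<le> - 1 * x" by (simp add: algebra_simps)
          thus ?thesis using C by (intro mult_left_mono) auto
        qed
        also have "\<dots> \<le> b x" using True C by (simp add: b_def)
        finally show ?thesis .
      next
        case False
        have "(1 / pi) * exp ((\<alpha> - 1) * x) * (- s) / D \<le> (1 / pi) * exp ((\<alpha> - 1) * x) * (- s) / s\<^sup>2"
          using s D by (intro divide_left_mono mult_nonneg_nonneg mult_pos_pos Dpos) auto
        also have "\<dots> = C * exp ((\<alpha> - 1) * x)"
          using s by (simp add: C_def power2_eq_square field_simps)
        also have "\<dots> = C * exp (- (\<alpha> - 1) * (- x))" by (simp only: mult_minus_left mult_minus_right minus_minus)
        also have "\<dots> = b x" using False by (simp add: b_def)
        finally show ?thesis .
      qed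
      thus "norm (ml_kernel \<alpha> x) \<le> norm (b x)" using eq bnn by simp
    qed
  qed measurable
qed

lemma ml_kernel_nonneg: "1 < \<alpha> \<Longrightarrow> \<alpha> < 2 \<Longrightarrow> ml_kernel \<alpha> x \<ge> 0"
  by (rule ml_contour.kernel_nonneg[of \<alpha> 1]) (simp add: ml_contour_def)

lemma ml_kernel_stieltjes:
  assumes \<alpha>: "1 < \<alpha>" "\<alpha> < 2" and p: "p > 0"
  shows "has_bochner_integral lborel (\<lambda>x. ml_kernel \<alpha> x / (p + exp x))
           (p powr (\<alpha> - 2) / (p powr \<alpha> + 1) - 2 * Re (1 / (of_real \<alpha> * ml_root \<alpha> * (of_real p - ml_root \<alpha>))))"
proof -
  interpret ml_contour \<alpha> p using assms by unfold_locales
  have root: "s0 = ml_root \<alpha>" by (simp add: s0_def w0_def ml_root_def exp_eq_polar)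
  let ?f = "\<lambda>x. ml_kernel \<alpha> x / (p + exp x)"
  have px: "p + exp x > 0" for x using p exp_gt_zero[of x] by linarith
  have nn: "?f x \<ge> 0" for x using ml_kernel_nonneg[OF \<alpha>] px[of x] by simp
  have int: "integrable lborel ?f"
  proof (rule Bochner_Integration.integrable_bound)
    show "integrable lborel (\<lambda>x. ml_kernel \<alpha> x / p)" using ml_kernel_integrable[OF \<alpha>] by simp
    have "\<bar>ml_kernel \<alpha> x / (p + exp x)\<bar> \<le> \<bar>ml_kernel \<alpha> x / p\<bar>" for x
      using ml_kernel_nonneg[OF \<alpha>, of x] p px[of x] by (auto intro!: divide_left_mono)
    thus "AE x in lborel. norm (?f x) \<le> norm (ml_kernel \<alpha> x / p)" by simp
  qed measurable
  have "(\<lambda>n. LINT x|lborel. indicator {-real n..real n} x *\<^sub>R ?f x) \<longlonglongrightarrow> (LINT x|lborel. ?f x)"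
  proof (rule integral_dominated_convergence[where w = ?f])
    show "AE x in lborel. (\<lambda>n. indicator {-real n..real n} x *\<^sub>R ?f x) \<longlonglongrightarrow> ?f x"
    proof (intro AE_I2 tendsto_eventually)
      fix x :: real
      obtain N :: nat where N: "\<bar>x\<bar> \<le> real N" using real_arch_simple by blast
      show "eventually (\<lambda>n. indicator {-real n..real n} x *\<^sub>R ?f x = ?f x) sequentially"
        using eventually_ge_at_top[of N] by eventually_elim (use N in \<open>auto simp: indicator_def\<close>)
    qed
    show "AE x in lborel. norm (indicator {-real n..real n} x *\<^sub>R ?f x) \<le> ?f x" for n
    proof (intro AE_I2)
      fix x
      have "norm (?f x) = ?f x" using nn[of x] by (simp only: real_norm_def abs_of_nonneg)
      thus "norm (indicator {-real n..real n} x *\<^sub>R ?f x) \<le> ?f x"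
        using nn[of x] by (cases "x \<in> {-real n..real n}") simp_all
    qed
  qed (use int in auto)
  also have "(\<lambda>n. LINT x|lborel. indicator {-real n..real n} x *\<^sub>R ?f x) = (\<lambda>n. integral {-real n..real n} ?f)"
  proof
    fix n
    have "set_integrable lborel {-real n..real n} ?f"
      unfolding set_integrable_def by (rule integrable_mult_indicator[OF _ int]) simp
    from set_borel_integral_eq_integral(2)[OF this]
    show "(LINT x|lborel. indicator {-real n..real n} x *\<^sub>R ?f x) = integral {-real n..real n} ?f"
      by (simp add: set_lebesgue_integral_def)
  qed
  finally have "(LINT x|lborel. ?f x) = p powr (\<alpha> - 2) / (p powr \<alpha> + 1) - 2 * Re (1 / (of_real \<alpha> * ml_root \<alpha> * (of_real p - ml_root \<alpha>)))"
    using J_tendsto unfolding root by (rule LIMSEQ_unique)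
  with int show ?thesis by (simp add: has_bochner_integral_iff)
qed

text \<open>The contribution of the branch cut to \<open>t E\<^bsub>\<alpha>,2\<^esub>(-t\<^sup>\<alpha>)\<close>; the integral over \<open>r > 0\<close> is written in
  the variable \<open>x = ln r\<close>.\<close>

definition ml_cut :: "real \<Rightarrow> real \<Rightarrow> real" where
  "ml_cut \<alpha> t = (LINT x|lborel. exp (- t * exp x) * ml_kernel \<alpha> x)"

text \<open>The contribution of the pair of conjugate poles.\<close>

definition ml_osc :: "real \<Rightarrow> real \<Rightarrow> real" where
  "ml_osc \<alpha> t = 2 * Re (exp (of_real t * ml_root \<alpha>) / (of_real \<alpha> * ml_root \<alpha>))"

lemma ml_cut_integrable:
  assumes \<alpha>: "1 < \<alpha>" "\<alpha> < 2" and t: "t \<ge> 0"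
  shows "integrable lborel (\<lambda>x. exp (- t * exp x) * ml_kernel \<alpha> x)"
proof (rule Bochner_Integration.integrable_bound[OF ml_kernel_integrable[OF \<alpha>]])
  have "\<bar>exp (- t * exp x) * ml_kernel \<alpha> x\<bar> \<le> \<bar>ml_kernel \<alpha> x\<bar>" for x
  proof -
    have "exp (- t * exp x) \<le> 1" using t by simp
    from mult_right_mono[OF this abs_ge_zero[of "ml_kernel \<alpha> x"]] show ?thesis by (simp add: abs_mult)
  qed
  thus "AE x in lborel. norm (exp (- t * exp x) * ml_kernel \<alpha> x) \<le> norm (ml_kernel \<alpha> x)" by simp
qed measurable

lemma exp_bounded_ml_cut:
  assumes \<alpha>: "1 < \<alpha>" "\<alpha> < 2"
  shows "exp_bounded 0 (ml_cut \<alpha>)"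
proof -
  have "ml_cut \<alpha> \<in> borel_measurable borel"
    unfolding ml_cut_def[abs_def] by measurable
  moreover have "\<bar>ml_cut \<alpha> t\<bar> \<le> (LINT x|lborel. ml_kernel \<alpha> x) * exp (0 * t)" if t: "t \<ge> 0" for t
  proof -
    have "\<bar>exp (- t * exp x) * ml_kernel \<alpha> x\<bar> \<le> ml_kernel \<alpha> x" for x
    proof -
      have "exp (- t * exp x) \<le> 1" using t by simp
      from mult_right_mono[OF this ml_kernel_nonneg[OF \<alpha>, of x]] show ?thesis 
        using ml_kernel_nonneg[OF \<alpha>, of x] by (simp add: abs_mult)
    qed
    hence "(LINT x|lborel. \<bar>exp (- t * exp x) * ml_kernel \<alpha> x\<bar>) \<le> (LINT x|lborel. ml_kernel \<alpha> x)"
      by (intro integral_mono integrable_abs ml_cut_integrable[OF \<alpha> t] ml_kernel_integrable[OF \<alpha>])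
    moreover have "\<bar>ml_cut \<alpha> t\<bar> \<le> (LINT x|lborel. \<bar>exp (- t * exp x) * ml_kernel \<alpha> x\<bar>)"
      unfolding ml_cut_def using integral_norm_bound[of lborel "\<lambda>x. exp (- t * exp x) * ml_kernel \<alpha> x"] by simp
    ultimately show ?thesis by simp
  qed
  moreover have "(LINT x|lborel. ml_kernel \<alpha> x) \<ge> 0"
    by (intro Bochner_Integration.integral_nonneg ml_kernel_nonneg[OF \<alpha>])
  ultimately show ?thesis unfolding exp_bounded_def by blast
qed

lemma isCont_ml_cut:
  assumes \<alpha>: "1 < \<alpha>" "\<alpha> < 2" and t: "t > 0"
  shows "isCont (ml_cut \<alpha>) t"
proof (rule continuous_at_sequentially[THEN iffD2], intro allI impI)
  fix X :: "nat \<Rightarrow> real" assume X: "X \<longlonglongrightarrow> t"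
  show "(ml_cut \<alpha> \<circ> X) \<longlonglongrightarrow> ml_cut \<alpha> t"
  proof -
    obtain N where N: "\<And>n. n \<ge> N \<Longrightarrow> X n > 0"
      using order_tendstoD(1)[OF X t] by (auto simp: eventually_sequentially)
    have "(\<lambda>n. ml_cut \<alpha> (X (n + N))) \<longlonglongrightarrow> ml_cut \<alpha> t"
      unfolding ml_cut_def
    proof (rule integral_dominated_convergence[where w = "ml_kernel \<alpha>"])
      show "AE x in lborel. (\<lambda>n. exp (- X (n + N) * exp x) * ml_kernel \<alpha> x) \<longlonglongrightarrow> exp (- t * exp x) * ml_kernel \<alpha> x"
        by (intro AE_I2 tendsto_intros LIMSEQ_ignore_initial_segment X)
      show "AE x in lborel. norm (exp (- X (n + N) * exp x) * ml_kernel \<alpha> x) \<le> ml_kernel \<alpha> x" for n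
      proof (intro AE_I2)
        fix x
        have "exp (- X (n + N) * exp x) \<le> 1" using N[of "n + N"] by simp
        from mult_right_mono[OF this ml_kernel_nonneg[OF \<alpha>, of x]]
        show "norm (exp (- X (n + N) * exp x) * ml_kernel \<alpha> x) \<le> ml_kernel \<alpha> x"
          using ml_kernel_nonneg[OF \<alpha>, of x] by (simp add: abs_mult)
      qed
    qed (use ml_kernel_integrable[OF \<alpha>] in auto)
    thus ?thesis by (simp add: o_def LIMSEQ_offset)
  qed
qed

lemma laplace_ml_cut:
  assumes \<alpha>: "1 < \<alpha>" "\<alpha> < 2" and p: "p > 0"
  shows "laplace (ml_cut \<alpha>) p = (LINT x|lborel. ml_kernel \<alpha> x / (p + exp x))"
proof -
  let ?F = "\<lambda>(x, t). indicator {0..} t * (exp (- p * t) * (exp (- t * exp x) * ml_kernel \<alpha> x))"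
  have inner: "has_bochner_integral lborel (\<lambda>t. indicator {0..} t * (exp (- p * t) * (exp (- t * exp x) * ml_kernel \<alpha> x)))
      (ml_kernel \<alpha> x / (p + exp x))" for x
  proof -
    have px: "p + exp x > 0" using p exp_gt_zero[of x] by linarith
    have "has_bochner_integral lborel (\<lambda>t. indicator {0..} t * (exp (- (p + exp x) * t) * t ^ 0)) (1 / (p + exp x))"
    proof -
      have *: "has_bochner_integral lborel (\<lambda>t. indicator {0..} t * (exp (- (p + exp x) * t) * t powr 0)) (1 / (p + exp x))"
        using has_bochner_integral_powr_exp[OF px, of 0] px by simp
      have "AE t in lborel. indicator {0..} t * (exp (- (p + exp x) * t) * t powr 0) = indicator {0..} t * (exp (- (p + exp x) * t) * t ^ 0)"
        using AE_lborel_singleton[of "0::real"] by eventually_elim auto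
      thus ?thesis using * by (subst has_bochner_integral_cong_AE[symmetric]) auto
    qed
    hence "has_bochner_integral lborel (\<lambda>t. indicator {0..} t * (exp (- (p + exp x) * t) * t ^ 0) * ml_kernel \<alpha> x) (1 / (p + exp x) * ml_kernel \<alpha> x)"
      by (rule has_bochner_integral_mult_left)
    also have "(\<lambda>t. indicator {0..} t * (exp (- (p + exp x) * t) * t ^ 0) * ml_kernel \<alpha> x)
       = (\<lambda>t. indicator {0..} t * (exp (- p * t) * (exp (- t * exp x) * ml_kernel \<alpha> x)))"
    proof
      fix t
      have "exp (- (p + exp x) * t) = exp (- p * t) * exp (- t * exp x)"
        by (simp add: algebra_simps flip: exp_add)
      thus "indicator {0..} t * (exp (- (p + exp x) * t) * t ^ 0) * ml_kernel \<alpha> x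
         = indicator {0..} t * (exp (- p * t) * (exp (- t * exp x) * ml_kernel \<alpha> x))" by simp
    qed
    finally show ?thesis by simp
  qed
  have F_nonneg: "?F z \<ge> 0" for z using ml_kernel_nonneg[OF \<alpha>] by (cases z) simp
  have meas: "?F \<in> borel_measurable (lborel \<Otimes>\<^sub>M lborel)" by measurable
  have int: "integrable (lborel \<Otimes>\<^sub>M lborel) ?F"
  proof (rule lborel_pair.Fubini_integrable[OF meas])
    have "(\<lambda>x. LINT t|lborel. norm (?F (x, t))) = (\<lambda>x. ml_kernel \<alpha> x / (p + exp x))"
    proof
      fix x
      have "(LINT t|lborel. norm (?F (x, t))) = (LINT t|lborel. ?F (x, t))"
        using F_nonneg by (intro Bochner_Integration.integral_cong) (simp_all only: real_norm_def abs_of_nonneg)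
      also have "\<dots> = ml_kernel \<alpha> x / (p + exp x)"
        using inner[of x] by (simp add: has_bochner_integral_iff)
      finally show "(LINT t|lborel. norm (?F (x, t))) = ml_kernel \<alpha> x / (p + exp x)" .
    qed
    thus "integrable lborel (\<lambda>x. LINT t|lborel. norm (?F (x, t)))"
      using ml_kernel_stieltjes[OF \<alpha> p] by (simp add: has_bochner_integral_iff)
    show "AE x in lborel. integrable lborel (\<lambda>t. ?F (x, t))"
      using inner by (auto simp: has_bochner_integral_iff)
  qed
  have "(LINT t|lborel. LINT x|lborel. ?F (x, t)) = (LINT x|lborel. LINT t|lborel. ?F (x, t))"
    using lborel_pair.Fubini_integral[of "\<lambda>x t. ?F (x, t)"] int by simp
  also have "\<dots> = (LINT x|lborel. ml_kernel \<alpha> x / (p + exp x))"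
    using inner by (simp add: has_bochner_integral_iff)
  also have "(LINT t|lborel. LINT x|lborel. ?F (x, t)) = laplace (ml_cut \<alpha>) p"
    unfolding laplace_def ml_cut_def by (simp only: prod.case integral_mult_right_zero)
  finally show ?thesis .
qed

lemma Re_ml_root_neg:
  assumes "1 < \<alpha>" "\<alpha> < 2"
  shows "Re (ml_root \<alpha>) < 0"
proof -
  have "pi / 2 < pi / \<alpha>" "pi / \<alpha> < pi" using assms by (simp_all add: field_simps)
  hence "cos (pi / \<alpha>) < cos (pi / 2)" by (intro cos_monotone_0_pi) auto
  thus ?thesis by (simp add: ml_root_def)
qed

lemma norm_ml_osc:
  assumes "1 < \<alpha>"
  shows "\<bar>ml_osc \<alpha> t\<bar> \<le> 2 * exp (t * Re (ml_root \<alpha>))"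
proof -
  have "\<bar>Re (exp (of_real t * ml_root \<alpha>) / (of_real \<alpha> * ml_root \<alpha>))\<bar>
      \<le> norm (exp (of_real t * ml_root \<alpha>) / (of_real \<alpha> * ml_root \<alpha>))" by (rule abs_Re_le_cmod)
  also have "\<dots> = exp (t * Re (ml_root \<alpha>)) / \<alpha>"
    using assms by (simp add: norm_divide norm_mult ml_root_def)
  also have "\<dots> \<le> exp (t * Re (ml_root \<alpha>)) / 1"
    using assms by (intro divide_left_mono) auto
  finally show ?thesis by (simp add: ml_osc_def abs_mult)
qed

lemma exp_bounded_ml_osc:
  assumes \<alpha>: "1 < \<alpha>" "\<alpha> < 2"
  shows "exp_bounded 0 (ml_osc \<alpha>)"
proof -
  have "ml_osc \<alpha> \<in> borel_measurable borel"
    unfolding ml_osc_def[abs_def] by (intro borel_measurable_continuous_onI continuous_intros) (use \<alpha> in \<open>auto simp: ml_root_def\<close>)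
  moreover have "\<bar>ml_osc \<alpha> t\<bar> \<le> 2 * exp (0 * t)" if t: "t \<ge> 0" for t
  proof -
    have "t * Re (ml_root \<alpha>) \<le> 0" using t Re_ml_root_neg[OF \<alpha>] by (simp add: mult_nonneg_nonpos)
    thus ?thesis by (intro order.trans[OF norm_ml_osc[OF \<alpha>(1)]]) simp
  qed
  ultimately show ?thesis unfolding exp_bounded_def by (intro conjI exI[of _ 2]) auto
qed

lemma laplace_ml_osc:
  assumes \<alpha>: "1 < \<alpha>" "\<alpha> < 2" and p: "p > 0"
  shows "laplace (ml_osc \<alpha>) p = 2 * Re (1 / (of_real \<alpha> * ml_root \<alpha> * (of_real p - ml_root \<alpha>)))"
proof -
  define q where "q = of_real p - ml_root \<alpha>"
  define c where "c = 2 / (of_real \<alpha> * ml_root \<alpha>)"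
  have "Re q > 0" using p Re_ml_root_neg[OF \<alpha>] by (simp add: q_def)
  hence "has_bochner_integral lborel (\<lambda>x. c * (indicator {0..} x *\<^sub>R exp (- (of_real x * q)))) (c * (1 / q))"
    by (intro has_bochner_integral_mult_right has_bochner_integral_exp_complex)
  from has_bochner_integral_Re[OF this]
  have "has_bochner_integral lborel (\<lambda>x. Re (c * (indicator {0..} x *\<^sub>R exp (- (of_real x * q))))) (Re (c * (1 / q)))" .
  also have "(\<lambda>x. Re (c * (indicator {0..} x *\<^sub>R exp (- (of_real x * q))))) = (\<lambda>x. indicator {0..} x * (exp (- p * x) * ml_osc \<alpha> x))"
  proof
    fix x :: real
    have "exp (- (of_real x * q)) = of_real (exp (- p * x)) * exp (of_real x * ml_root \<alpha>)"
      by (simp add: q_def algebra_simps exp_of_real[symmetric] flip: exp_add)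
    hence "c * (indicator {0..} x *\<^sub>R exp (- (of_real x * q)))
       = of_real (indicator {0..} x * exp (- p * x)) * (c * exp (of_real x * ml_root \<alpha>))"
      by (simp add: scaleR_conv_of_real)
    also have "Re \<dots> = indicator {0..} x * exp (- p * x) * Re (c * exp (of_real x * ml_root \<alpha>))"
      by (simp only: times_complex.sel Re_complex_of_real Im_complex_of_real mult_zero_left diff_zero)
    also have "c * exp (of_real x * ml_root \<alpha>) = of_real 2 * (exp (of_real x * ml_root \<alpha>) / (of_real \<alpha> * ml_root \<alpha>))"
      by (simp add: c_def)
    also have "Re \<dots> = ml_osc \<alpha> x" unfolding ml_osc_def
      by (simp only: times_complex.sel Re_complex_of_real Im_complex_of_real mult_zero_left diff_zero)
    finally show "Re (c * (indicator {0..} x *\<^sub>R exp (- (of_real x * q)))) = indicator {0..} x * (exp (- p * x) * ml_osc \<alpha> x)"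
      by (simp add: mult.assoc)
  qed
  finally have "laplace (ml_osc \<alpha>) p = Re (c * (1 / q))"
    by (simp add: laplace_def has_bochner_integral_iff)
  also have "c * (1 / q) = of_real 2 * (1 / (of_real \<alpha> * ml_root \<alpha> * (of_real p - ml_root \<alpha>)))"
    by (simp add: c_def q_def)
  also have "Re \<dots> = 2 * Re (1 / (of_real \<alpha> * ml_root \<alpha> * (of_real p - ml_root \<alpha>)))"
    by (simp only: times_complex.sel Re_complex_of_real Im_complex_of_real mult_zero_left diff_zero)
  finally show ?thesis .
qed

lemma ml_mode_decomp:
  assumes \<alpha>: "1 < \<alpha>" "\<alpha> < 2" and t: "t > 0"
  shows "ml_mode \<alpha> 1 t = ml_cut \<alpha> t + ml_osc \<alpha> t"
proof -
  have e: "exp_bounded 2 (ml_cut \<alpha>)" "exp_bounded 2 (ml_osc \<alpha>)"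
    using exp_bounded_mono[OF exp_bounded_ml_cut[OF \<alpha>]] exp_bounded_mono[OF exp_bounded_ml_osc[OF \<alpha>]] by auto
  \<comment> \<open>The transforms agree for \<open>s > 2\<close>; any base \<open>b\<close> with \<open>b\<^sup>\<alpha> > 1\<close> would do.\<close>
  have b: "1 < (2::real) powr \<alpha>" using \<alpha> by simp
  have 1: "exp_bounded 2 (ml_mode \<alpha> 1)" using \<alpha> b by (intro exp_bounded_ml_mode) auto
  have 2: "exp_bounded 2 (\<lambda>t. ml_cut \<alpha> t + ml_osc \<alpha> t)" by (intro exp_bounded_add e)
  have 3: "isCont (ml_mode \<alpha> 1) t" using \<alpha> t by (intro isCont_ml_mode) auto
  have "isCont (ml_osc \<alpha>) t"
    unfolding ml_osc_def[abs_def] by (intro continuous_intros) (use \<alpha> in \<open>auto simp: ml_root_def\<close>)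
  hence 4: "isCont (\<lambda>t. ml_cut \<alpha> t + ml_osc \<alpha> t) t"
    using isCont_ml_cut[OF \<alpha> t] by (intro continuous_intros)
  have 5: "laplace (ml_mode \<alpha> 1) s = laplace (\<lambda>t. ml_cut \<alpha> t + ml_osc \<alpha> t) s" if s: "s > 2" for s
  proof -
  have "laplace (\<lambda>t. ml_cut \<alpha> t + ml_osc \<alpha> t) s = laplace (ml_cut \<alpha>) s + laplace (ml_osc \<alpha>) s"
    using laplace_integrable_power[OF e(1) s, of 0] laplace_integrable_power[OF e(2) s, of 0]
    by (simp add: laplace_def distrib_left)
  also have "\<dots> = s powr (\<alpha> - 2) / (s powr \<alpha> + 1)"
    using s ml_kernel_stieltjes[OF \<alpha>, of s] laplace_ml_cut[OF \<alpha>, of s] laplace_ml_osc[OF \<alpha>, of s]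
    by (simp add: has_bochner_integral_iff)
  also have "\<dots> = laplace (ml_mode \<alpha> 1) s"
    using \<alpha> b s by (subst laplace_ml_mode[of \<alpha> 1 2]) auto
  finally show ?thesis by simp
  qed
  show ?thesis using laplace_inject[OF 1 2 3 4 t 5] .
qed

text \<open>Since \<open>ml_kernel \<alpha> x\<close> is at least a multiple of \<open>e\<^bsup>(\<alpha>-1)x\<^esup>\<close> for \<open>x \<le> 0\<close>, the unit interval
  ending at \<open>x = - ln t\<close>, on which \<open>t e\<^sup>x \<le> 1\<close>, already contributes a multiple of
  \<open>t\<^bsup>1-\<alpha>\<^esup>\<close>.\<close>

lemma ml_cut_lower:
  assumes \<alpha>: "1 < \<alpha>" "\<alpha> < 2"
  obtains c where "c > 0" "\<And>t. t \<ge> 1 \<Longrightarrow> ml_cut \<alpha> t \<ge> c * t powr (1 - \<alpha>)"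
proof -
  define s where "s = sin (pi * \<alpha>)"
  have s: "s < 0" unfolding s_def by (rule sin_pi_neg[OF \<alpha>])
  define c1 where "c1 = (- s) / (4 * pi)"
  have c1: "c1 > 0" using s by (simp add: c1_def divide_neg_pos)
  have k: "ml_kernel \<alpha> x \<ge> c1 * exp ((\<alpha> - 1) * x)" if x: "x \<le> 0" for x
  proof -
    define u where "u = exp (\<alpha> * x)"
    define D where "D = (1 + u * cos (pi * \<alpha>))\<^sup>2 + (u * s)\<^sup>2"
    have D: "s\<^sup>2 \<le> D" "D \<le> (1 + u)\<^sup>2" using ml_kernel_den(1,3)[of \<alpha> x] by (simp_all add: D_def u_def s_def)
    have s2: "s\<^sup>2 > 0" using s by simp
    hence Dpos: "D > 0" using D(1) by linarith
    have "u \<le> 1" using x \<alpha> by (simp add: u_def mult_nonneg_nonpos)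
    hence "(1 + u)\<^sup>2 \<le> 2\<^sup>2" by (intro power_mono) (auto simp: u_def)
    with D have D4: "D \<le> 4" by simp
    have "c1 * exp ((\<alpha> - 1) * x) = (1 / pi) * exp ((\<alpha> - 1) * x) * (- s) / 4" unfolding c1_def by (simp add: field_simps)
    also have "\<dots> \<le> (1 / pi) * exp ((\<alpha> - 1) * x) * (- s) / D"
      using s D4 Dpos by (intro divide_left_mono mult_nonneg_nonneg) auto
    also have "\<dots> = ml_kernel \<alpha> x" unfolding ml_kernel_def D_def u_def s_def by simp
    finally show ?thesis .
  qed
  define c where "c = exp (-1) * (c1 * exp (- (\<alpha> - 1)))"
  show ?thesis
  proof (rule that)
    show "c > 0" using c1 by (simp add: c_def)
    fix t :: real assume t: "t \<ge> 1"
    have lnt: "ln t \<ge> 0" using t by simp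
    have "(LINT x|lborel. (c * t powr (1 - \<alpha>)) * indicator {- ln t - 1..- ln t} x) \<le> ml_cut \<alpha> t"
      unfolding ml_cut_def
    proof (rule integral_mono)
      show "integrable lborel (\<lambda>x. exp (- t * exp x) * ml_kernel \<alpha> x)"
        using t by (intro ml_cut_integrable[OF \<alpha>]) auto
      show "integrable lborel (\<lambda>x. (c * t powr (1 - \<alpha>)) * indicator {- ln t - 1..- ln t} x :: real)"
        by (intro integrable_mult_right integrable_real_indicator) (auto simp: emeasure_lborel_Icc_eq)
      fix x
      show "(c * t powr (1 - \<alpha>)) * indicator {- ln t - 1..- ln t} x \<le> exp (- t * exp x) * ml_kernel \<alpha> x"
      proof (cases "x \<in> {- ln t - 1..- ln t}")
        case True
        hence x: "x \<le> - ln t" "x \<ge> - ln t - 1" by auto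
        have "exp x \<le> exp (- ln t)" using x by simp
        hence "t * exp x \<le> 1" using t by (simp add: exp_minus field_simps)
        hence e1: "exp (-1) \<le> exp (- t * exp x)" by simp
        have "(\<alpha> - 1) * (- ln t - 1) \<le> (\<alpha> - 1) * x" using x \<alpha> by (intro mult_left_mono) auto
        hence "exp ((\<alpha> - 1) * (- ln t - 1)) \<le> exp ((\<alpha> - 1) * x)" by simp
        moreover have "exp ((\<alpha> - 1) * (- ln t - 1)) = exp (- (\<alpha> - 1)) * t powr (1 - \<alpha>)"
          using t by (simp add: powr_def algebra_simps flip: exp_add)
        ultimately have "c1 * (exp (- (\<alpha> - 1)) * t powr (1 - \<alpha>)) \<le> c1 * exp ((\<alpha> - 1) * x)"
          using c1 by (intro mult_left_mono) auto
        also have "\<dots> \<le> ml_kernel \<alpha> x" using x lnt by (intro k) linarith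
        finally have "exp (-1) * (c1 * (exp (- (\<alpha> - 1)) * t powr (1 - \<alpha>))) \<le> exp (- t * exp x) * ml_kernel \<alpha> x"
          using e1 c1 by (intro mult_mono) auto
        thus ?thesis using True by (simp add: c_def mult_ac)
      qed (use ml_kernel_nonneg[OF \<alpha>, of x] in auto)
    qed
    thus "ml_cut \<alpha> t \<ge> c * t powr (1 - \<alpha>)" by simp
  qed
qed

text \<open>For \<open>z = t\<^sup>\<alpha>\<close> one has \<open>z E\<^bsub>\<alpha>,2\<^esub>(-z) = t\<^bsup>\<alpha>-1\<^esup> (t E\<^bsub>\<alpha>,2\<^esub>(-t\<^sup>\<alpha>))\<close>; the cut contributes at
  least a constant, the oscillation tends to 0.\<close>

lemma mittag_leffler_lower_large:
  assumes \<alpha>: "1 < \<alpha>" "\<alpha> < 2"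
  obtains c z1 where "c > 0" "z1 > 0" "\<And>z. z \<ge> z1 \<Longrightarrow> z * mittag_leffler \<alpha> 2 (- z) \<ge> c"
proof -
  obtain c where c: "c > 0" "\<And>t. t \<ge> 1 \<Longrightarrow> ml_cut \<alpha> t \<ge> c * t powr (1 - \<alpha>)"
    using ml_cut_lower[OF \<alpha>] by blast
  define g where "g = - Re (ml_root \<alpha>)"
  have g: "g > 0" using Re_ml_root_neg[OF \<alpha>] by (simp add: g_def)
  \<comment> \<open>Beyond \<open>t1\<close> the oscillation takes away at most half of the constant \<open>c\<close>.\<close>
  define t1 where "t1 = max 1 (8 / (c * g\<^sup>2))"
  have t1: "t1 \<ge> 1" "t1 \<ge> 8 / (c * g\<^sup>2)" by (auto simp: t1_def)
  have main: "t powr (\<alpha> - 1) * ml_mode \<alpha> 1 t \<ge> c / 2" if t: "t \<ge> t1" for t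
  proof -
    have t0: "t \<ge> 1" "t > 0" using t t1 by auto
    have "1 + g * t + (g * t)\<^sup>2 / 2 \<le> exp (g * t)"
      using g t0 by (intro exp_lower_Taylor_quadratic) auto
    hence "(g * t)\<^sup>2 / 2 \<le> exp (g * t)" using g t0 by (smt (verit) mult_pos_pos)
    hence "exp (- (g * t)) \<le> 2 / (g * t)\<^sup>2" using g t0 by (simp add: exp_minus field_simps)
    have "t powr (\<alpha> - 1) \<le> t powr 1" using \<alpha> t0 by (intro powr_mono) auto
    hence "t powr (\<alpha> - 1) * \<bar>ml_osc \<alpha> t\<bar> \<le> t * (2 * (2 / (g * t)\<^sup>2))"
      using t0 norm_ml_osc[OF \<alpha>(1), of t] \<open>exp (- (g * t)) \<le> 2 / (g * t)\<^sup>2\<close>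
      by (intro mult_mono) (auto simp: g_def mult.commute)
    also have "\<dots> = 4 / (g\<^sup>2 * t)" using t0 by (simp add: power2_eq_square)
    also have "\<dots> \<le> 4 / (g\<^sup>2 * (8 / (c * g\<^sup>2)))"
      using t t1 g c t0 by (intro divide_left_mono mult_left_mono) auto
    also have "\<dots> = c / 2" using g c by (simp add: field_simps)
    finally have osc: "t powr (\<alpha> - 1) * \<bar>ml_osc \<alpha> t\<bar> \<le> c / 2" .
    have "t powr (\<alpha> - 1) * (c * t powr (1 - \<alpha>)) \<le> t powr (\<alpha> - 1) * ml_cut \<alpha> t"
      using c(2)[OF t0(1)] by (intro mult_left_mono) auto
    moreover have "t powr (\<alpha> - 1) * (c * t powr (1 - \<alpha>)) = c"
    proof -
      have "t powr (\<alpha> - 1) * t powr (1 - \<alpha>) = 1" using t0 by (simp flip: powr_add)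
      thus ?thesis by (simp add: mult.left_commute)
    qed
    moreover have "t powr (\<alpha> - 1) * (- \<bar>ml_osc \<alpha> t\<bar>) \<le> t powr (\<alpha> - 1) * ml_osc \<alpha> t"
      by (intro mult_left_mono) auto
    hence "t powr (\<alpha> - 1) * ml_osc \<alpha> t \<ge> - (t powr (\<alpha> - 1) * \<bar>ml_osc \<alpha> t\<bar>)"
      by (simp only: mult_minus_right)
    ultimately show ?thesis using osc
      unfolding ml_mode_decomp[OF \<alpha> t0(2)] distrib_left by linarith
  qed
  show ?thesis
  proof (rule that)
    show "c / 2 > 0" "t1 powr \<alpha> > 0" using c t1 by auto
    fix z :: real assume z: "z \<ge> t1 powr \<alpha>"
    have "t1 powr \<alpha> > 0" using t1 by simp
    with z have z0: "z > 0" by linarith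
    define t where "t = z powr (1 / \<alpha>)"
    have tz: "t powr \<alpha> = z" using z0 \<alpha> by (simp add: t_def powr_powr)
    have "(t1 powr \<alpha>) powr (1 / \<alpha>) \<le> t" unfolding t_def using z \<alpha> by (intro powr_mono2) auto
    hence "t1 \<le> t" using \<alpha> t1 by (simp add: powr_powr)
    from main[OF this] have "t powr (\<alpha> - 1) * t * mittag_leffler \<alpha> 2 (- z) \<ge> c / 2"
      by (simp add: ml_mode_def tz mult.assoc)
    moreover have "t powr (\<alpha> - 1) * t = z" using \<open>t1 \<le> t\<close> t1 tz by (simp add: powr_diff)
    ultimately show "z * mittag_leffler \<alpha> 2 (- z) \<ge> c / 2" by simp
  qed
qed

section \<open>Positivity for orders up to 4/3\<close>

lemma laplace_one_minus_cos_sq: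
  fixes p :: real
  assumes p: "p > 0"
  shows "laplace (\<lambda>x. (1 - cos x)\<^sup>2) p = 6 / (p * (p\<^sup>2 + 1) * (p\<^sup>2 + 4))"
proof -
  let ?c = "\<lambda>b x. indicator {0..} x * (exp (- p * x) * cos (b * x))"
  note c = has_bochner_integral_exp_cos[OF p]
  have "has_bochner_integral lborel (\<lambda>x. 3 / 2 * ?c 0 x - 2 * ?c 1 x + 1 / 2 * ?c 2 x)
      (3 / 2 * (p / (p\<^sup>2 + 0\<^sup>2)) - 2 * (p / (p\<^sup>2 + 1\<^sup>2)) + 1 / 2 * (p / (p\<^sup>2 + 2\<^sup>2)))"
    by (intro has_bochner_integral_add has_bochner_integral_diff has_bochner_integral_mult_right c)
  also have "(\<lambda>x. 3 / 2 * ?c 0 x - 2 * ?c 1 x + 1 / 2 * ?c 2 x) = (\<lambda>x. indicator {0..} x * (exp (- p * x) * (1 - cos x)\<^sup>2))"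
  proof
    fix x :: real
    have "(1 - cos x)\<^sup>2 = 3 / 2 * cos (0 * x) - 2 * cos (1 * x) + 1 / 2 * cos (2 * x)"
      by (simp only: cos_double_cos) (simp add: power2_eq_square algebra_simps)
    thus "3 / 2 * ?c 0 x - 2 * ?c 1 x + 1 / 2 * ?c 2 x = indicator {0..} x * (exp (- p * x) * (1 - cos x)\<^sup>2)"
      by (simp only:) (simp add: algebra_simps)
  qed
  finally have "laplace (\<lambda>x. (1 - cos x)\<^sup>2) p = 3 / 2 * (p / (p\<^sup>2 + 0\<^sup>2)) - 2 * (p / (p\<^sup>2 + 1\<^sup>2)) + 1 / 2 * (p / (p\<^sup>2 + 2\<^sup>2))"
    by (simp add: laplace_def has_bochner_integral_iff)
  also have "\<dots> = 6 / (p * (p\<^sup>2 + 1) * (p\<^sup>2 + 4))"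
  proof -
    have nz: "p\<^sup>2 + 1 \<noteq> 0" "p\<^sup>2 + 4 \<noteq> 0" using p by (auto simp: add_nonneg_eq_0_iff)
    have "3 / 2 * (p / (p\<^sup>2 + 0\<^sup>2)) = 3 / 2 * (1 / p)" using p by (simp add: power2_eq_square)
    moreover have "3 / 2 * (1 / p) - 2 * (p / (p\<^sup>2 + 1)) + 1 / 2 * (p / (p\<^sup>2 + 4)) = 6 / (p * (p\<^sup>2 + 1) * (p\<^sup>2 + 4))"
      using p nz by (simp add: divide_simps) algebra
    ultimately show ?thesis by simp
  qed
  finally show ?thesis .
qed

text \<open>The transform of \<open>t (E\<^bsub>\<alpha>,2\<^esub>(-t\<^sup>\<alpha>) - E\<^bsub>\<alpha>,2\<^esub>(-4t\<^sup>\<alpha>))\<close> is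
  \<open>3 s\<^bsup>\<alpha>-2\<^esup> / ((s\<^sup>\<alpha> + 1) (s\<^sup>\<alpha> + 4))\<close>, a product of a nonpositive power of \<open>s\<close> with the transform
  of \<open>(1 - cos x)\<^sup>2\<close> at \<open>s\<^bsup>\<alpha>/2\<^esup>\<close>.\<close>

lemma mittag_leffler_dilation:
  assumes \<alpha>: "1 < \<alpha>" "\<alpha> \<le> 4 / 3" and z: "z > 0"
  shows "mittag_leffler \<alpha> 2 (- (4 * z)) \<le> mittag_leffler \<alpha> 2 (- z)"
proof -
  define f where "f = (\<lambda>x. ml_mode \<alpha> 1 x - ml_mode \<alpha> 4 x)"
  \<comment> \<open>The exponential type \<open>8\<close> serves for both \<open>\<kappa> = 1\<close> and \<open>\<kappa> = 4\<close>.\<close>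
  have "(8::real) powr 1 < 8 powr \<alpha>" using \<alpha> by (intro powr_less_mono) auto
  hence b8: "1 < (8::real) powr \<alpha>" "4 < (8::real) powr \<alpha>" by simp_all
  have bd: "exp_bounded 8 (ml_mode \<alpha> 1)" "exp_bounded 8 (ml_mode \<alpha> 4)"
    using \<alpha> b8 by (auto intro!: exp_bounded_ml_mode)
  define t where "t = z powr (1 / \<alpha>)"
  have t: "t > 0" "t powr \<alpha> = z" using z \<alpha> by (simp_all add: t_def powr_powr)
  have "f t \<ge> 0"
  proof (rule nonneg_of_laplace_cm_upto[where b = 8 and f = f and t = t])
    show "exp_bounded 8 f" unfolding f_def by (intro exp_bounded_diff bd)
    show "isCont f t" unfolding f_def using \<alpha> t by (intro continuous_intros isCont_ml_mode) auto
    fix n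
    let ?W = "laplace (\<lambda>x. x ^ 0 * (1 - cos x)\<^sup>2)"
    have W: "cm_upto n 0 ?W" for n
    proof (rule cm_upto_laplace[where m = 0 and w = "\<lambda>x. (1 - cos x)\<^sup>2"])
      have "\<bar>(1 - cos x)\<^sup>2\<bar> \<le> 4 * exp (0 * x)" for x :: real
      proof -
        have "\<bar>1 - cos x\<bar> \<le> 2" using cos_ge_minus_one[of x] cos_le_one[of x] by linarith
        from power_mono[OF this, of 2] show ?thesis by simp
      qed
      thus "exp_bounded 0 (\<lambda>x. (1 - cos x)\<^sup>2)" unfolding exp_bounded_def by (intro conjI exI[of _ 4]) auto
    qed auto
    have comp: "cm_upto n 0 (\<lambda>s. ?W (s powr (\<alpha> / 2)))"
    proof (rule cm_upto_compose[OF _ _ _ W])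
      show "((\<lambda>s. s powr (\<alpha> / 2)) has_real_derivative (\<alpha> / 2) * s powr (- (1 - \<alpha> / 2))) (at s)" if "s > 0" for s
        using that by (auto intro!: derivative_eq_intros)
      show "cm_upto n 0 (\<lambda>s. (\<alpha> / 2) * s powr (- (1 - \<alpha> / 2)))" for n
        using \<alpha> by (intro cm_upto_powr) auto
    qed auto
    have "cm_upto n 0 (\<lambda>s. (1 / 2 * s powr (- (2 - 3 * \<alpha> / 2))) * ?W (s powr (\<alpha> / 2)))"
      using \<alpha> by (intro cm_upto_mult comp cm_upto_powr) auto
    hence "cm_upto n 8 (\<lambda>s. (1 / 2 * s powr (- (2 - 3 * \<alpha> / 2))) * ?W (s powr (\<alpha> / 2)))"
      by (rule cm_upto_weaken) simp
    thus "cm_upto n 8 (laplace f)"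
    proof (rule cm_upto_cong)
      fix s :: real assume s: "s > 8"
      define A where "A = s powr \<alpha>"
      have A: "A > 0" using s by (simp add: A_def)
      have sq: "(s powr (\<alpha> / 2))\<^sup>2 = A" using s by (simp add: A_def powr_power)
      have "?W (s powr (\<alpha> / 2)) = 6 / (s powr (\<alpha> / 2) * (A + 1) * (A + 4))"
        using laplace_one_minus_cos_sq[of "s powr (\<alpha> / 2)"] s by (simp add: sq)
      moreover have "s powr (- (2 - 3 * \<alpha> / 2)) = s powr (\<alpha> - 2) * s powr (\<alpha> / 2)"
        by (simp flip: powr_add)
      ultimately have "(1 / 2 * s powr (- (2 - 3 * \<alpha> / 2))) * ?W (s powr (\<alpha> / 2)) = s powr (\<alpha> - 2) * (3 / ((A + 1) * (A + 4)))"
        using s by simp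
      also have "3 / ((A + 1) * (A + 4)) = 1 / (A + 1) - 1 / (A + 4)"
        using A by (simp add: field_simps)
      also have "s powr (\<alpha> - 2) * (1 / (A + 1) - 1 / (A + 4)) = s powr (\<alpha> - 2) / (A + 1) - s powr (\<alpha> - 2) / (A + 4)"
        by (simp add: right_diff_distrib)
      also have "\<dots> = laplace (ml_mode \<alpha> 1) s - laplace (ml_mode \<alpha> 4) s"
        unfolding A_def using \<alpha> b8 s laplace_ml_mode[of \<alpha> 1 8 s] laplace_ml_mode[of \<alpha> 4 8 s] by simp
      also have "\<dots> = laplace f s" unfolding f_def by (rule laplace_diff[OF bd s, symmetric])
      finally show "(1 / 2 * s powr (- (2 - 3 * \<alpha> / 2))) * ?W (s powr (\<alpha> / 2)) = laplace f s" .
    qed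
  qed (rule t)
  hence "t * (mittag_leffler \<alpha> 2 (- (4 * z))) \<le> t * mittag_leffler \<alpha> 2 (- z)"
    by (simp add: f_def ml_mode_def t)
  thus ?thesis using t by simp
qed

lemma mittag_leffler_pos:
  assumes \<alpha>: "1 < \<alpha>" "\<alpha> \<le> 4 / 3" and z: "z > 0"
  shows "mittag_leffler \<alpha> 2 (- z) > 0"
proof -
  have \<alpha>2: "\<alpha> < 2" using \<alpha> by simp
  have mono: "mittag_leffler \<alpha> 2 (- (4 ^ m * z)) \<le> mittag_leffler \<alpha> 2 (- z)" for m
  proof (induction m)
    case (Suc m)
    have "mittag_leffler \<alpha> 2 (- (4 * (4 ^ m * z))) \<le> mittag_leffler \<alpha> 2 (- (4 ^ m * z))"
      using z by (intro mittag_leffler_dilation[OF \<alpha>]) simp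
    with Suc show ?case by (simp add: mult.assoc)
  qed simp
  obtain c z1 where c: "c > 0" "\<And>z. z \<ge> z1 \<Longrightarrow> z * mittag_leffler \<alpha> 2 (- z) \<ge> c"
    using mittag_leffler_lower_large[OF \<alpha>(1) \<alpha>2] by blast
  obtain m where "z1 / z < 4 ^ m" using real_arch_pow[of 4 "z1 / z"] by auto
  hence "4 ^ m * z \<ge> z1" using z by (simp add: field_simps)
  from c(2)[OF this] c(1) have "(4 ^ m * z) * mittag_leffler \<alpha> 2 (- (4 ^ m * z)) > 0" by linarith
  hence "mittag_leffler \<alpha> 2 (- (4 ^ m * z)) > 0"
    by (rule zero_less_mult_pos) (use z in simp)
  with mono[of m] show ?thesis by linarith
qed

lemma mittag_leffler_lower:
  assumes \<alpha>: "1 < \<alpha>" "\<alpha> \<le> 4 / 3" and z0: "z0 > 0"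
  obtains c where "c > 0" "\<And>z. z \<ge> z0 \<Longrightarrow> z * mittag_leffler \<alpha> 2 (- z) \<ge> c"
proof -
  have \<alpha>2: "\<alpha> < 2" using \<alpha> by simp
  obtain c z1 where c: "c > 0" "\<And>z. z \<ge> z1 \<Longrightarrow> z * mittag_leffler \<alpha> 2 (- z) \<ge> c"
    using mittag_leffler_lower_large[OF \<alpha>(1) \<alpha>2] by blast
  have "continuous_on {z0..max z0 z1} (\<lambda>z. z * mittag_leffler \<alpha> 2 (- z))"
    by (intro continuous_at_imp_continuous_on ballI continuous_intros isCont_o2[OF _ isCont_mittag_leffler]) (use \<alpha> in auto)
  then obtain y where y: "y \<in> {z0..max z0 z1}" "\<And>z. z \<in> {z0..max z0 z1} \<Longrightarrow> y * mittag_leffler \<alpha> 2 (- y) \<le> z * mittag_leffler \<alpha> 2 (- z)"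
    using continuous_attains_inf[of "{z0..max z0 z1}" "\<lambda>z. z * mittag_leffler \<alpha> 2 (- z)"] by auto
  show ?thesis
  proof (rule that)
    show "min c (y * mittag_leffler \<alpha> 2 (- y)) > 0"
      using c y z0 mittag_leffler_pos[OF \<alpha>, of y] by simp
    show "z * mittag_leffler \<alpha> 2 (- z) \<ge> min c (y * mittag_leffler \<alpha> 2 (- y))" if "z \<ge> z0" for z
      using c(2)[of z] y(2)[of z] that by (cases "z \<le> max z0 z1") (auto simp: min_le_iff_disj)
  qed
qed

section \<open>Volterra equations with fractional kernels\<close>

lemma has_integral_Beta_scaled:
  fixes a b s t :: real
  assumes a: "a > 0" and b: "b > 0" and st: "s < t"
  shows "((\<lambda>x. (t - x) powr (a - 1) * (x - s) powr (b - 1)) has_integral Beta b a * (t - s) powr (a + b - 1)) {s..t}"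
proof -
  define m where "m = 1 / (t - s)"
  define c where "c = - s / (t - s)"
  have m: "m > 0" using st by (simp add: m_def)
  have ends: "(0 - c) /\<^sub>R m = s" "(1 - c) /\<^sub>R m = t" using st by (simp_all add: c_def m_def field_simps)
  have "((\<lambda>x. (m *\<^sub>R x + c) powr (b - 1) * (1 - (m *\<^sub>R x + c)) powr (a - 1)) has_integral Beta b a /\<^sub>R m ^ DIM(real))
      (cbox ((0 - c) /\<^sub>R m) ((1 - c) /\<^sub>R m))"
    using has_integral_Beta_real[OF b a] m by (intro has_integral_affinity') auto
  hence "((\<lambda>x. (m *\<^sub>R x + c) powr (b - 1) * (1 - (m *\<^sub>R x + c)) powr (a - 1)) has_integral Beta b a * (t - s)) {s..t}"
    unfolding ends by (simp add: m_def mult.commute)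
  hence "((\<lambda>x. (t - s) powr (a + b - 2) * ((m *\<^sub>R x + c) powr (b - 1) * (1 - (m *\<^sub>R x + c)) powr (a - 1)))
      has_integral (t - s) powr (a + b - 2) * (Beta b a * (t - s))) {s..t}"
    by (rule has_integral_mult_right)
  also have "(t - s) powr (a + b - 2) * (Beta b a * (t - s)) = Beta b a * (t - s) powr (a + b - 1)"
  proof -
    have "(t - s) powr (a + b - 1) = (t - s) powr ((a + b - 2) + 1)" by (simp add: algebra_simps)
    also have "\<dots> = (t - s) powr (a + b - 2) * (t - s)" using st by (subst powr_add) simp
    finally show ?thesis by simp
  qed
  finally show ?thesis
  proof (rule has_integral_eq[rotated])
    fix x assume x: "x \<in> {s..t}"
    have 1: "m *\<^sub>R x + c = (x - s) / (t - s)" by (simp add: m_def c_def diff_divide_distrib)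
    have 2: "1 - (x - s) / (t - s) = (t - x) / (t - s)" using st by (simp add: field_simps)
    have "(t - s) powr (a + b - 2) = (t - s) powr (b - 1) * (t - s) powr (a - 1)"
      by (simp add: algebra_simps flip: powr_add)
    thus "(t - s) powr (a + b - 2) * ((m *\<^sub>R x + c) powr (b - 1) * (1 - (m *\<^sub>R x + c)) powr (a - 1))
        = (t - x) powr (a - 1) * (x - s) powr (b - 1)"
      unfolding 1 2 using x st by (simp add: powr_divide)
  qed
qed

text \<open>The fractional integral of order \<open>\<alpha>\<close>, here multiplied by \<open>\<Gamma>(\<alpha>)\<close>, raises the index in
  \<open>x\<^bsup>\<alpha>k+1\<^esup> / \<Gamma>(\<alpha>k+2)\<close> by one.\<close>

lemma frac_integral_powr:
  fixes \<alpha> t :: real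
  assumes \<alpha>: "\<alpha> > 0" and t: "t \<ge> 0"
  shows "((\<lambda>x. (t - x) powr (\<alpha> - 1) * (x powr (\<alpha> * real k + 1) / Gamma (\<alpha> * real k + 2))) has_integral
           Gamma \<alpha> * (t powr (\<alpha> * real (Suc k) + 1) / Gamma (\<alpha> * real (Suc k) + 2))) {0..t}"
proof (cases "t = 0")
  case True
  thus ?thesis using has_integral_null_real[of 0 0] by (simp add: has_integral_refl)
next
  case False
  let ?b = "\<alpha> * real k + 2"
  have ak: "\<alpha> * real k \<ge> 0" using \<alpha> by simp
  have "((\<lambda>x. (t - x) powr (\<alpha> - 1) * (x - 0) powr (?b - 1)) has_integral Beta ?b \<alpha> * (t - 0) powr (\<alpha> + ?b - 1)) {0..t}"
    using \<alpha> t False ak by (intro has_integral_Beta_scaled) linarith+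
  hence "((\<lambda>x. (t - x) powr (\<alpha> - 1) * (x - 0) powr (?b - 1) / Gamma ?b) has_integral Beta ?b \<alpha> * (t - 0) powr (\<alpha> + ?b - 1) / Gamma ?b) {0..t}"
    by (rule has_integral_divide)
  moreover have "Beta ?b \<alpha> * (t - 0) powr (\<alpha> + ?b - 1) / Gamma ?b = Gamma \<alpha> * (t powr (\<alpha> * real (Suc k) + 1) / Gamma (\<alpha> * real (Suc k) + 2))"
  proof -
    have "Gamma ?b > 0" using ak by (intro Gamma_real_pos) linarith
    hence nz: "Gamma ?b \<noteq> 0" by simp
    have e: "?b + \<alpha> = \<alpha> * real (Suc k) + 2" "\<alpha> + ?b - 1 = \<alpha> * real (Suc k) + 1" by (simp_all add: algebra_simps)
    show ?thesis unfolding Beta_def e diff_zero using nz by simp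
  qed
  moreover have "?b - 1 = \<alpha> * real k + 1" by simp
  ultimately show ?thesis by simp
qed

lemma continuous_on_frac_kernel:
  fixes \<alpha> t :: real
  assumes "\<alpha> > 1"
  shows "continuous_on {0..t} (\<lambda>x. (t - x) powr (\<alpha> - 1))"
  by (intro continuous_on_powr' continuous_intros) (use assms in auto)

text \<open>Picard iteration. The remainder \<open>R n\<close> after subtracting \<open>n\<close> terms of the series satisfies
  \<open>R (n + 1) = -\<kappa> I\<^sup>\<alpha> (R n)\<close>, and as the kernel is bounded it is at most \<open>M (L t)\<^sup>n / n!\<close>.\<close>

lemma volterra_solution:
  fixes \<psi> :: "real \<Rightarrow> real"
  assumes \<alpha>: "\<alpha> > 1" and \<kappa>: "\<kappa> \<ge> 0" and b: "b > 0" and cont: "continuous_on {0..b} \<psi>"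
    and eq: "\<And>t. t \<in> {0..b} \<Longrightarrow> \<psi> t = a * t - \<kappa> / Gamma \<alpha> * integral {0..t} (\<lambda>x. (t - x) powr (\<alpha> - 1) * \<psi> x)"
  shows "\<psi> b = a * ml_mode \<alpha> \<kappa> b"
proof -
  define q where "q = (\<lambda>k x. (- \<kappa>) ^ k * (x powr (\<alpha> * real k + 1) / Gamma (\<alpha> * real k + 2)))"
  define R where "R = (\<lambda>n t. \<psi> t - a * (\<Sum>k<n. q k t))"
  have Gpos: "Gamma \<alpha> > 0" using \<alpha> by (intro Gamma_real_pos) simp
  have ker: "continuous_on {0..t} (\<lambda>x. (t - x) powr (\<alpha> - 1))" for t by (rule continuous_on_frac_kernel[OF \<alpha>])
  have ak: "\<alpha> * real k + 1 > 0" for k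
  proof -
    have "\<alpha> * real k \<ge> 0" using \<alpha> by simp
    thus ?thesis by linarith
  qed
  have qcont: "continuous_on {0..t} (q k)" for k t
    unfolding q_def divide_inverse
    by (intro continuous_on_mult continuous_on_const continuous_on_powr' continuous_on_id) (use ak in auto)
  have Rcont: "continuous_on {0..t} (R n)" if "t \<in> {0..b}" for n t
    unfolding R_def using that
    by (intro continuous_on_diff continuous_on_mult continuous_on_const continuous_on_sum qcont
        continuous_on_subset[OF cont]) auto
  have qint: "((\<lambda>x. (t - x) powr (\<alpha> - 1) * q k x) has_integral - (Gamma \<alpha> / \<kappa>) * q (Suc k) t) {0..t}"
    if "t \<ge> 0" "\<kappa> > 0" for k t
  proof -
    have "((\<lambda>x. (- \<kappa>) ^ k * ((t - x) powr (\<alpha> - 1) * (x powr (\<alpha> * real k + 1) / Gamma (\<alpha> * real k + 2)))) has_integral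
        (- \<kappa>) ^ k * (Gamma \<alpha> * (t powr (\<alpha> * real (Suc k) + 1) / Gamma (\<alpha> * real (Suc k) + 2)))) {0..t}"
      using \<alpha> that by (intro has_integral_mult_right frac_integral_powr) auto
    moreover have "(- \<kappa>) ^ k * (Gamma \<alpha> * (t powr (\<alpha> * real (Suc k) + 1) / Gamma (\<alpha> * real (Suc k) + 2))) = - (Gamma \<alpha> / \<kappa>) * q (Suc k) t"
      using that by (simp add: q_def)
    ultimately show ?thesis using that by (simp add: q_def mult.left_commute)
  qed
  have rec: "R (Suc n) t = - (\<kappa> / Gamma \<alpha>) * integral {0..t} (\<lambda>x. (t - x) powr (\<alpha> - 1) * R n x)"
    if t: "t \<in> {0..b}" for n t
  proof (cases "\<kappa> = 0")
    case True
    have "(\<Sum>k<Suc n. q k t) = t"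
    proof -
      have "(\<Sum>k<Suc n. q k t) = q 0 t + (\<Sum>k<n. q (Suc k) t)" by (rule sum.lessThan_Suc_shift)
      thus ?thesis using True t by (simp add: q_def Gamma_numeral)
    qed
    thus ?thesis using eq[OF t] True by (simp add: R_def)
  next
    case False
    with \<kappa> have k: "\<kappa> > 0" by simp
    have t0: "t \<ge> 0" using t by simp
    have i1: "(\<lambda>x. (t - x) powr (\<alpha> - 1) * \<psi> x) integrable_on {0..t}"
      using t by (intro integrable_continuous_real continuous_on_mult ker continuous_on_subset[OF cont]) auto
    have i2: "((\<lambda>x. a * (\<Sum>k<n. (t - x) powr (\<alpha> - 1) * q k x)) has_integral a * (\<Sum>k<n. - (Gamma \<alpha> / \<kappa>) * q (Suc k) t)) {0..t}"
      by (intro has_integral_mult_right has_integral_sum qint t0 k) auto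
    have "((\<lambda>x. (t - x) powr (\<alpha> - 1) * \<psi> x - a * (\<Sum>k<n. (t - x) powr (\<alpha> - 1) * q k x)) has_integral
        integral {0..t} (\<lambda>x. (t - x) powr (\<alpha> - 1) * \<psi> x) - a * (\<Sum>k<n. - (Gamma \<alpha> / \<kappa>) * q (Suc k) t)) {0..t}"
      by (intro has_integral_diff integrable_integral i1 i2)
    also have "(\<lambda>x. (t - x) powr (\<alpha> - 1) * \<psi> x - a * (\<Sum>k<n. (t - x) powr (\<alpha> - 1) * q k x)) = (\<lambda>x. (t - x) powr (\<alpha> - 1) * R n x)"
      by (simp add: R_def right_diff_distrib sum_distrib_left mult.left_commute)
    finally have "integral {0..t} (\<lambda>x. (t - x) powr (\<alpha> - 1) * R n x)
        = integral {0..t} (\<lambda>x. (t - x) powr (\<alpha> - 1) * \<psi> x) + a * (Gamma \<alpha> / \<kappa>) * (\<Sum>k<n. q (Suc k) t)"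
      by (simp add: integral_unique sum_distrib_left sum_negf mult.assoc)
    hence "- (\<kappa> / Gamma \<alpha>) * integral {0..t} (\<lambda>x. (t - x) powr (\<alpha> - 1) * R n x)
        = (\<psi> t - a * t) - a * (\<Sum>k<n. q (Suc k) t)"
      using eq[OF t] k Gpos by (simp add: algebra_simps)
    also have "\<dots> = \<psi> t - a * (q 0 t + (\<Sum>k<n. q (Suc k) t))"
      using t0 by (simp add: q_def Gamma_numeral algebra_simps)
    also have "q 0 t + (\<Sum>k<n. q (Suc k) t) = (\<Sum>k<Suc n. q k t)" by (rule sum.lessThan_Suc_shift[symmetric])
    finally show ?thesis by (simp only: R_def)
  qed
  obtain M where M: "\<And>t. t \<in> {0..b} \<Longrightarrow> \<bar>\<psi> t\<bar> \<le> M"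
  proof -
    have "bounded (\<psi> ` {0..b})" by (intro compact_imp_bounded compact_continuous_image cont) auto
    then obtain B where "\<forall>y\<in>\<psi> ` {0..b}. norm y \<le> B" by (auto simp: bounded_iff)
    thus ?thesis by (intro that[of B]) auto
  qed
  define L where "L = \<kappa> / Gamma \<alpha> * b powr (\<alpha> - 1)"
  have L: "L \<ge> 0" using \<kappa> Gpos by (simp add: L_def)
  have bound: "\<bar>R n t\<bar> \<le> M * L ^ n * (t ^ n / fact n)" if "t \<in> {0..b}" for n t
    using that
  proof (induction n arbitrary: t)
    case 0
    thus ?case using M by (simp add: R_def)
  next
    case (Suc n)
    let ?B = "\<lambda>x. b powr (\<alpha> - 1) * (M * L ^ n * (x ^ n / fact n))"
    have pw: "((\<lambda>x. x ^ n / fact n) has_integral t ^ Suc n / fact (Suc n) - 0 ^ Suc n / fact (Suc n)) {0..t}"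
    proof (rule fundamental_theorem_of_calculus)
      fix x :: real
      have "((\<lambda>x. x ^ Suc n / fact (Suc n)) has_real_derivative (real (Suc n) * x ^ n) / fact (Suc n)) (at x within {0..t})"
        using DERIV_cdivide[OF DERIV_pow[of "Suc n" x "{0..t}"], of "fact (Suc n)"]
        by (simp only: diff_Suc_Suc diff_zero)
      also have "(real (Suc n) * x ^ n) / fact (Suc n) = x ^ n / fact n"
        by (simp only: fact_Suc of_nat_mult) (simp del: of_nat_Suc)
      finally show "((\<lambda>x. x ^ Suc n / fact (Suc n)) has_vector_derivative x ^ n / fact n) (at x within {0..t})"
        unfolding has_real_derivative_iff_has_vector_derivative .
    qed (use Suc in auto)
    have Bint: "(?B has_integral b powr (\<alpha> - 1) * (M * L ^ n * (t ^ Suc n / fact (Suc n)))) {0..t}"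
      using pw by (intro has_integral_mult_right) simp
    have "norm (integral {0..t} (\<lambda>x. (t - x) powr (\<alpha> - 1) * R n x)) \<le> integral {0..t} ?B"
    proof (rule integral_norm_bound_integral)
      show "(\<lambda>x. (t - x) powr (\<alpha> - 1) * R n x) integrable_on {0..t}"
        using Suc.prems by (intro integrable_continuous_real continuous_on_mult ker Rcont)
      show "?B integrable_on {0..t}" using Bint by blast
      fix x assume x: "x \<in> {0..t}"
      have "(t - x) powr (\<alpha> - 1) \<le> b powr (\<alpha> - 1)" using x Suc.prems \<alpha> by (intro powr_mono2) auto
      moreover have "\<bar>R n x\<bar> \<le> M * L ^ n * (x ^ n / fact n)" using x Suc.prems by (intro Suc.IH) auto
      ultimately show "norm ((t - x) powr (\<alpha> - 1) * R n x) \<le> ?B x"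
        unfolding real_norm_def abs_mult by (intro mult_mono) auto
    qed
    also have "\<dots> = b powr (\<alpha> - 1) * (M * L ^ n * (t ^ Suc n / fact (Suc n)))" using Bint by (rule integral_unique)
    finally have *: "\<bar>integral {0..t} (\<lambda>x. (t - x) powr (\<alpha> - 1) * R n x)\<bar> \<le> b powr (\<alpha> - 1) * (M * L ^ n * (t ^ Suc n / fact (Suc n)))"
      by simp
    have "\<bar>R (Suc n) t\<bar> = \<kappa> / Gamma \<alpha> * \<bar>integral {0..t} (\<lambda>x. (t - x) powr (\<alpha> - 1) * R n x)\<bar>"
      unfolding rec[OF Suc.prems] using \<kappa> Gpos by (simp add: abs_mult)
    also have "\<dots> \<le> \<kappa> / Gamma \<alpha> * (b powr (\<alpha> - 1) * (M * L ^ n * (t ^ Suc n / fact (Suc n))))"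
      using * \<kappa> Gpos by (intro mult_left_mono) auto
    also have "\<dots> = M * L ^ Suc n * (t ^ Suc n / fact (Suc n))" by (simp add: L_def)
    finally show ?case .
  qed
  have "(\<lambda>n. R n b) \<longlonglongrightarrow> 0"
  proof (rule Lim_null_comparison)
    show "eventually (\<lambda>n. norm (R n b) \<le> M * (inverse (fact n) * (L * b) ^ n)) sequentially"
    proof (intro always_eventually allI)
      fix n
      have "norm (R n b) \<le> M * L ^ n * (b ^ n / fact n)" using bound[of b n] b by simp
      also have "\<dots> = M * (inverse (fact n) * (L * b) ^ n)" by (simp add: power_mult_distrib divide_inverse mult_ac)
      finally show "norm (R n b) \<le> M * (inverse (fact n) * (L * b) ^ n)" .
    qed
    have "(\<lambda>n. inverse (fact n) * (L * b) ^ n) \<longlonglongrightarrow> 0" by (rule summable_LIMSEQ_zero[OF summable_exp])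
    from tendsto_mult_left[OF this, of M] show "(\<lambda>n. M * (inverse (fact n) * (L * b) ^ n)) \<longlonglongrightarrow> 0" by simp
  qed
  moreover have "(\<lambda>n. R n b) \<longlonglongrightarrow> \<psi> b - a * ml_mode \<alpha> \<kappa> b"
    unfolding R_def using ml_mode_sums[of \<alpha> b \<kappa>] \<alpha> b
    by (intro tendsto_intros) (simp add: sums_def q_def)
  ultimately have "0 = \<psi> b - a * ml_mode \<alpha> \<kappa> b" by (rule LIMSEQ_unique)
  thus ?thesis by simp
qed

lemma frac_kernel_convolution:
  fixes \<alpha> t \<tau> :: real
  assumes \<alpha>: "1 < \<alpha>" "\<alpha> < 2" and \<tau>: "\<tau> < t"
  shows "has_bochner_integral lborel
           (\<lambda>\<sigma>. indicator {\<tau><..<t} \<sigma> * ((t - \<sigma>) powr (\<alpha> - 1) * (\<sigma> - \<tau>) powr (1 - \<alpha>)))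
           (Gamma \<alpha> * Gamma (2 - \<alpha>) * (t - \<tau>))"
proof -
  let ?f = "\<lambda>\<sigma>. (t - \<sigma>) powr (\<alpha> - 1) * (\<sigma> - \<tau>) powr (1 - \<alpha>)"
  have "(?f has_integral Beta (2 - \<alpha>) \<alpha> * (t - \<tau>) powr 1) {\<tau>..t}"
    using has_integral_Beta_scaled[of \<alpha> "2 - \<alpha>" \<tau> t] \<alpha> \<tau> by simp
  also have "Beta (2 - \<alpha>) \<alpha> = Gamma \<alpha> * Gamma (2 - \<alpha>)"
    by (simp add: Beta_def Gamma_numeral)
  finally have "(?f has_integral Gamma \<alpha> * Gamma (2 - \<alpha>) * (t - \<tau>)) {\<tau>..t}" using \<tau> by simp
  hence "(?f has_integral Gamma \<alpha> * Gamma (2 - \<alpha>) * (t - \<tau>)) {\<tau><..<t}"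
    by (simp add: has_integral_Icc_iff_Ioo)
  hence "((\<lambda>\<sigma>. if \<sigma> \<in> {\<tau><..<t} then ?f \<sigma> else 0) has_integral Gamma \<alpha> * Gamma (2 - \<alpha>) * (t - \<tau>)) UNIV"
    by (simp only: has_integral_restrict_UNIV)
  also have "(\<lambda>\<sigma>. if \<sigma> \<in> {\<tau><..<t} then ?f \<sigma> else 0) = (\<lambda>\<sigma>. indicator {\<tau><..<t} \<sigma> * ?f \<sigma>)"
    by (auto simp: indicator_def fun_eq_iff)
  finally have hi: "((\<lambda>\<sigma>. indicator {\<tau><..<t} \<sigma> * ?f \<sigma>) has_integral Gamma \<alpha> * Gamma (2 - \<alpha>) * (t - \<tau>)) UNIV" .
  show ?thesis
  proof (rule has_bochner_integral_nn_integral)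
    show "Gamma \<alpha> * Gamma (2 - \<alpha>) * (t - \<tau>) \<ge> 0"
      using \<alpha> \<tau> by (intro mult_nonneg_nonneg Gamma_real_nonneg) auto
    show "(\<integral>\<^sup>+ \<sigma>. ennreal (indicator {\<tau><..<t} \<sigma> * ?f \<sigma>) \<partial>lborel) = ennreal (Gamma \<alpha> * Gamma (2 - \<alpha>) * (t - \<tau>))"
      by (rule nn_integral_has_integral_lborel[OF _ _ hi]) auto
  qed auto
qed

text \<open>The composition rule \<open>I\<^sup>\<alpha> I\<^bsup>2-\<alpha>\<^esup> g = I\<^sup>2 g\<close>, multiplied by \<open>\<Gamma>(\<alpha>) \<Gamma>(2-\<alpha>)\<close>, by Fubini and the
  Beta integral.\<close>

lemma frac_integral_semigroup:
  fixes \<alpha> t :: real and g :: "real \<Rightarrow> real"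
  assumes \<alpha>: "1 < \<alpha>" "\<alpha> < 2" and t: "t > 0" and g: "set_integrable lborel {0<..<t} g"
  shows "(LINT \<sigma>|lborel. indicator {0<..<t} \<sigma> * ((t - \<sigma>) powr (\<alpha> - 1) *
             (LINT \<tau>:{0<..<\<sigma>}|lborel. (\<sigma> - \<tau>) powr (1 - \<alpha>) * g \<tau>)))
       = Gamma \<alpha> * Gamma (2 - \<alpha>) * (LINT \<tau>:{0<..<t}|lborel. (t - \<tau>) * g \<tau>)"
proof -
  define h where "h = (\<lambda>\<tau>. indicator {0<..<t} \<tau> * g \<tau>)"
  have h: "integrable lborel h" using g by (simp add: h_def set_integrable_def)
  hence [measurable]: "h \<in> borel_measurable borel" by (simp add: borel_measurable_integrable)
  define c where "c = Gamma \<alpha> * Gamma (2 - \<alpha>)"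
  define k where "k = (\<lambda>\<tau> \<sigma>. indicator {\<tau><..<t} \<sigma> * ((t - \<sigma>) powr (\<alpha> - 1) * (\<sigma> - \<tau>) powr (1 - \<alpha>)))"
  have k: "has_bochner_integral lborel (k \<tau>) (c * (t - \<tau>))" if "\<tau> < t" for \<tau>
    unfolding k_def c_def by (rule frac_kernel_convolution[OF \<alpha> that])
  have k_nonneg: "k \<tau> \<sigma> \<ge> 0" for \<tau> \<sigma> by (simp add: k_def)
  have [measurable]: "(\<lambda>(\<tau>, \<sigma>). k \<tau> \<sigma>) \<in> borel_measurable (lborel \<Otimes>\<^sub>M lborel)"
  proof -
    have eq: "(\<lambda>(\<tau>, \<sigma>). k \<tau> \<sigma>) = (\<lambda>z. (if fst z < snd z \<and> snd z < t then 1 else 0) * ((t - snd z) powr (\<alpha> - 1) * (snd z - fst z) powr (1 - \<alpha>)))"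
      by (auto simp: k_def indicator_def fun_eq_iff)
    show ?thesis unfolding eq by measurable
  qed
  have hk: "has_bochner_integral lborel (\<lambda>\<sigma>. h \<tau> * k \<tau> \<sigma>) (h \<tau> * (c * (t - \<tau>)))" for \<tau>
  proof (cases "\<tau> < t")
    case True
    show ?thesis by (intro has_bochner_integral_mult_right k True)
  next
    case False
    hence "h \<tau> = 0" by (simp add: h_def)
    thus ?thesis by (simp add: has_bochner_integral_zero)
  qed
  have int: "integrable (lborel \<Otimes>\<^sub>M lborel) (\<lambda>(\<tau>, \<sigma>). h \<tau> * k \<tau> \<sigma>)"
  proof (rule lborel_pair.Fubini_integrable)
    show "(\<lambda>(\<tau>, \<sigma>). h \<tau> * k \<tau> \<sigma>) \<in> borel_measurable (lborel \<Otimes>\<^sub>M lborel)"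
      by measurable
    show "AE \<tau> in lborel. integrable lborel (\<lambda>\<sigma>. case (\<tau>, \<sigma>) of (\<tau>, \<sigma>) \<Rightarrow> h \<tau> * k \<tau> \<sigma>)"
      using hk by (auto simp: has_bochner_integral_iff)
    have "(LINT \<sigma>|lborel. norm (h \<tau> * k \<tau> \<sigma>)) = \<bar>h \<tau> * (c * (t - \<tau>))\<bar>" for \<tau>
    proof (cases "\<tau> < t")
      case True
      have "(LINT \<sigma>|lborel. norm (h \<tau> * k \<tau> \<sigma>)) = (LINT \<sigma>|lborel. \<bar>h \<tau>\<bar> * k \<tau> \<sigma>)"
        using k_nonneg by (simp add: abs_mult)
      also have "\<dots> = \<bar>h \<tau>\<bar> * (c * (t - \<tau>))" using k[OF True] by (simp add: has_bochner_integral_iff)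
      also have "\<dots> = \<bar>h \<tau> * (c * (t - \<tau>))\<bar>"
        using True \<alpha> by (simp add: abs_mult c_def)
      finally show ?thesis .
    next
      case False
      hence "h \<tau> = 0" by (simp add: h_def)
      thus ?thesis by simp
    qed
    moreover have "integrable lborel (\<lambda>\<tau>. \<bar>h \<tau> * (c * (t - \<tau>))\<bar>)"
    proof (rule Bochner_Integration.integrable_bound)
      show "integrable lborel (\<lambda>\<tau>. (\<bar>c\<bar> * t) * h \<tau>)" using h by simp
      show "AE \<tau> in lborel. norm \<bar>h \<tau> * (c * (t - \<tau>))\<bar> \<le> norm ((\<bar>c\<bar> * t) * h \<tau>)"
      proof (intro AE_I2)
        fix \<tau>
        show "norm \<bar>h \<tau> * (c * (t - \<tau>))\<bar> \<le> norm ((\<bar>c\<bar> * t) * h \<tau>)"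
        proof (cases "\<tau> \<in> {0<..<t}")
          case True
          hence "\<bar>h \<tau>\<bar> * \<bar>c\<bar> * \<bar>t - \<tau>\<bar> \<le> \<bar>h \<tau>\<bar> * \<bar>c\<bar> * t" by (intro mult_left_mono) auto
          thus ?thesis using t by (simp add: abs_mult mult_ac)
        qed (simp add: h_def)
      qed
    qed measurable
    ultimately show "integrable lborel (\<lambda>\<tau>. LINT \<sigma>|lborel. norm (case (\<tau>, \<sigma>) of (\<tau>, \<sigma>) \<Rightarrow> h \<tau> * k \<tau> \<sigma>))"
      by simp
  qed
  have "(LINT \<sigma>|lborel. LINT \<tau>|lborel. h \<tau> * k \<tau> \<sigma>) = (LINT \<tau>|lborel. LINT \<sigma>|lborel. h \<tau> * k \<tau> \<sigma>)"
    by (rule lborel_pair.Fubini_integral[OF int])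
  also have "\<dots> = (LINT \<tau>|lborel. h \<tau> * (c * (t - \<tau>)))"
    by (simp only: has_bochner_integral_integral_eq[OF hk])
  also have "\<dots> = (LINT \<tau>|lborel. c * (indicator {0<..<t} \<tau> * ((t - \<tau>) * g \<tau>)))"
    by (intro Bochner_Integration.integral_cong) (auto simp: h_def mult_ac)
  also have "\<dots> = c * (LINT \<tau>:{0<..<t}|lborel. (t - \<tau>) * g \<tau>)"
    by (simp add: set_lebesgue_integral_def)
  finally have main: "(LINT \<sigma>|lborel. LINT \<tau>|lborel. h \<tau> * k \<tau> \<sigma>) = c * (LINT \<tau>:{0<..<t}|lborel. (t - \<tau>) * g \<tau>)" .
  have "(LINT \<tau>|lborel. h \<tau> * k \<tau> \<sigma>) = indicator {0<..<t} \<sigma> * ((t - \<sigma>) powr (\<alpha> - 1) *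
             (LINT \<tau>:{0<..<\<sigma>}|lborel. (\<sigma> - \<tau>) powr (1 - \<alpha>) * g \<tau>))" for \<sigma>
  proof -
    have "h \<tau> * k \<tau> \<sigma> = (indicator {0<..<t} \<sigma> * (t - \<sigma>) powr (\<alpha> - 1)) * (indicator {0<..<\<sigma>} \<tau> * ((\<sigma> - \<tau>) powr (1 - \<alpha>) * g \<tau>))" for \<tau>
      by (auto simp: h_def k_def indicator_def)
    thus ?thesis by (simp add: set_lebesgue_integral_def)
  qed
  with main show ?thesis by (simp add: c_def)
qed

text \<open>The function \<open>\<psi>(x) + (t - x) \<psi>'(x)\<close> has the integrable derivative \<open>(t - x) \<psi>''(x)\<close>, so \<open>\<psi>'\<close>
  has a limit at \<open>0\<close>. By l'Hospital's rule this limit is the one-sided derivative \<open>a\<close>; no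
  continuity of \<open>\<psi>'\<close> at 0 is assumed.\<close>

lemma taylor_from_endpoint:
  fixes \<psi> d1 d2 :: "real \<Rightarrow> real"
  assumes T: "0 < t" "t < T" 
    and cont: "continuous_on {0..T} \<psi>" and zero: "\<psi> 0 = 0"
    and d0: "(\<psi> has_real_derivative a) (at 0 within {0..T})"
    and d1: "\<And>x. x \<in> {0<..<T} \<Longrightarrow> (\<psi> has_real_derivative d1 x) (at x)"
    and d2: "\<And>x. x \<in> {0<..<T} \<Longrightarrow> (d1 has_real_derivative d2 x) (at x)"
    and int: "set_integrable lborel {0<..<t} d2"
  shows "\<psi> t = a * t + (LINT x:{0<..<t}|lborel. (t - x) * d2 x)"
proof -
  let ?I = "LINT x:{0<..<t}|lborel. (t - x) * d2 x"
  have int': "set_integrable lborel {0<..<t} (\<lambda>x. (t - x) * d2 x)"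
  proof -
    have meas: "(\<lambda>x. indicator {0<..<t} x * d2 x) \<in> borel_measurable borel"
      using int by (simp add: set_integrable_def borel_measurable_integrable)
    show ?thesis unfolding set_integrable_def
    proof (rule Bochner_Integration.integrable_bound)
      show "integrable lborel (\<lambda>x. t * (indicator {0<..<t} x * d2 x))"
        using int by (intro integrable_mult_right) (simp add: set_integrable_def)
      have "(\<lambda>x. (t - x) * (indicator {0<..<t} x * d2 x)) \<in> borel_measurable borel"
        using meas by measurable
      thus "(\<lambda>x. indicator {0<..<t} x *\<^sub>R ((t - x) * d2 x)) \<in> borel_measurable lborel"
        by (simp add: mult.left_commute)
      show "AE x in lborel. norm (indicator {0<..<t} x *\<^sub>R ((t - x) * d2 x)) \<le> norm (t * (indicator {0<..<t} x * d2 x))"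
        by (intro AE_I2) (auto simp: indicator_def abs_mult intro!: mult_right_mono)
    qed
  qed
  have step: "\<psi> t - (\<psi> e + (t - e) * d1 e) = (LINT x|lborel. indicator {e..t} x * (indicator {0<..<t} x * ((t - x) * d2 x)))"
    if e: "0 < e" "e < t" for e
  proof -
    have "((\<lambda>x. (t - x) * d2 x) has_integral ((\<psi> t + (t - t) * d1 t) - (\<psi> e + (t - e) * d1 e))) {e..t}"
    proof (rule fundamental_theorem_of_calculus)
      fix x assume "x \<in> {e..t}"
      hence x: "x \<in> {0<..<T}" using e T by auto
      show "((\<lambda>x. \<psi> x + (t - x) * d1 x) has_vector_derivative (t - x) * d2 x) (at x within {e..t})"
        unfolding has_real_derivative_iff_has_vector_derivative[symmetric]
        by (rule has_field_derivative_at_within) (auto intro!: derivative_eq_intros d1[OF x] d2[OF x])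
    qed (use e in auto)
    hence hi: "integral {e..t} (\<lambda>x. (t - x) * d2 x) = \<psi> t - (\<psi> e + (t - e) * d1 e)"
      by (simp add: integral_unique)
    have eint: "set_integrable lborel {e..<t} (\<lambda>x. (t - x) * d2 x)"
      by (rule set_integrable_subset[OF int']) (use e in auto)
    have "(LINT x|lborel. indicator {e..t} x * (indicator {0<..<t} x * ((t - x) * d2 x)))
        = (LINT x:{e..<t}|lborel. (t - x) * d2 x)"
      unfolding set_lebesgue_integral_def
      by (intro Bochner_Integration.integral_cong) (use e in \<open>auto simp: indicator_def\<close>)
    also have "\<dots> = integral {e..<t} (\<lambda>x. (t - x) * d2 x)"
      by (rule set_borel_integral_eq_integral(2)[OF eint])
    also have "\<dots> = integral {e..t} (\<lambda>x. (t - x) * d2 x)"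
      by (rule integral_spike_set) (auto intro: negligible_subset[of "{t}"])
    finally show ?thesis using hi by simp
  qed
  have lim_int: "((\<lambda>e. LINT x|lborel. indicator {e..t} x * (indicator {0<..<t} x * ((t - x) * d2 x))) \<longlongrightarrow> ?I) (at_right 0)"
    unfolding tendsto_at_iff_sequentially
  proof (intro allI impI)
    fix X :: "nat \<Rightarrow> real" assume X: "\<forall>i. X i \<in> {0<..} - {0}" "X \<longlonglongrightarrow> 0"
    have "(\<lambda>n. LINT x|lborel. indicator {X n..t} x * (indicator {0<..<t} x * ((t - x) * d2 x)))
        \<longlonglongrightarrow> (LINT x|lborel. indicator {0<..<t} x * ((t - x) * d2 x))"
    proof (rule integral_dominated_convergence[where w = "\<lambda>x. \<bar>indicator {0<..<t} x * ((t - x) * d2 x)\<bar>"])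
      have m: "integrable lborel (\<lambda>x. indicator {0<..<t} x * ((t - x) * d2 x))"
        using int' by (simp add: set_integrable_def)
      show "(\<lambda>x. indicator {0<..<t} x * ((t - x) * d2 x)) \<in> borel_measurable lborel"
        using m by (rule borel_measurable_integrable)
      show "(\<lambda>x. indicator {X n..t} x * (indicator {0<..<t} x * ((t - x) * d2 x))) \<in> borel_measurable lborel" for n
        using borel_measurable_integrable[OF m] by measurable
      show "integrable lborel (\<lambda>x. \<bar>indicator {0<..<t} x * ((t - x) * d2 x)\<bar>)"
        using m by (rule integrable_abs)
      show "AE x in lborel. (\<lambda>n. indicator {X n..t} x * (indicator {0<..<t} x * ((t - x) * d2 x))) \<longlonglongrightarrow> indicator {0<..<t} x * ((t - x) * d2 x)"
      proof (intro AE_I2 tendsto_eventually)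
        fix x
        show "eventually (\<lambda>n. indicator {X n..t} x * (indicator {0<..<t} x * ((t - x) * d2 x)) = indicator {0<..<t} x * ((t - x) * d2 x)) sequentially"
        proof (cases "x \<in> {0<..<t}")
          case True
          hence "eventually (\<lambda>n. X n < x) sequentially" by (intro order_tendstoD(2)[OF X(2)]) auto
          thus ?thesis by eventually_elim (use True in auto)
        qed auto
      qed
      show "AE x in lborel. norm (indicator {X n..t} x * (indicator {0<..<t} x * ((t - x) * d2 x))) \<le> \<bar>indicator {0<..<t} x * ((t - x) * d2 x)\<bar>" for n
        by (intro AE_I2) (auto simp: indicator_def)
    qed
    thus "((\<lambda>e. LINT x|lborel. indicator {e..t} x * (indicator {0<..<t} x * ((t - x) * d2 x))) \<circ> X) \<longlonglongrightarrow> ?I"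
      by (simp add: o_def set_lebesgue_integral_def)
  qed
  have ev: "eventually (\<lambda>e. e \<in> {0<..<t}) (at_right (0::real))"
    using T by (simp add: eventually_at_right_field) (auto intro: exI[of _ t])
  have psi0: "(\<psi> \<longlongrightarrow> 0) (at_right 0)"
  proof -
    have "(\<psi> \<longlongrightarrow> \<psi> 0) (at 0 within {0..T})" using cont T by (auto simp: continuous_on_def)
    thus ?thesis using T zero by (simp add: at_within_Icc_at_right)
  qed
  have lim1: "(d1 \<longlongrightarrow> (\<psi> t - ?I) / t) (at_right 0)"
  proof -
    have *: "((\<lambda>e. ((\<psi> t - \<psi> e) - (LINT x|lborel. indicator {e..t} x * (indicator {0<..<t} x * ((t - x) * d2 x)))) / (t - e))
        \<longlongrightarrow> ((\<psi> t - 0) - ?I) / (t - 0)) (at_right 0)"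
      using T by (intro tendsto_intros psi0 lim_int) auto
    have "eventually (\<lambda>e. ((\<psi> t - \<psi> e) - (LINT x|lborel. indicator {e..t} x * (indicator {0<..<t} x * ((t - x) * d2 x)))) / (t - e) = d1 e) (at_right 0)"
      using ev by eventually_elim (simp add: step[symmetric])
    with * have "(d1 \<longlongrightarrow> ((\<psi> t - 0) - ?I) / (t - 0)) (at_right 0)"
      by (rule Lim_transform_eventually)
    thus ?thesis by simp
  qed
  have "((\<lambda>x. \<psi> x / x) \<longlongrightarrow> (\<psi> t - ?I) / t) (at_right 0)"
  proof (rule lhopital_right_0[where f' = d1 and g' = "\<lambda>_. 1"])
    show "(\<psi> \<longlongrightarrow> 0) (at_right 0)" by (rule psi0)
    show "((\<lambda>x::real. x) \<longlongrightarrow> 0) (at_right 0)" by (rule tendsto_ident_at)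
    show "eventually (\<lambda>x::real. x \<noteq> 0) (at_right 0)" using ev by eventually_elim auto
    show "eventually (\<lambda>x. (\<psi> has_real_derivative d1 x) (at x)) (at_right 0)"
      using ev by eventually_elim (use T in \<open>auto intro!: d1\<close>)
    show "((\<lambda>x. d1 x / 1) \<longlongrightarrow> (\<psi> t - ?I) / t) (at_right 0)" using lim1 by simp
  qed auto
  moreover have "((\<lambda>x. \<psi> x / x) \<longlongrightarrow> a) (at_right 0)"
    using d0 T zero by (simp add: has_field_derivative_iff at_within_Icc_at_right)
  ultimately have "(\<psi> t - ?I) / t = a"
    by (intro tendsto_unique[OF trivial_limit_at_right_real])
  thus ?thesis using T by (simp add: field_simps)
qed

section \<open>Fourier coefficients of the solution and norms on the spectral scale\<close>

lemma L2_inner_commute: "L2_inner \<Omega> f g = L2_inner \<Omega> g f"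
  by (simp add: L2_inner_def mult.commute)

lemma dirichlet_form_commute: "dirichlet_form \<Omega> f g = dirichlet_form \<Omega> g f"
  by (simp add: dirichlet_form_def inner_commute)

text \<open>By symmetry of the Dirichlet form, eigenfunctions of different eigenvalues are orthogonal. An
  eigenfunction whose eigenvalue does not occur in the first system would be orthogonal to a basis.\<close>

lemma eigenvalue_range_subset:
  assumes e: "dirichlet_eigensystem \<Omega> lam \<phi>" and e': "dirichlet_eigensystem \<Omega> lam' \<phi>'"
  shows "range lam' \<subseteq> range lam"
proof
  fix y assume "y \<in> range lam'"
  then obtain k where k: "y = lam' k" by blast
  show "y \<in> range lam"
  proof (rule ccontr)
    assume neq: "y \<notin> range lam"
    have orth: "L2_inner \<Omega> (\<phi>' k) (\<phi> n) = 0" for n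
    proof -
      have h: "\<phi> n \<in> H10 \<Omega>" "\<phi>' k \<in> H10 \<Omega>"
        using e e' by (auto simp: dirichlet_eigensystem_def)
      have "dirichlet_form \<Omega> (\<phi>' k) (\<phi> n) = lam' k * L2_inner \<Omega> (\<phi>' k) (\<phi> n)"
        using e' h by (auto simp: dirichlet_eigensystem_def)
      moreover have "dirichlet_form \<Omega> (\<phi> n) (\<phi>' k) = lam n * L2_inner \<Omega> (\<phi> n) (\<phi>' k)"
        using e h by (auto simp: dirichlet_eigensystem_def)
      ultimately have "(lam' k - lam n) * L2_inner \<Omega> (\<phi>' k) (\<phi> n) = 0"
        by (simp add: dirichlet_form_commute[of \<Omega> "\<phi> n"] L2_inner_commute[of \<Omega> "\<phi> n"] left_diff_distrib)
      moreover have "lam' k \<noteq> lam n" using neq k by auto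
      ultimately show ?thesis by simp
    qed
    have "\<phi>' k \<in> L2 \<Omega>" "L2_inner \<Omega> (\<phi>' k) (\<phi>' k) = 1"
      using e' by (auto simp: dirichlet_eigensystem_def L2_orthonormal_basis_def)
    moreover have "(\<lambda>N. L2_norm \<Omega> (\<lambda>x. \<phi>' k x - (\<Sum>j<N. L2_inner \<Omega> (\<phi>' k) (\<phi> j) * \<phi> j x))) \<longlonglongrightarrow> 0"
      using e \<open>\<phi>' k \<in> L2 \<Omega>\<close> by (auto simp: dirichlet_eigensystem_def L2_orthonormal_basis_def)
    ultimately show False by (simp add: orth L2_norm_def LIMSEQ_const_iff)
  qed
qed

lemma eigenvalue_pos:
  assumes "dirichlet_eigensystem \<Omega> lam \<phi>"
  shows "lam n > 0"
proof -
  have "lam 0 > 0" "lam 0 \<le> lam n"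
    using assms by (auto simp: dirichlet_eigensystem_def incseq_def)
  thus ?thesis by linarith
qed

text \<open>The Volterra equation holds on \<open>(0, T)\<close>, where the fractional equation is given; the value at
  \<open>T\<close> follows by continuity.\<close>

lemma fractional_mode_solution:
  fixes \<psi> :: "real \<Rightarrow> real"
  assumes \<alpha>: "1 < \<alpha>" "\<alpha> < 2" and T: "T > 0" and \<kappa>: "\<kappa> \<ge> 0"
    and cont: "continuous_on {0..T} \<psi>" and zero: "\<psi> 0 = 0"
    and d0: "(\<psi> has_real_derivative a) (at 0 within {0..T})"
    and cap: "\<And>t. t \<in> {0<..<T} \<Longrightarrow> caputo_differentiable \<alpha> \<psi> t \<and> caputo_deriv \<alpha> \<psi> t + \<kappa> * \<psi> t = 0"
  shows "\<psi> T = a * ml_mode \<alpha> \<kappa> T"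
proof -
  have G: "Gamma \<alpha> > 0" "Gamma (2 - \<alpha>) > 0" using \<alpha> by (auto intro!: Gamma_real_pos)
  have diff: "(\<psi> has_real_derivative deriv \<psi> x) (at x)" "(deriv \<psi> has_real_derivative deriv (deriv \<psi>) x) (at x)"
    if "x \<in> {0<..<T}" for x
  proof -
    \<comment> \<open>Differentiability at \<open>x\<close> is part of the hypothesis at any later time, here the midpoint.\<close>
    have "(x + T) / 2 \<in> {0<..<T}" "x \<in> {0<..<(x + T) / 2}" using that by auto
    with cap have "\<psi> differentiable at x" "deriv \<psi> differentiable at x"
      unfolding caputo_differentiable_def by blast+
    thus "(\<psi> has_real_derivative deriv \<psi> x) (at x)" "(deriv \<psi> has_real_derivative deriv (deriv \<psi>) x) (at x)"
      by (simp_all add: DERIV_deriv_iff_real_differentiable)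
  qed
  have volterra: "\<psi> t = a * t - \<kappa> / Gamma \<alpha> * integral {0..t} (\<lambda>x. (t - x) powr (\<alpha> - 1) * \<psi> x)"
    if t: "t \<in> {0<..<T}" for t
  proof -
    let ?g = "deriv (deriv \<psi>)"
    have t0: "t > 0" "t < T" using t by auto
    have int: "set_integrable lborel {0<..<t} ?g"
    proof -
      have I: "integrable lborel (\<lambda>x. indicator {0<..<t} x *\<^sub>R caputo_integrand \<alpha> \<psi> t x)"
        using cap[OF t] by (simp add: caputo_differentiable_def set_integrable_def)
      note [measurable] = borel_measurable_integrable[OF I]
      have eq: "indicator {0<..<t} x *\<^sub>R ?g x = (t - x) powr (\<alpha> - 1) * (indicator {0<..<t} x *\<^sub>R caputo_integrand \<alpha> \<psi> t x)" for x
      proof (cases "x \<in> {0<..<t}")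
        case True
        have "(t - x) powr (\<alpha> - 1) * (t - x) powr (1 - \<alpha>) = 1" using True by (simp flip: powr_add)
        thus ?thesis using True by (simp add: caputo_integrand_def mult.assoc[symmetric])
      qed auto
      show ?thesis unfolding set_integrable_def eq
      proof (rule Bochner_Integration.integrable_bound)
        show "integrable lborel (\<lambda>x. t powr (\<alpha> - 1) * (indicator {0<..<t} x *\<^sub>R caputo_integrand \<alpha> \<psi> t x))"
          using I by (rule integrable_mult_right)
        show "AE x in lborel. norm ((t - x) powr (\<alpha> - 1) * (indicator {0<..<t} x *\<^sub>R caputo_integrand \<alpha> \<psi> t x))
            \<le> norm (t powr (\<alpha> - 1) * (indicator {0<..<t} x *\<^sub>R caputo_integrand \<alpha> \<psi> t x))"
        proof (intro AE_I2)
          fix x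
          show "norm ((t - x) powr (\<alpha> - 1) * (indicator {0<..<t} x *\<^sub>R caputo_integrand \<alpha> \<psi> t x))
            \<le> norm (t powr (\<alpha> - 1) * (indicator {0<..<t} x *\<^sub>R caputo_integrand \<alpha> \<psi> t x))"
          proof (cases "x \<in> {0<..<t}")
            case True
            have "(t - x) powr (\<alpha> - 1) \<le> t powr (\<alpha> - 1)" using True \<alpha> by (intro powr_mono2) auto
            thus ?thesis unfolding norm_mult by (intro mult_right_mono) auto
          qed auto
        qed
      qed measurable
    qed
    have taylor: "\<psi> t = a * t + (LINT x:{0<..<t}|lborel. (t - x) * ?g x)"
      by (rule taylor_from_endpoint[OF t0 cont zero d0 diff int])
    have inner: "(LINT \<tau>:{0<..<\<sigma>}|lborel. (\<sigma> - \<tau>) powr (1 - \<alpha>) * ?g \<tau>) = - (Gamma (2 - \<alpha>) * \<kappa>) * \<psi> \<sigma>"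
      if "\<sigma> \<in> {0<..<t}" for \<sigma>
    proof -
      have "\<sigma> \<in> {0<..<T}" using that t0 by auto
      from cap[OF this] have "1 / Gamma (2 - \<alpha>) * (LINT \<tau>:{0<..<\<sigma>}|lborel. caputo_integrand \<alpha> \<psi> \<sigma> \<tau>) = - (\<kappa> * \<psi> \<sigma>)"
        by (simp add: caputo_deriv_def)
      thus ?thesis using G by (simp add: caputo_integrand_def[abs_def] field_simps)
    qed
    let ?k = "\<lambda>x. (t - x) powr (\<alpha> - 1) * \<psi> x"
    have kcont: "continuous_on {0..t} ?k"
      using t0 by (intro continuous_on_mult continuous_on_frac_kernel \<alpha> continuous_on_subset[OF cont]) auto
    have "Gamma \<alpha> * Gamma (2 - \<alpha>) * (\<psi> t - a * t) =
      (LINT \<sigma>|lborel. indicator {0<..<t} \<sigma> * ((t - \<sigma>) powr (\<alpha> - 1) *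
             (LINT \<tau>:{0<..<\<sigma>}|lborel. (\<sigma> - \<tau>) powr (1 - \<alpha>) * ?g \<tau>)))"
      unfolding frac_integral_semigroup[OF \<alpha> t0(1) int] using taylor by simp
    also have "\<dots> = (LINT \<sigma>|lborel. - (Gamma (2 - \<alpha>) * \<kappa>) * (indicator {0<..<t} \<sigma> *\<^sub>R ?k \<sigma>))"
    proof (rule Bochner_Integration.integral_cong[OF refl])
      fix \<sigma>
      show "indicator {0<..<t} \<sigma> * ((t - \<sigma>) powr (\<alpha> - 1) *
             (LINT \<tau>:{0<..<\<sigma>}|lborel. (\<sigma> - \<tau>) powr (1 - \<alpha>) * ?g \<tau>)) = - (Gamma (2 - \<alpha>) * \<kappa>) * (indicator {0<..<t} \<sigma> *\<^sub>R ?k \<sigma>)"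
        by (cases "\<sigma> \<in> {0<..<t}") (simp_all add: inner)
    qed
    also have "\<dots> = - (Gamma (2 - \<alpha>) * \<kappa>) * (LINT \<sigma>:{0<..<t}|lborel. ?k \<sigma>)"
      unfolding set_lebesgue_integral_def by (rule integral_mult_right_zero)
    also have "(LINT \<sigma>:{0<..<t}|lborel. ?k \<sigma>) = integral {0<..<t} ?k"
      by (rule set_borel_integral_eq_integral(2), rule set_integrable_subset[OF borel_integrable_atLeastAtMost'[OF kcont]]) auto
    also have "\<dots> = integral {0..t} ?k" by (simp add: integral_open_interval_real)
    finally have "Gamma (2 - \<alpha>) * (Gamma \<alpha> * (\<psi> t - a * t)) = Gamma (2 - \<alpha>) * (- \<kappa> * integral {0..t} ?k)"
      by (simp add: mult_ac)
    moreover have "Gamma (2 - \<alpha>) \<noteq> 0" using G by simp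
    ultimately have "Gamma \<alpha> * (\<psi> t - a * t) = - \<kappa> * integral {0..t} ?k"
      using mult_left_cancel by blast
    thus ?thesis using G by (simp add: field_simps)
  qed
  have sol: "\<psi> b = a * ml_mode \<alpha> \<kappa> b" if b: "b \<in> {0<..<T}" for b
  proof (rule volterra_solution[OF \<alpha>(1) \<kappa>])
    show "continuous_on {0..b} \<psi>" by (rule continuous_on_subset[OF cont]) (use b in auto)
    fix t assume t: "t \<in> {0..b}"
    show "\<psi> t = a * t - \<kappa> / Gamma \<alpha> * integral {0..t} (\<lambda>x. (t - x) powr (\<alpha> - 1) * \<psi> x)"
    proof (cases "t = 0")
      case False
      thus ?thesis using t b by (intro volterra) auto
    qed (simp add: zero)
  qed (use b in auto)
  have "(\<psi> \<longlongrightarrow> \<psi> T) (at_left T)"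
  proof -
    have "(\<psi> \<longlongrightarrow> \<psi> T) (at T within {0..T})" using cont T by (auto simp: continuous_on_def)
    thus ?thesis using T by (simp add: at_within_Icc_at_left)
  qed
  moreover have "eventually (\<lambda>b. \<psi> b = a * ml_mode \<alpha> \<kappa> b) (at_left T)"
    using eventually_at_left_real[OF T] by eventually_elim (rule sol)
  ultimately have "((\<lambda>b. a * ml_mode \<alpha> \<kappa> b) \<longlongrightarrow> \<psi> T) (at_left T)"
    by (rule Lim_transform_eventually)
  moreover have "((\<lambda>b. a * ml_mode \<alpha> \<kappa> b) \<longlongrightarrow> a * ml_mode \<alpha> \<kappa> T) (at_left T)"
    using isCont_ml_mode[of \<alpha> T \<kappa>] \<alpha> T by (intro tendsto_intros) (auto simp: isCont_def intro: tendsto_within_subset)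
  ultimately show ?thesis
    by (intro tendsto_unique[OF trivial_limit_at_left_real])
qed

lemma weak_solution_coefficient:
  assumes \<alpha>: "1 < \<alpha>" "\<alpha> < 2" and T: "T > 0"
    and e: "dirichlet_eigensystem \<Omega> lam \<phi>" and u: "weak_solution \<Omega> \<alpha> T (\<lambda>x. 0) a1 u"
  shows "L2_inner \<Omega> (u T) (\<phi> n) = L2_inner \<Omega> a1 (\<phi> n) * ml_mode \<alpha> (lam n) T"
proof -
  have h: "\<phi> n \<in> H10 \<Omega>" "\<And>v. v \<in> H10 \<Omega> \<Longrightarrow> dirichlet_form \<Omega> (\<phi> n) v = lam n * L2_inner \<Omega> (\<phi> n) v"
    using e by (auto simp: dirichlet_eigensystem_def)
  have uH: "u t \<in> H10 \<Omega>" if "t \<in> {0<..<T}" for t using u that by (auto simp: weak_solution_def)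
  have test: "continuous_on {0..T} (\<lambda>t. L2_inner \<Omega> (u t) (\<phi> n))"
    "((\<lambda>t. L2_inner \<Omega> (u t) (\<phi> n)) has_real_derivative L2_inner \<Omega> a1 (\<phi> n)) (at 0 within {0..T})"
    "\<And>t. t \<in> {0<..<T} \<Longrightarrow> caputo_differentiable \<alpha> (\<lambda>t. L2_inner \<Omega> (u t) (\<phi> n)) t \<and>
           caputo_deriv \<alpha> (\<lambda>t. L2_inner \<Omega> (u t) (\<phi> n)) t + dirichlet_form \<Omega> (u t) (\<phi> n) = 0"
    using u h(1) by (auto simp: weak_solution_def Let_def)
  show ?thesis
  proof (rule fractional_mode_solution[OF \<alpha> T _ test(1) _ test(2)])
    show "lam n \<ge> 0" using eigenvalue_pos[OF e, of n] by simp
    have "AE x in lebesgue_on \<Omega>. u 0 x = 0" using u by (simp add: weak_solution_def)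
    hence "AE x in lebesgue_on \<Omega>. u 0 x * \<phi> n x = 0" by eventually_elim simp
    thus "L2_inner \<Omega> (u 0) (\<phi> n) = 0" unfolding L2_inner_def by (rule integral_eq_zero_AE)
    fix t assume t: "t \<in> {0<..<T}"
    have "dirichlet_form \<Omega> (u t) (\<phi> n) = lam n * L2_inner \<Omega> (u t) (\<phi> n)"
      using h(2)[OF uH[OF t]] by (simp add: dirichlet_form_commute[of \<Omega> "u t"] L2_inner_commute[of \<Omega> "u t"])
    with test(3)[OF t] show "caputo_differentiable \<alpha> (\<lambda>t. L2_inner \<Omega> (u t) (\<phi> n)) t \<and>
           caputo_deriv \<alpha> (\<lambda>t. L2_inner \<Omega> (u t) (\<phi> n)) t + lam n * L2_inner \<Omega> (u t) (\<phi> n) = 0"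
      by simp
  qed
qed

lemma D_norm_le:
  assumes C: "C > 0"
    and le: "\<And>n. \<bar>lam n powr \<beta> * L2_inner \<Omega> f (\<phi> n)\<bar> \<le> C * \<bar>lam n powr \<gamma> * L2_inner \<Omega> g (\<phi> n)\<bar>"
  shows "D_norm \<Omega> lam \<phi> \<beta> f \<le> ennreal C * D_norm \<Omega> lam \<phi> \<gamma> g"
proof -
  define F where "F = (\<lambda>n. ennreal (\<bar>lam n powr \<beta> * L2_inner \<Omega> f (\<phi> n)\<bar>\<^sup>2))"
  define G where "G = (\<lambda>n. ennreal (\<bar>lam n powr \<gamma> * L2_inner \<Omega> g (\<phi> n)\<bar>\<^sup>2))"
  have "F n \<le> ennreal (C\<^sup>2) * G n" for n
  proof -
    have "\<bar>lam n powr \<beta> * L2_inner \<Omega> f (\<phi> n)\<bar>\<^sup>2 \<le> (C * \<bar>lam n powr \<gamma> * L2_inner \<Omega> g (\<phi> n)\<bar>)\<^sup>2"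
      using le[of n] by (intro power_mono) auto
    thus ?thesis by (simp add: F_def G_def power_mult_distrib flip: ennreal_mult)
  qed
  hence "suminf F \<le> (\<Sum>n. ennreal (C\<^sup>2) * G n)" by (intro suminf_le) auto
  also have "\<dots> = ennreal (C\<^sup>2) * suminf G" by (rule ennreal_suminf_cmult)
  finally have S: "suminf F \<le> ennreal (C\<^sup>2) * suminf G" .
  have D: "D_norm \<Omega> lam \<phi> \<beta> f = (if suminf F = \<infinity> then \<infinity> else ennreal (sqrt (enn2real (suminf F))))"
    "D_norm \<Omega> lam \<phi> \<gamma> g = (if suminf G = \<infinity> then \<infinity> else ennreal (sqrt (enn2real (suminf G))))"
    by (simp_all add: D_norm_def F_def G_def Let_def)
  show ?thesis
  proof (cases "suminf G = \<infinity>")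
    case True
    thus ?thesis using C by (simp add: D ennreal_mult_top)
  next
    case False
    define r where "r = enn2real (suminf G)"
    have r: "suminf G = ennreal r" "r \<ge> 0" using False by (auto simp: r_def less_top)
    have S': "suminf F \<le> ennreal (C\<^sup>2 * r)" using S r by (simp add: ennreal_mult)
    hence fin: "suminf F \<noteq> \<infinity>" by (auto simp: top_unique)
    have "enn2real (suminf F) \<le> C\<^sup>2 * r" using S' r by (intro enn2real_leI) auto
    hence "sqrt (enn2real (suminf F)) \<le> sqrt (C\<^sup>2 * r)" by simp
    also have "\<dots> = C * sqrt r" using C by (simp add: real_sqrt_mult)
    finally have "sqrt (enn2real (suminf F)) \<le> C * sqrt r" .
    thus ?thesis using fin False C r(2) by (simp add: D r_def[symmetric] ennreal_leI flip: ennreal_mult)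
  qed
qed

lemma D_norm_bound:
  assumes \<alpha>: "1 < \<alpha>" "\<alpha> < 2" and T: "T > 0" and c: "c > 0"
    and e: "dirichlet_eigensystem \<Omega> lam \<phi>" and u: "weak_solution \<Omega> \<alpha> T (\<lambda>x. 0) a1 u"
    and low: "\<And>n. c \<le> (lam n * T powr \<alpha>) * \<bar>mittag_leffler \<alpha> 2 (- (lam n * T powr \<alpha>))\<bar>"
  shows "D_norm \<Omega> lam \<phi> (- \<gamma>) a1 \<le> ennreal (1 / c * T powr (\<alpha> - 1)) * D_norm \<Omega> lam \<phi> (1 - \<gamma>) (u T)"
proof (rule D_norm_le)
  show "1 / c * T powr (\<alpha> - 1) > 0" using c T by simp
  fix n
  have lam: "lam n > 0" by (rule eigenvalue_pos[OF e])
  define A where "A = \<bar>L2_inner \<Omega> a1 (\<phi> n)\<bar>"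
  define B where "B = \<bar>L2_inner \<Omega> (u T) (\<phi> n)\<bar>"
  define E where "E = \<bar>mittag_leffler \<alpha> 2 (- (lam n * T powr \<alpha>))\<bar>"
  have B: "B = A * (T * E)"
    using weak_solution_coefficient[OF \<alpha> T e u, of n] T
    by (simp add: A_def B_def E_def ml_mode_def abs_mult)
  have "A * c \<le> A * (lam n * T powr \<alpha> * E)"
    using low[of n] by (intro mult_left_mono) (auto simp: A_def E_def)
  also have "T powr \<alpha> = T powr (\<alpha> - 1) * T" using T by (simp add: powr_diff)
  also have "A * (lam n * (T powr (\<alpha> - 1) * T) * E) = lam n * T powr (\<alpha> - 1) * B"
    by (simp add: B mult_ac)
  finally have "A \<le> 1 / c * T powr (\<alpha> - 1) * (lam n * B)" using c by (simp add: field_simps)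
  hence "lam n powr (- \<gamma>) * A \<le> lam n powr (- \<gamma>) * (1 / c * T powr (\<alpha> - 1) * (lam n * B))"
    by (intro mult_left_mono) auto
  also have "\<dots> = 1 / c * T powr (\<alpha> - 1) * ((lam n powr (- \<gamma>) * lam n) * B)" by (simp add: mult_ac)
  also have "lam n powr (- \<gamma>) * lam n = lam n powr (1 - \<gamma>)"
    using lam by (simp add: powr_diff powr_minus divide_inverse)
  finally show "\<bar>lam n powr (- \<gamma>) * L2_inner \<Omega> a1 (\<phi> n)\<bar> \<le> 1 / c * T powr (\<alpha> - 1) * \<bar>lam n powr (1 - \<gamma>) * L2_inner \<Omega> (u T) (\<phi> n)\<bar>"
    by (simp add: A_def B_def abs_mult)
qed

text \<open>All but finitely many eigenvalues fall under the bound for large arguments.\<close>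

lemma spectrum_lower_bound:
  assumes \<alpha>: "1 < \<alpha>" "\<alpha> < 2" and T: "T > 0" and e: "dirichlet_eigensystem \<Omega> lam \<phi>"
    and nonroot: "T powr \<alpha> \<notin> (\<Union>k. (\<lambda>t. t / lam k) ` mlf_roots \<alpha>)"
  obtains c where "c > 0" "\<And>n. c \<le> (lam n * T powr \<alpha>) * \<bar>mittag_leffler \<alpha> 2 (- (lam n * T powr \<alpha>))\<bar>"
proof -
  define v where "v = (\<lambda>n. (lam n * T powr \<alpha>) * \<bar>mittag_leffler \<alpha> 2 (- (lam n * T powr \<alpha>))\<bar>)"
  have T\<alpha>: "T powr \<alpha> > 0" using T by simp
  have lam: "lam n > 0" for n by (rule eigenvalue_pos[OF e])
  have v: "v n > 0" for n
  proof -
    have "mittag_leffler \<alpha> 2 (- (lam n * T powr \<alpha>)) \<noteq> 0"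
    proof
      assume "mittag_leffler \<alpha> 2 (- (lam n * T powr \<alpha>)) = 0"
      hence "lam n * T powr \<alpha> \<in> mlf_roots \<alpha>" using lam T\<alpha> by (simp add: mlf_roots_def)
      moreover have "T powr \<alpha> = (lam n * T powr \<alpha>) / lam n" using lam[of n] by simp
      ultimately show False using nonroot by blast
    qed
    thus ?thesis using lam[of n] T\<alpha> by (simp add: v_def)
  qed
  obtain c1 z1 where c1: "c1 > 0" "\<And>z. z \<ge> z1 \<Longrightarrow> z * mittag_leffler \<alpha> 2 (- z) \<ge> c1"
    using mittag_leffler_lower_large[OF \<alpha>] by blast
  have "filterlim lam at_top sequentially" using e by (simp add: dirichlet_eigensystem_def)
  hence "eventually (\<lambda>n. lam n \<ge> z1 / T powr \<alpha>) sequentially" by (simp add: filterlim_at_top)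
  then obtain N where N: "\<And>n. n \<ge> N \<Longrightarrow> lam n \<ge> z1 / T powr \<alpha>" by (auto simp: eventually_sequentially)
  have tail: "v n \<ge> c1" if "n \<ge> N" for n
  proof -
    have "lam n * T powr \<alpha> \<ge> z1" using N[OF that] T\<alpha> by (simp add: field_simps)
    from c1(2)[OF this] have "c1 \<le> (lam n * T powr \<alpha>) * mittag_leffler \<alpha> 2 (- (lam n * T powr \<alpha>))" .
    also have "\<dots> \<le> v n" unfolding v_def using lam[of n] T\<alpha> by (intro mult_left_mono) auto
    finally show ?thesis .
  qed
  let ?M = "insert c1 (v ` {..<N})"
  show ?thesis
  proof (rule that)
    show "Min ?M > 0" using c1 v by (subst Min_gr_iff) auto
    fix n
    have "Min ?M \<le> v n"
    proof (cases "n < N")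
      case True
      thus ?thesis by (intro Min_le) auto
    next
      case False
      have "Min ?M \<le> c1" by (intro Min_le) auto
      with tail[of n] False show ?thesis by linarith
    qed
    thus "Min ?M \<le> (lam n * T powr \<alpha>) * \<bar>mittag_leffler \<alpha> 2 (- (lam n * T powr \<alpha>))\<bar>" by (simp add: v_def)
  qed
qed

theorem theorem1:
  fixes \<Omega> :: "(real^'d::finite) set" and \<alpha> \<gamma> :: real
  assumes "CARD('d) \<in> {1, 2, 3}"
    and "open \<Omega>" and "connected \<Omega>" and "\<Omega> \<noteq> {}" and "bounded \<Omega>"
    and "Ck_boundary 2 \<Omega>"
    and "1 < \<alpha>" and "\<alpha> < 2"
  shows "(\<forall>T>0. \<exists>C>0. \<forall>lam \<phi> a1 u.
            dirichlet_eigensystem \<Omega> lam \<phi> \<longrightarrow>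
            T powr \<alpha> \<notin> (\<Union>k. (\<lambda>t. t / lam k) ` mlf_roots \<alpha>) \<longrightarrow>
            a1 \<in> L2 \<Omega> \<longrightarrow>
            weak_solution \<Omega> \<alpha> T (\<lambda>x. 0) a1 u \<longrightarrow>
            D_norm \<Omega> lam \<phi> (- \<gamma>) a1 \<le> ennreal C * D_norm \<Omega> lam \<phi> (1 - \<gamma>) (u T)) \<and>
         (\<alpha> \<le> 4 / 3 \<longrightarrow>
           (\<forall>T0>0. \<exists>C>0. \<forall>T\<ge>T0. \<forall>lam \<phi> a1 u.
            dirichlet_eigensystem \<Omega> lam \<phi> \<longrightarrow>
            a1 \<in> L2 \<Omega> \<longrightarrow>
            weak_solution \<Omega> \<alpha> T (\<lambda>x. 0) a1 u \<longrightarrow>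
            D_norm \<Omega> lam \<phi> (- \<gamma>) a1 \<le>
              ennreal (C * T powr (\<alpha> - 1)) * D_norm \<Omega> lam \<phi> (1 - \<gamma>) (u T)))"
proof (intro conjI allI impI)
  note \<alpha> = \<open>1 < \<alpha>\<close> \<open>\<alpha> < 2\<close>
  let ?eig = "\<lambda>lam \<phi>. dirichlet_eigensystem \<Omega> lam \<phi>"
  fix T :: real assume T: "T > 0"
  let ?good = "\<lambda>lam. T powr \<alpha> \<notin> (\<Union>k. (\<lambda>t. t / lam k) ` mlf_roots \<alpha>)"
  show "\<exists>C>0. \<forall>lam \<phi> a1 u. ?eig lam \<phi> \<longrightarrow> ?good lam \<longrightarrow> a1 \<in> L2 \<Omega> \<longrightarrow>
      weak_solution \<Omega> \<alpha> T (\<lambda>x. 0) a1 u \<longrightarrow>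
      D_norm \<Omega> lam \<phi> (- \<gamma>) a1 \<le> ennreal C * D_norm \<Omega> lam \<phi> (1 - \<gamma>) (u T)"
  proof (cases "\<exists>lam \<phi>. ?eig lam \<phi> \<and> ?good lam")
    case True
    \<comment> \<open>The constant is taken from one fixed eigensystem; all others have the same eigenvalues.\<close>
    then obtain lam0 \<phi>0 where e0: "?eig lam0 \<phi>0" "?good lam0" by blast
    obtain c where c: "c > 0" 
      "\<And>n. c \<le> (lam0 n * T powr \<alpha>) * \<bar>mittag_leffler \<alpha> 2 (- (lam0 n * T powr \<alpha>))\<bar>"
      using spectrum_lower_bound[OF \<alpha> T e0] by blast
    show ?thesis
    proof (intro exI[of _ "1 / c * T powr (\<alpha> - 1)"] conjI allI impI)
      show "1 / c * T powr (\<alpha> - 1) > 0" using c T by simp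
      fix lam \<phi> a1 u assume e: "?eig lam \<phi>" and u: "weak_solution \<Omega> \<alpha> T (\<lambda>x. 0) a1 u"
      have "c \<le> (lam n * T powr \<alpha>) * \<bar>mittag_leffler \<alpha> 2 (- (lam n * T powr \<alpha>))\<bar>" for n
      proof -
        have "lam n \<in> range lam0" using eigenvalue_range_subset[OF e0(1) e] by blast
        with c(2) show ?thesis by auto
      qed
      thus "D_norm \<Omega> lam \<phi> (- \<gamma>) a1 \<le> ennreal (1 / c * T powr (\<alpha> - 1)) * D_norm \<Omega> lam \<phi> (1 - \<gamma>) (u T)"
        by (intro D_norm_bound[OF \<alpha> T c(1) e u])
    qed
  next
    \<comment> \<open>Nothing to prove, any constant will do.\<close>
    case False
    thus ?thesis by (intro exI[of _ 1]) auto
  qed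
next
  note \<alpha> = \<open>1 < \<alpha>\<close> \<open>\<alpha> < 2\<close>
  let ?eig = "\<lambda>lam \<phi>. dirichlet_eigensystem \<Omega> lam \<phi>"
  fix T0 :: real assume \<alpha>43: "\<alpha> \<le> 4 / 3" and T0: "T0 > 0"
  show "\<exists>C>0. \<forall>T\<ge>T0. \<forall>lam \<phi> a1 u. ?eig lam \<phi> \<longrightarrow> a1 \<in> L2 \<Omega> \<longrightarrow>
      weak_solution \<Omega> \<alpha> T (\<lambda>x. 0) a1 u \<longrightarrow>
      D_norm \<Omega> lam \<phi> (- \<gamma>) a1 \<le> ennreal (C * T powr (\<alpha> - 1)) * D_norm \<Omega> lam \<phi> (1 - \<gamma>) (u T)"
  proof (cases "\<exists>lam \<phi>. ?eig lam \<phi>")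
    case True
    then obtain lam0 \<phi>0 where e0: "?eig lam0 \<phi>0" by blast
    have z0: "lam0 0 * T0 powr \<alpha> > 0" using eigenvalue_pos[OF e0, of 0] T0 by simp
    obtain c where c: "c > 0" "\<And>z. z \<ge> lam0 0 * T0 powr \<alpha> \<Longrightarrow> z * mittag_leffler \<alpha> 2 (- z) \<ge> c"
      using mittag_leffler_lower[OF \<alpha>(1) \<alpha>43 z0] by blast
    show ?thesis
    proof (intro exI[of _ "1 / c"] conjI allI impI)
      show "1 / c > 0" using c by simp
      fix T lam \<phi> a1 u
      assume TT0: "T0 \<le> T" and e: "?eig lam \<phi>" and u: "weak_solution \<Omega> \<alpha> T (\<lambda>x. 0) a1 u"
      have T: "T > 0" using TT0 T0 by linarith
      have "c \<le> (lam n * T powr \<alpha>) * \<bar>mittag_leffler \<alpha> 2 (- (lam n * T powr \<alpha>))\<bar>" for n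
      proof -
        let ?z = "lam n * T powr \<alpha>"
        have "lam n \<in> range lam0" using eigenvalue_range_subset[OF e0 e] by blast
        hence "lam0 0 \<le> lam n" using e0 by (auto simp: dirichlet_eigensystem_def incseq_def)
        moreover have "T0 powr \<alpha> \<le> T powr \<alpha>" using TT0 T0 \<alpha> by (intro powr_mono2) auto
        ultimately have "lam0 0 * T0 powr \<alpha> \<le> ?z"
          using eigenvalue_pos[OF e, of n] by (intro mult_mono) auto
        from c(2)[OF this] have "c \<le> ?z * mittag_leffler \<alpha> 2 (- ?z)" .
        also have "\<dots> \<le> ?z * \<bar>mittag_leffler \<alpha> 2 (- ?z)\<bar>"
          using eigenvalue_pos[OF e, of n] T by (intro mult_left_mono) auto
        finally show ?thesis .
      qed
      thus "D_norm \<Omega> lam \<phi> (- \<gamma>) a1 \<le> ennreal (1 / c * T powr (\<alpha> - 1)) * D_norm \<Omega> lam \<phi> (1 - \<gamma>) (u T)"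
        by (intro D_norm_bound[OF \<alpha> T c(1) e u])
    qed
  next
    \<comment> \<open>Nothing to prove, any constant will do.\<close>
    case False
    thus ?thesis by (intro exI[of _ 1]) auto
  qed
qed

end
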